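(* Let $f\in L^2(\mathbb{R})$ be positive definite and continuous. Then the additive homogeneous Riemann-Hilbert problem for $f$ on the real line is solved by a decomposition $f=f_-+f_+$, where $f_+$ has Fourier transform supported in $[0,\infty)$ and $f_-$ has Fourier transform supported in $(-\infty,0]$. The functions $f_+$ and $f_-$ are positive definite. Furthermore, $$f_{+}(w)=\lim_{h\to 0}\sum_{n=-\infty}^{\infty}f(nh)\,\frac{\exp(\pi i(w/h-n))-1}{2\pi i(w/h-n)}$$ and $$f_{-}(w)=\lim_{h\to 0}\sum_{n=-\infty}^{\infty}f(nh)\,\frac{1-\exp(-i\pi(w/h-n))}{2\pi i(w/h-n)}.$$
   Context: Positive definiteness: a function $f$ on the real line is called positive definite if its Fourier transform exists everywhere and takes non-negative real values; this is used interchangeably with Bochner's criterion, that for every finite set of points $x_1,\dots,x_m\in\mathbb{R}$ the matrix $[f(x_i-x_j)]$ is positive semi-definite (Hermitian with non-negative eigenvalues). Additive homogeneous Riemann-Hilbert problem on $\mathbb{R}$ (up to the sign convention for the lower function): given $f$ on $\mathbb{R}$, find a function $f_+$ that is the boundary value on $\mathbb{R}$ of a function holomorphic in the upper half plane, and a function $f_-$ that is the boundary value on $\mathbb{R}$ of a function holomorphic in the lower half plane, with $f=f_++f_-$ on $\mathbb{R}$. The Fourier transform $\hat f$ is taken with the convention that $f(x)$ is represented, up to a positive normalizing constant, as $\int \hat f(\omega)e^{i\omega x}\,d\omega$. The parameter $h$ is positive, and the quotients in the series are extended by continuity at $w=nh$. *)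

theory Defs
  imports "HOL-Analysis.Analysis" "Jordan_Normal_Form.Schur_Decomposition"
begin

definition positive_semidefinite :: "complex mat \<Rightarrow> bool" where
  "positive_semidefinite A \<longleftrightarrow>
     mat_adjoint A = A \<and> (\<forall>k. eigenvalue A k \<longrightarrow> k \<in> \<real> \<and> 0 \<le> Re k)"

definition positive_definite :: "(real \<Rightarrow> complex) \<Rightarrow> bool" where
  "positive_definite f \<longleftrightarrow>
     (\<forall>(m::nat) (x :: nat \<Rightarrow> real).
        positive_semidefinite (Matrix.mat m m (\<lambda>(i, j). f (x i - x j))))"

definition square_integrable :: "(real \<Rightarrow> complex) \<Rightarrow> bool" where
  "square_integrable f \<longleftrightarrow>
     f \<in> borel_measurable lborel \<and> integrable lborel (\<lambda>x. (cmod (f x))\<^sup>2)"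

text \<open>The Fourier transform of a function in \<open>L\<^sup>2\<close> is the \<open>L\<^sup>2\<close> limit of the transforms of its
  truncations to \<open>[-R, R]\<close>; it is determined up to a null set, hence a relation. With this
  normalization, \<open>f x\<close> corresponds to the integral of \<open>F \<omega> * exp (\<i> * \<omega> * x) / (2 * pi)\<close>
  over \<open>\<omega>\<close>.\<close>

definition truncated_fourier :: "(real \<Rightarrow> complex) \<Rightarrow> real \<Rightarrow> real \<Rightarrow> complex" where
  "truncated_fourier f R \<omega> =
     (LINT x:{-R..R}|lborel. f x * exp (- (\<i> * of_real \<omega> * of_real x)))"

definition has_fourier_transform ::
    "(real \<Rightarrow> complex) \<Rightarrow> (real \<Rightarrow> complex) \<Rightarrow> bool" where
  "has_fourier_transform f F \<longleftrightarrow>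
     square_integrable f \<and> square_integrable F \<and>
     ((\<lambda>R. \<integral>\<^sup>+ \<omega>. ennreal ((cmod (truncated_fourier f R \<omega> - F \<omega>))\<^sup>2) \<partial>lborel)
        \<longlongrightarrow> 0) at_top"

text \<open>The support of a function defined only up to null sets: the complement of the largest
  open set on which it vanishes almost everywhere.\<close>

definition essential_support :: "(real \<Rightarrow> complex) \<Rightarrow> real set" where
  "essential_support F = - \<Union>{U. open U \<and> (AE \<omega> in lborel. \<omega> \<in> U \<longrightarrow> F \<omega> = 0)}"

definition fourier_supported_in :: "(real \<Rightarrow> complex) \<Rightarrow> real set \<Rightarrow> bool" where
  "fourier_supported_in f S \<longleftrightarrow>
     (\<exists>F. has_fourier_transform f F \<and> essential_support F \<subseteq> S)"

definition holomorphic_boundary_value :: "complex set \<Rightarrow> (real \<Rightarrow> complex) \<Rightarrow> bool" where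
  "holomorphic_boundary_value D g \<longleftrightarrow>
     (\<exists>G. G holomorphic_on D \<and>
        (\<forall>x. (G \<longlongrightarrow> g x) (at (complex_of_real x) within D)))"

definition solves_riemann_hilbert ::
    "(real \<Rightarrow> complex) \<Rightarrow> (real \<Rightarrow> complex) \<Rightarrow> (real \<Rightarrow> complex) \<Rightarrow> bool" where
  "solves_riemann_hilbert f fminus fplus \<longleftrightarrow>
     holomorphic_boundary_value {z. Im z < 0} fminus \<and>
     holomorphic_boundary_value {z. 0 < Im z} fplus \<and>
     (\<forall>x. f x = fminus x + fplus x)"

text \<open>The value \<open>1/2\<close> at \<open>0\<close> is the continuous extension, as checked below.\<close>

definition plus_kernel :: "real \<Rightarrow> complex" where
  "plus_kernel t =
     (if t = 0 then 1/2
      else (exp (of_real pi * \<i> * of_real t) - 1) / (2 * of_real pi * \<i> * of_real t))"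

definition minus_kernel :: "real \<Rightarrow> complex" where
  "minus_kernel t =
     (if t = 0 then 1/2
      else (1 - exp (- \<i> * of_real pi * of_real t)) / (2 * of_real pi * \<i> * of_real t))"

lemma plus_kernel_isCont: "isCont plus_kernel 0"
proof -
  have "filterlim (\<lambda>t::real. of_real pi * \<i> * of_real t) (at 0) (at 0)"
    by (rule filterlim_atI) (auto intro!: tendsto_eq_intros simp: eventually_at_filter)
  from filterlim_compose[OF lim_exp_minus_1 this]
  have "((\<lambda>t::real. (exp (of_real pi * \<i> * of_real t) - 1) / (of_real pi * \<i> * of_real t) / 2)
      \<longlongrightarrow> 1 / 2) (at 0)"
    by (intro tendsto_divide) auto
  then have "(plus_kernel \<longlongrightarrow> 1 / 2) (at 0)"
    by (rule Lim_transform_eventually)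
       (auto simp: eventually_at_filter plus_kernel_def mult_ac)
  then show ?thesis
    by (simp add: isCont_def plus_kernel_def)
qed

lemma minus_kernel_eq: "minus_kernel t = plus_kernel (- t)"
  by (simp add: plus_kernel_def minus_kernel_def mult_ac minus_divide_left)

lemma minus_kernel_isCont: "isCont minus_kernel 0"
  using isCont_o2[of 0 uminus plus_kernel] plus_kernel_isCont
  by (simp add: minus_kernel_eq[abs_def])

text \<open>Two-sided series are limits of symmetric partial sums: the samples of \<open>f\<close> need not make
  the series below converge absolutely.\<close>

definition symmetric_summable :: "(int \<Rightarrow> complex) \<Rightarrow> bool" where
  "symmetric_summable a \<longleftrightarrow> convergent (\<lambda>N::nat. \<Sum>n = - int N..int N. a n)"

definition symmetric_sum :: "(int \<Rightarrow> complex) \<Rightarrow> complex" where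
  "symmetric_sum a = lim (\<lambda>N::nat. \<Sum>n = - int N..int N. a n)"

end

theory Submission
  imports Defs "HOL-Probability.Probability"
begin

text \<open>Write \<open>f\<close> as the inverse Fourier integral of a nonnegative density \<open>F\<close>. The damped transforms of
  \<open>f x * exp (- x\<^sup>2 / (2 s\<^sup>2))\<close> are nonnegative, because \<open>f\<close> is positive definite, and they are Cauchy
  in \<open>L\<^sup>2\<close> by the inequality of Bessel; along a fast sequence \<open>s\<close> they converge almost everywhere
  to \<open>F\<close>. Both halves of \<open>f\<close> are the inverse Fourier integrals of the restrictions of \<open>F\<close> to the
  half lines. They are again continuous, positive definite and in \<open>L\<^sup>2\<close>, so they have spectral
  densities themselves, and uniqueness of characteristic functions identifies these with the
  restrictions of \<open>F\<close>: this replaces a proof of the full Plancherel theorem.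

  For the series, \<open>plus_kernel (a - n)\<close> is the \<open>n\<close>-th Fourier coefficient of \<open>exp (\<i> a x)\<close> cut off to
  \<open>[0, \<pi>]\<close>. Hence the averaged partial sums are integrals of \<open>F\<close> against Fejer means, which are bounded
  by 1 and converge almost everywhere. The terms are \<open>o(1/n)\<close> because \<open>f\<close> vanishes at infinity, so
  the partial sums converge to the same limit as their averages.\<close>

subsection \<open>Positive semidefinite matrices and quadratic forms\<close>

text \<open>Since \<open>f\<close> is merely square integrable, its Fourier integral need not
  converge, and a sharp cut-off in frequency need not preserve continuity. Positivity removes both
  obstacles: the masses of the nonnegative damped transforms are all at most
  \<open>2 * pi * Re (f 0)\<close>, so the limit \<open>F\<close> is integrable by Fatou and can
  itself serve as a majorant when limits are exchanged. Splitting at frequency 0 is then harmless,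
  because a density charges no point and its restrictions stay integrable, nonnegative and square
  integrable. Positive definiteness is given through eigenvalues, whereas the analysis works with
  quadratic forms; the minimal Rayleigh quotient connects the two. In the series, sampling with step
  \<open>h\<close> identifies frequencies that differ by multiples of \<open>2 * pi / h\<close>. For
  fixed \<open>h\<close> the sum is an integral of \<open>F\<close> against a folded cut-off, and at
  each single frequency the folding disappears once \<open>h\<close> is small. The Fejer kernel
  enters because it is nonnegative with mean 1, which yields uniform bounds and pointwise limits
  without any analysis of oscillation at the jumps of the cut-off.\<close>

definition qform :: "nat \<Rightarrow> (nat \<Rightarrow> nat \<Rightarrow> complex) \<Rightarrow> (nat \<Rightarrow> complex) \<Rightarrow> (nat \<Rightarrow> complex) \<Rightarrow> complex" where
  "qform m a v w = (\<Sum>i<m. \<Sum>j<m. cnj (v i) * a i j * w j)"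

lemma qform_add_left: "qform m a (\<lambda>i. u i + v i) w = qform m a u w + qform m a v w"
  by (simp add: qform_def algebra_simps sum.distrib)

lemma qform_add_right: "qform m a w (\<lambda>i. u i + v i) = qform m a w u + qform m a w v"
  by (simp add: qform_def algebra_simps sum.distrib)

lemma qform_scale_left: "qform m a (\<lambda>i. c * u i) w = cnj c * qform m a u w"
  by (simp add: qform_def algebra_simps sum_distrib_left)

lemma qform_scale_right: "qform m a w (\<lambda>i. c * u i) = c * qform m a w u"
  by (simp add: qform_def algebra_simps sum_distrib_left)

lemma qform_cnj:
  assumes "\<And>i j. i < m \<Longrightarrow> j < m \<Longrightarrow> a j i = cnj (a i j)"
  shows "qform m a w v = cnj (qform m a v w)"
proof -
  have "qform m a w v = (\<Sum>i<m. \<Sum>j<m. cnj (w i) * a i j * v j)" by (simp add: qform_def)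
  also have "\<dots> = (\<Sum>j<m. \<Sum>i<m. cnj (w i) * a i j * v j)" by (rule sum.swap)
  also have "\<dots> = (\<Sum>j<m. \<Sum>i<m. cnj (cnj (v j) * a j i * w i))"
  proof (intro sum.cong refl)
    fix i j assume "i \<in> {..<m}" "j \<in> {..<m}"
    then have "a i j = cnj (a j i)" using assms by blast
    then show "cnj (w i) * a i j * v j = cnj (cnj (v j) * a j i * w i)" by (simp add: mult_ac)
  qed
  finally show ?thesis by (simp add: qform_def)
qed

text \<open>For small negative \<open>t\<close> the linear term outweighs the quadratic one, so a
  positive slope would push the polynomial below 0. This serves as the first-order condition at the
  Rayleigh minimum.\<close>

lemma quadratic_nonneg_imp_linear_zero:
  fixes a c :: real
  assumes "\<And>t. 0 \<le> 2 * t * a + t\<^sup>2 * c" "0 \<le> a"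
  shows "a = 0"
proof (rule ccontr)
  assume "a \<noteq> 0"
  with assms have a: "a > 0" by simp
  \<comment> \<open>This size guarantees \<open>\<bar>t * c\<bar> \<le> a\<close>, so the factor
    \<open>2 * a + t * c\<close> stays positive while \<open>t\<close> is negative.\<close>
  define t where "t = - a / (\<bar>c\<bar> + 1)"
  have t: "t < 0" using a by (simp add: t_def field_simps add_pos_nonneg)
  have "0 \<le> t * (2 * a + t * c)" using assms(1)[of t] by (simp add: power2_eq_square algebra_simps)
  then have "2 * a + t * c \<le> 0" using t by (simp add: zero_le_mult_iff)
  moreover have "\<bar>t * c\<bar> \<le> a"
  proof -
    have "\<bar>t * c\<bar> = a * (\<bar>c\<bar> / (\<bar>c\<bar> + 1))" using a by (simp add: t_def abs_mult)
    also have "\<dots> \<le> a * 1" using a by (intro mult_left_mono) (auto simp: field_simps)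
    finally show ?thesis by simp
  qed
  ultimately show False using a by linarith
qed

text \<open>A minimizer of the Rayleigh quotient on the unit sphere is an eigenvector.\<close>

lemma rayleigh_minimum:
  assumes "m > 0" and herm: "\<And>i j. i < m \<Longrightarrow> j < m \<Longrightarrow> a j i = cnj (a i j)"
  obtains l :: real and u where "(\<Sum>i<m. (cmod (u i))\<^sup>2) = 1"
    "\<And>i. i < m \<Longrightarrow> (\<Sum>j<m. a i j * u j) = of_real l * u i"
    "\<And>v. l * (\<Sum>i<m. (cmod (v i))\<^sup>2) \<le> Re (qform m a v v)"
proof -
  \<comment> \<open>The unit sphere of dimension \<open>m\<close> is realised inside the functions
    on \<open>nat\<close>: coordinates from \<open>m\<close> on are pinned to 0 and the others lie
    in the unit disc, so compactness is Tychonoff's theorem and no type depends on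
    \<open>m\<close>.\<close>
  define P :: "(nat \<Rightarrow> complex) set" where
    "P = PiE UNIV (\<lambda>i. if i < m then cball 0 1 else {0})"
  define K where "K = P \<inter> {v. (\<Sum>i<m. (cmod (v i))\<^sup>2) = 1}"
  have "compactin (product_topology (\<lambda>_. euclidean) UNIV) P"
    unfolding P_def compactin_PiE by auto
  then have "compact P" by (simp add: euclidean_product_topology)
  moreover have "closed {v :: nat \<Rightarrow> complex. (\<Sum>i<m. (cmod (v i))\<^sup>2) = 1}"
    by (intro closed_Collect_eq continuous_intros continuous_on_product_coordinates)
  ultimately have cK: "compact K" unfolding K_def by (rule compact_Int_closed)
  have "(\<lambda>i. if i = 0 then 1 else 0) \<in> K"
    using \<open>m > 0\<close> by (auto simp: K_def P_def if_distrib[of cmod] if_distrib[of "\<lambda>x. x\<^sup>2"] cong: if_cong)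
  then have ne: "K \<noteq> {}" by blast
  have "continuous_on K (\<lambda>v. Re (qform m a v v))"
    unfolding qform_def
    by (intro continuous_intros continuous_on_subset[OF continuous_on_product_coordinates subset_UNIV])
  from continuous_attains_inf[OF cK ne this] obtain u where
    u: "u \<in> K" "\<And>v. v \<in> K \<Longrightarrow> Re (qform m a u u) \<le> Re (qform m a v v)" by blast
  define l where "l = Re (qform m a u u)"
  have u1: "(\<Sum>i<m. (cmod (u i))\<^sup>2) = 1" using u by (simp add: K_def)
  have bound: "l * (\<Sum>i<m. (cmod (v i))\<^sup>2) \<le> Re (qform m a v v)" for v
  proof (cases "(\<Sum>i<m. (cmod (v i))\<^sup>2) = 0")
    case True
    then have "\<And>i. i < m \<Longrightarrow> v i = 0" by (simp add: sum_nonneg_eq_0_iff)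
    then show ?thesis by (simp add: qform_def)
  next
    case False
    define s where "s = sqrt (\<Sum>i<m. (cmod (v i))\<^sup>2)"
    have s2: "s\<^sup>2 = (\<Sum>i<m. (cmod (v i))\<^sup>2)" by (simp add: s_def sum_nonneg)
    have s: "s > 0" using False by (auto simp: s_def sum_nonneg intro: le_neq_trans)
    define w where "w = (\<lambda>i. if i < m then of_real (1 / s) * v i else 0)"
    have norm_w: "(cmod (w i))\<^sup>2 = (cmod (v i))\<^sup>2 / s\<^sup>2" if "i < m" for i
      using that s by (simp add: w_def norm_mult norm_divide power_divide)
    have "(\<Sum>i<m. (cmod (w i))\<^sup>2) = (\<Sum>i<m. (cmod (v i))\<^sup>2) / s\<^sup>2"
      by (simp add: norm_w sum_divide_distrib)
    also have "\<dots> = 1" using False s2 by simp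
    finally have sw: "(\<Sum>i<m. (cmod (w i))\<^sup>2) = 1" .
    have "cmod (w i) \<le> 1" if "i < m" for i
    proof -
      have "(cmod (w i))\<^sup>2 \<le> (\<Sum>i<m. (cmod (w i))\<^sup>2)"
        using that by (intro member_le_sum) auto
      then show ?thesis using sw by (simp add: power_le_one_iff abs_square_le_1)
    qed
    then have "w \<in> K" using sw by (auto simp: K_def P_def w_def)
    from u(2)[OF this] have "l \<le> Re (qform m a w w)" by (simp add: l_def)
    also have "qform m a w w = qform m a (\<lambda>i. of_real (1/s) * v i) (\<lambda>i. of_real (1/s) * v i)"
      by (simp add: qform_def w_def)
    also have "\<dots> = of_real (1 / s\<^sup>2) * qform m a v v"
      unfolding qform_scale_left qform_scale_right by (simp add: power2_eq_square)
    finally have "l \<le> Re (qform m a v v) / s\<^sup>2" by (simp del: of_real_power of_real_divide)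
    then show ?thesis using s by (simp add: s2[symmetric] field_simps)
  qed
  \<comment> \<open>The residual of the eigenvalue equation. Moving from \<open>u\<close> in the
    direction \<open>b\<close> changes the form minus \<open>l\<close> times the squared norm at
    first order by \<open>2 * t * B\<close>, as the terms with \<open>U\<close> cancel. Minimality
    forces \<open>B = 0\<close>.\<close>
  define b where "b = (\<lambda>i. (\<Sum>j<m. a i j * u j) - of_real l * u i)"
  define B where "B = (\<Sum>i<m. (cmod (b i))\<^sup>2)"
  define U where "U = (\<Sum>i<m. cnj (b i) * u i)"
  have bu: "qform m a b u = of_real B + of_real l * U"
  proof -
    have "qform m a b u = (\<Sum>i<m. cnj (b i) * (\<Sum>j<m. a i j * u j))"
      by (simp add: qform_def sum_distrib_left mult.assoc)
    also have "\<dots> = (\<Sum>i<m. of_real ((cmod (b i))\<^sup>2) + of_real l * (cnj (b i) * u i))"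
    proof (intro sum.cong refl)
      fix i
      have "(\<Sum>j<m. a i j * u j) = b i + of_real l * u i" by (simp add: b_def)
      then show "cnj (b i) * (\<Sum>j<m. a i j * u j)
          = of_real ((cmod (b i))\<^sup>2) + of_real l * (cnj (b i) * u i)"
        by (simp only: complex_norm_square) (simp add: algebra_simps)
    qed
    finally show ?thesis by (simp add: sum.distrib B_def U_def sum_distrib_left)
  qed
  have "0 \<le> 2 * t * B + t\<^sup>2 * (Re (qform m a b b) - l * B)" for t
  proof -
    have "qform m a (\<lambda>i. u i + of_real t * b i) (\<lambda>i. u i + of_real t * b i)
        = qform m a u u + of_real t * (qform m a u b + qform m a b u) + of_real (t\<^sup>2) * qform m a b b"
      unfolding qform_add_left qform_add_right qform_scale_left qform_scale_right
      by (simp add: algebra_simps power2_eq_square)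
    moreover have "qform m a u b = cnj (qform m a b u)" by (rule qform_cnj[OF herm])
    ultimately have "Re (qform m a (\<lambda>i. u i + of_real t * b i) (\<lambda>i. u i + of_real t * b i))
        = l + 2 * t * Re (qform m a b u) + t\<^sup>2 * Re (qform m a b b)"
      by (simp add: l_def del: of_real_power)
    moreover have "(\<Sum>i<m. (cmod (u i + of_real t * b i))\<^sup>2) = 1 + 2 * t * Re U + t\<^sup>2 * B"
    proof -
      have "(cmod (u i + of_real t * b i))\<^sup>2
          = (cmod (u i))\<^sup>2 + 2 * t * Re (cnj (b i) * u i) + t\<^sup>2 * (cmod (b i))\<^sup>2" for i
        unfolding cmod_power2 by (simp add: power2_eq_square algebra_simps)
      then show ?thesis using u1 by (simp add: sum.distrib B_def U_def flip: sum_distrib_left)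
    qed
    ultimately show ?thesis
      using bound[of "\<lambda>i. u i + of_real t * b i"] bu by (simp add: algebra_simps)
  qed
  moreover have "0 \<le> B" by (simp add: B_def sum_nonneg)
  ultimately have "B = 0" by (rule quadratic_nonneg_imp_linear_zero)
  then have "b i = 0" if "i < m" for i
    using that by (simp add: B_def sum_nonneg_eq_0_iff)
  then have "(\<Sum>j<m. a i j * u j) = of_real l * u i" if "i < m" for i
    using that by (simp add: b_def)
  then show thesis using that u1 bound by blast
qed

lemma index_mult_mat_vec_fun:
  assumes "i < m"
  shows "Matrix.vec_index (Matrix.mat m m (\<lambda>(i, j). a i j) *\<^sub>v Matrix.vec m v) i = (\<Sum>j<m. a i j * v j)"
  using assms by (simp add: scalar_prod_def atLeast0LessThan)

text \<open>From left to right, the minimal Rayleigh quotient is an eigenvalue, hence nonnegative,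
  and it bounds the form from below. From right to left, the form at an eigenvector is the
  eigenvalue times a positive number.\<close>

lemma positive_semidefinite_iff_qform:
  "positive_semidefinite (Matrix.mat m m (\<lambda>(i, j). a i j)) \<longleftrightarrow>
     (\<forall>i<m. \<forall>j<m. a j i = cnj (a i j)) \<and> (\<forall>v. 0 \<le> Re (qform m a v v))"
    (is "positive_semidefinite ?A \<longleftrightarrow> ?R")
proof -
  have adj: "mat_adjoint ?A = ?A \<longleftrightarrow> (\<forall>i<m. \<forall>j<m. a j i = cnj (a i j))"
  proof -
    have "mat_adjoint ?A = Matrix.mat m m (\<lambda>(i, j). cnj (a j i))"
      by (rule eq_matI) (auto simp: mat_adjoint_def mat_of_rows_def)
    then have "mat_adjoint ?A = ?A \<longleftrightarrow> (\<forall>i<m. \<forall>j<m. cnj (a j i) = a i j)"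
      by (auto simp: mat_eq_iff)
    then show ?thesis by (metis complex_cnj_cnj)
  qed
  show ?thesis
  proof
    assume L: "positive_semidefinite ?A"
    then have h: "\<And>i j. i < m \<Longrightarrow> j < m \<Longrightarrow> a j i = cnj (a i j)"
      unfolding positive_semidefinite_def adj by blast
    have "0 \<le> Re (qform m a v v)" for v
    \<comment> \<open>For \<open>m = 0\<close> there is no unit vector to minimize over, and the
      form is an empty sum.\<close>
    proof (cases "m > 0")
      case True
      show ?thesis
      proof (rule rayleigh_minimum[of m a])
      show "m > 0" by fact
      show "a j i = cnj (a i j)" if "i < m" "j < m" for i j using that by (rule h)
      fix l :: real and u
      assume u: "(\<Sum>i<m. (cmod (u i))\<^sup>2) = 1"
           "\<And>i. i < m \<Longrightarrow> (\<Sum>j<m. a i j * u j) = of_real l * u i"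
        and b: "\<And>v. l * (\<Sum>i<m. (cmod (v i))\<^sup>2) \<le> Re (qform m a v v)"
      have "eigenvector ?A (Matrix.vec m u) (of_real l)"
        unfolding eigenvector_def
      proof (intro conjI)
        show "Matrix.vec m u \<noteq> 0\<^sub>v (dim_row ?A)"
        proof
          assume z: "Matrix.vec m u = 0\<^sub>v (dim_row ?A)"
          have "u i = 0" if "i < m" for i :: nat
            using arg_cong[of _ _ "\<lambda>v. Matrix.vec_index v i", OF z] that by simp
          then show False using u(1) by simp
        qed
        show "?A *\<^sub>v Matrix.vec m u = of_real l \<cdot>\<^sub>v Matrix.vec m u"
          by (rule eq_vecI) (simp_all add: u(2) index_mult_mat_vec_fun del: index_mult_mat_vec)
      qed auto
      then have "eigenvalue ?A (of_real l)" unfolding eigenvalue_def by blast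
      with L have "0 \<le> Re (of_real l)" unfolding positive_semidefinite_def by blast
      then have "0 \<le> l" by simp
      then have "0 \<le> l * (\<Sum>i<m. (cmod (v i))\<^sup>2)" by (simp add: sum_nonneg)
      with b[of v] show ?thesis by linarith
      qed
    qed (simp add: qform_def)
    then show ?R using h by blast
  next
    assume R: ?R
    show "positive_semidefinite ?A"
      unfolding positive_semidefinite_def
    proof (intro conjI allI impI)
      show "mat_adjoint ?A = ?A" using R adj by blast
    next
      fix k assume "eigenvalue ?A k"
      then obtain v where v: "v \<in> carrier_vec m" "v \<noteq> 0\<^sub>v m" "?A *\<^sub>v v = k \<cdot>\<^sub>v v"
        unfolding eigenvalue_def eigenvector_def by auto
      define w where "w = (\<lambda>i. Matrix.vec_index v i)"
      have vw: "v = Matrix.vec m w" using v(1) by (auto simp: w_def)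
      have ev: "(\<Sum>j<m. a i j * w j) = k * w i" if "i < m" for i
      proof -
        have "(\<Sum>j<m. a i j * w j) = Matrix.vec_index (k \<cdot>\<^sub>v Matrix.vec m w) i"
          using index_mult_mat_vec_fun[OF that, of a w] v(3) unfolding vw by metis
        then show ?thesis using that by simp
      qed
      define N where "N = (\<Sum>i<m. (cmod (w i))\<^sup>2)"
      have "qform m a w w = (\<Sum>i<m. cnj (w i) * (\<Sum>j<m. a i j * w j))"
        by (simp add: qform_def sum_distrib_left mult.assoc)
      also have "\<dots> = (\<Sum>i<m. k * of_real ((cmod (w i))\<^sup>2))"
      proof (intro sum.cong refl)
        fix i assume "i \<in> {..<m}"
        then show "cnj (w i) * (\<Sum>j<m. a i j * w j) = k * of_real ((cmod (w i))\<^sup>2)"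
          unfolding complex_norm_square by (simp only: ev lessThan_iff) (simp only: mult_ac)
      qed
      also have "\<dots> = k * of_real N" by (simp add: N_def sum_distrib_left)
      finally have q: "qform m a w w = k * of_real N" .
      have "N \<noteq> 0"
      proof
        assume "N = 0"
        then have "\<And>i. i < m \<Longrightarrow> w i = 0" by (simp add: N_def sum_nonneg_eq_0_iff)
        then have "v = 0\<^sub>v m" unfolding vw by auto
        with v(2) show False by simp
      qed
      then have N: "N > 0" by (auto simp: N_def sum_nonneg intro: le_neq_trans)
      have "qform m a w w = cnj (qform m a w w)" using R by (intro qform_cnj) blast
      then have "Im (qform m a w w) = 0" by (metis Reals_cnj_iff complex_is_Real_iff)
      then show "k \<in> \<real>" using q N by (simp add: complex_is_Real_iff)
      have "0 \<le> Re (qform m a w w)" using R by blast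
      then show "0 \<le> Re k" using q N by (simp add: zero_le_mult_iff)
    qed
  qed
qed

text \<open>The Hermitian condition on all matrices collapses to a reflection symmetry of
  \<open>f\<close>, because the two points \<open>x\<close> and 0 already produce an arbitrary entry
  and its mirror image.\<close>

lemma positive_definite_iff_qform:
  fixes f :: "real \<Rightarrow> complex"
  shows "positive_definite f \<longleftrightarrow> (\<forall>x. f (- x) = cnj (f x)) \<and>
     (\<forall>(m::nat) x c. 0 \<le> Re (\<Sum>i<m. \<Sum>j<m::nat. cnj (c i) * f (x i - x j) * c j))"
proof -
  have herm: "(\<forall>(m::nat) (x :: nat \<Rightarrow> real). \<forall>i<m. \<forall>j<m. f (x j - x i) = cnj (f (x i - x j)))
      \<longleftrightarrow> (\<forall>x. f (- x) = cnj (f x))"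
  proof (intro iffI allI impI)
    fix x assume "\<forall>(m::nat) (x :: nat \<Rightarrow> real). \<forall>i<m. \<forall>j<m. f (x j - x i) = cnj (f (x i - x j))"
    from this[rule_format, of 0 2 1 "\<lambda>i. if i = 0 then x else 0"] show "f (- x) = cnj (f x)" by simp
  next
    fix m x i j assume "\<forall>x. f (- x) = cnj (f x)"
    then show "f (x j - x i) = cnj (f (x i - x j))" by (metis minus_diff_eq)
  qed
  show ?thesis
    unfolding positive_definite_def positive_semidefinite_iff_qform qform_def all_conj_distrib
    by (intro arg_cong2[where f = "(\<and>)"] herm refl)
qed

text \<open>The form at the points \<open>x\<close>, 0 with coefficients \<open>s\<close>, -1, where
  \<open>s\<close> is the phase of \<open>f x\<close>, equals
  \<open>2 * Re (f 0) - 2 * cmod (f x)\<close>. Boundedness is what makes Gaussian-damped versions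
  of \<open>f\<close> integrable.\<close>

lemma positive_definite_norm_le:
  fixes f :: "real \<Rightarrow> complex"
  assumes "positive_definite f"
  shows "cmod (f x) \<le> Re (f 0)" "Im (f 0) = 0" "0 \<le> Re (f 0)"
proof -
  have h: "f (- x) = cnj (f x)" for x using assms unfolding positive_definite_iff_qform by blast
  show "Im (f 0) = 0" using h[of 0] by (metis Reals_cnj_iff add.inverse_neutral complex_is_Real_iff)
  define s where "s = sgn (f x)"
  have q: "0 \<le> Re (\<Sum>i<2::nat. \<Sum>j<2::nat. cnj (c i) * f (y i - y j) * c j)" for c y
    using assms unfolding positive_definite_iff_qform by blast
  show *: "0 \<le> Re (f 0)"
    using q[of "\<lambda>i. if i = 0 then 1 else 0" "\<lambda>_. 0"] by (simp add: numeral_2_eq_2)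
  show "cmod (f x) \<le> Re (f 0)"
  proof (cases "f x = 0")
    case False
    have sq: "cnj (f x) * f x = of_real ((cmod (f x))\<^sup>2)"
      by (simp only: complex_norm_square) (simp add: mult.commute)
    have "s = f x / of_real (cmod (f x))"
      by (simp add: s_def sgn_div_norm scaleR_conv_of_real field_simps)
    moreover have "cnj s = cnj (f x) / of_real (cmod (f x))"
      using calculation by simp
    ultimately have s: "cnj s * s = 1" "cnj s * f x = of_real (cmod (f x))"
      using False sq by (simp_all add: power2_eq_square)
    have "(\<Sum>i<2::nat. \<Sum>j<2::nat. cnj (if i = 0 then s else -1) * f ((if i = 0 then x else 0) - (if j = 0 then x else 0))
        * (if j = 0 then s else -1)) = cnj s * s * f 0 - cnj s * f x - cnj (cnj s * f x) + f 0"
      by (simp add: numeral_2_eq_2 h algebra_simps)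
    with q[of "\<lambda>i. if i = 0 then s else -1" "\<lambda>i. if i = 0 then x else 0"]
    have "0 \<le> Re (1 * f 0 - of_real (cmod (f x)) - cnj (of_real (cmod (f x))) + f 0)" by (simp only: s)
    then show ?thesis by simp
  qed (use * in simp)
qed

subsection \<open>Gaussian averages of positive definite functions\<close>

text \<open>The joint law of the coordinates is the product measure itself, and this factorization
  is independence. It supplies infinitely many independent points on one probability space, which
  then serves every sample size.\<close>

lemma indep_vars_PiM_coordinates:
  assumes "\<And>i. i \<in> I \<Longrightarrow> prob_space (M i)" "I \<noteq> {}"
  shows "prob_space.indep_vars (PiM I M) M (\<lambda>i \<omega>. \<omega> i) I"
proof -
  interpret prob_space "PiM I M" by (intro prob_space_PiM assms)
  have "distr (PiM I M) (PiM I M) (\<lambda>x. \<lambda>i\<in>I. x i) = distr (PiM I M) (PiM I M) (\<lambda>x. x)"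
    by (intro distr_cong refl) (auto simp: space_PiM PiE_def extensional_restrict)
  also have "\<dots> = PiM I (\<lambda>i. distr (PiM I M) (M i) (\<lambda>\<omega>. \<omega> i))"
    by (subst distr_id2) (auto intro!: PiM_cong simp: distr_PiM_component assms)
  finally show ?thesis using assms(2) by (subst indep_vars_iff_distr_eq_PiM') auto
qed

text \<open>Sampling \<open>m\<close> independent normal points, the expected quadratic form with all coefficients \<open>1\<close>
  is \<open>m g(0) + m (m - 1) I\<close>, with \<open>I\<close> the average below; hence \<open>I\<close> cannot be negative.\<close>

lemma positive_definite_normal_average:
  fixes g :: "real \<Rightarrow> complex"
  assumes g: "positive_definite g" and cont: "continuous_on UNIV g" and s: "s > 0"
  shows "0 \<le> Re (LINT u|lborel. normal_density 0 s u *\<^sub>R g u)"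
proof -
  \<comment> \<open>The difference of two independent centred normals of deviation
    \<open>\<sigma>\<close> has variance \<open>2 * \<sigma>\<^sup>2\<close>, which has to be
    \<open>s\<^sup>2\<close>.\<close>
  define \<sigma> where "\<sigma> = s / sqrt 2"
  have \<sigma>: "\<sigma> > 0" using s by (simp add: \<sigma>_def)
  have s_eq: "sqrt (\<sigma>\<^sup>2 + \<sigma>\<^sup>2) = s"
    using s by (simp add: \<sigma>_def power_divide real_sqrt_eq_iff)
  define D where "D = density lborel (\<lambda>x. ennreal (normal_density 0 \<sigma> x))"
  have D: "prob_space D" unfolding D_def by (rule prob_space_normal_density[OF \<sigma>])
  have sets_D [simp, measurable_cong]: "sets D = sets borel" by (simp add: D_def)
  define M where "M = PiM (UNIV :: nat set) (\<lambda>_. D)"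
  interpret prob_space M unfolding M_def by (intro prob_space_PiM D)
  have ind: "indep_vars (\<lambda>_. D) (\<lambda>i \<omega>. \<omega> i) UNIV"
    using indep_vars_PiM_coordinates[of UNIV "\<lambda>_::nat. D"] D by (simp add: M_def)
  have ind': "indep_vars (\<lambda>_. borel) (\<lambda>i \<omega>. \<omega> i) UNIV"
    by (rule indep_vars_compose2[OF ind, where Y = "\<lambda>_ x. x"]) simp
  have [measurable]: "(\<lambda>\<omega>. \<omega> i) \<in> borel_measurable M" for i
    using ind' by (auto simp: indep_vars_def)
  have normal: "distributed M lborel (\<lambda>\<omega>. \<omega> i) (\<lambda>x. ennreal (normal_density 0 \<sigma> x))" for i
    unfolding distributed_def
  proof (intro conjI)
    have "distr M lborel (\<lambda>\<omega>. \<omega> i) = distr M D (\<lambda>\<omega>. \<omega> i)" by (intro distr_cong) auto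
    also have "\<dots> = D" unfolding M_def by (rule distr_PiM_component[OF D]) simp
    finally show "distr M lborel (\<lambda>\<omega>. \<omega> i) = density lborel (\<lambda>x. ennreal (normal_density 0 \<sigma> x))"
      by (simp add: D_def)
  qed auto
  have diff: "distributed M lborel (\<lambda>\<omega>. \<omega> i - \<omega> j) (\<lambda>x. ennreal (normal_density 0 s x))"
    if "i \<noteq> j" for i j
  proof -
    have "indep_var borel (\<lambda>\<omega>. \<omega> i) borel (\<lambda>\<omega>. \<Sum>k\<in>{j}. \<omega> k)"
      using that by (intro indep_vars_sum indep_vars_subset[OF ind']) auto
    then have "indep_var borel (\<lambda>\<omega>. \<omega> i) borel (\<lambda>\<omega>. \<omega> j)" by simp
    from diff_indep_normal[OF this \<sigma> \<sigma> normal normal] show ?thesis unfolding s_eq by simp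
  qed
  have [measurable]: "g \<in> borel_measurable borel"
    using cont by (rule borel_measurable_continuous_onI)
  define I where "I = (LINT u|lborel. normal_density 0 s u *\<^sub>R g u)"
  have int: "integrable M (\<lambda>\<omega>. g (\<omega> i - \<omega> j))" for i j
    by (rule integrable_const_bound[where B = "Re (g 0)"]) (auto simp: positive_definite_norm_le[OF g])
  have expect: "expectation (\<lambda>\<omega>. Re (g (\<omega> i - \<omega> j))) = (if i = j then Re (g 0) else Re I)" for i j
  proof (cases "i = j")
    case True
    then show ?thesis by (simp add: prob_space)
  next
    case False
    have "expectation (\<lambda>\<omega>. Re (g (\<omega> i - \<omega> j))) = Re (LINT \<omega>|M. g (\<omega> i - \<omega> j))"
      using int by simp
    also have "(LINT \<omega>|M. g (\<omega> i - \<omega> j)) = (LINT u|distr M lborel (\<lambda>\<omega>. \<omega> i - \<omega> j). g u)"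
      by (subst integral_distr) auto
    also have "\<dots> = I"
      unfolding distributed_distr_eq_density[OF diff[OF False]] I_def
      by (subst integral_density) auto
    finally show ?thesis using False by simp
  qed
  have "0 \<le> real m * Re (g 0) + real m * (real m - 1) * Re I" for m
  proof -
    have "0 \<le> expectation (\<lambda>\<omega>. \<Sum>i<m. \<Sum>j<m. Re (g (\<omega> i - \<omega> j)))"
    proof (rule integral_nonneg_AE, rule AE_I2)
      fix \<omega> :: "nat \<Rightarrow> real"
      have "0 \<le> Re (\<Sum>i<m. \<Sum>j<m. cnj 1 * g (\<omega> i - \<omega> j) * 1)"
        using g unfolding positive_definite_iff_qform by (elim conjE allE[of _ m] allE[of _ \<omega>] allE[of _ "\<lambda>_. 1"])
      then show "0 \<le> (\<Sum>i<m. \<Sum>j<m. Re (g (\<omega> i - \<omega> j)))" by simp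
    qed
    also have "\<dots> = (\<Sum>i<m. \<Sum>j<m. expectation (\<lambda>\<omega>. Re (g (\<omega> i - \<omega> j))))"
      using int by (subst Bochner_Integration.integral_sum, simp)+ simp
    also have "\<dots> = (\<Sum>i<m. \<Sum>j<m. Re I + (if i = j then Re (g 0) - Re I else 0))"
      unfolding expect by (intro sum.cong refl) auto
    also have "\<dots> = real m * Re (g 0) + real m * (real m - 1) * Re I"
      by (simp add: sum.distrib algebra_simps)
    finally show ?thesis .
  qed
  \<comment> \<open>With \<open>m = n + 1\<close> the common factor \<open>m\<close> cancels; as
    \<open>n\<close> grows, the off-diagonal part dominates and rules out a negative
    \<open>Re I\<close>.\<close>
  from this[of "Suc n" for n] have "0 \<le> real (Suc n) * (Re (g 0) + real n * Re I)" for n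
    by (simp add: algebra_simps)
  then have *: "0 \<le> Re (g 0) + real n * Re I" for n
    by (simp add: zero_le_mult_iff del: of_nat_Suc)
  show ?thesis
  proof (rule ccontr)
    assume "\<not> ?thesis"
    then have "Re I < 0" by (simp add: I_def)
    moreover obtain n where "Re (g 0) < real n * - Re I"
      using reals_Archimedean3[of "- Re I"] calculation by auto
    ultimately show False using *[of n] by simp
  qed
qed

text \<open>A character splits over the difference of two points and is absorbed into the
  coefficients, which change only by phases. A statement about Gaussian means, that is about
  frequency 0, thereby becomes one about every frequency \<open>w\<close>.\<close>

lemma positive_definite_modulate:
  fixes f :: "real \<Rightarrow> complex"
  assumes "positive_definite f"
  shows "positive_definite (\<lambda>x. f x * exp (- (\<i> * of_real w * of_real x)))"
  unfolding positive_definite_iff_qform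
proof (intro conjI allI)
  fix x show "f (- x) * exp (- (\<i> * of_real w * of_real (- x))) = cnj (f x * exp (- (\<i> * of_real w * of_real x)))"
    using assms unfolding positive_definite_iff_qform by (simp add: exp_cnj)
next
  fix m and x :: "nat \<Rightarrow> real" and c :: "nat \<Rightarrow> complex"
  define d where "d i = c i * exp (\<i> * of_real w * of_real (x i))" for i
  have "cnj (d i) * f (x i - x j) * d j
      = cnj (c i) * (f (x i - x j) * exp (- (\<i> * of_real w * of_real (x i - x j)))) * c j" for i j
  proof -
    have "exp (- (\<i> * of_real w * of_real (x i - x j)))
        = cnj (exp (\<i> * of_real w * of_real (x i))) * exp (\<i> * of_real w * of_real (x j))"
      unfolding exp_cnj exp_add[symmetric] by (simp add: algebra_simps)
    then show ?thesis by (simp add: d_def)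
  qed
  moreover have "0 \<le> Re (\<Sum>i<m. \<Sum>j<m. cnj (d i) * f (x i - x j) * d j)"
    using assms unfolding positive_definite_iff_qform by blast
  ultimately show "0 \<le> Re (\<Sum>i<m. \<Sum>j<m. cnj (c i) *
      (f (x i - x j) * exp (- (\<i> * of_real w * of_real (x i - x j)))) * c j)" by (simp only:)
qed

subsection \<open>The Fourier transform of integrable functions\<close>

definition ft :: "(real \<Rightarrow> complex) \<Rightarrow> real \<Rightarrow> complex" where
  "ft p w = (LINT x|lborel. p x * exp (- (\<i> * of_real w * of_real x)))"

lemma norm_exp_imaginary [simp]:
  "cmod (exp (- (\<i> * of_real w * of_real x))) = 1" "cmod (exp (\<i> * of_real w * of_real x)) = 1"
  by (simp_all add: norm_exp_eq_Re)

lemma integrable_mult_exp_imaginary: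
  assumes "integrable lborel p"
  shows "integrable lborel (\<lambda>x. p x * exp (- (\<i> * of_real w * of_real x)))"
    "integrable lborel (\<lambda>x. p x * exp (\<i> * of_real w * of_real x))"
  by (rule Bochner_Integration.integrable_bound[OF assms]; use assms in \<open>simp add: norm_mult\<close>)+

lemma cnj_measurable [measurable (raw)]:
  assumes "f \<in> borel_measurable M"
  shows "(\<lambda>x. cnj (f x)) \<in> borel_measurable M"
  by (rule measurable_compose[OF assms borel_measurable_continuous_onI]) (intro continuous_intros)

text \<open>A function that is not integrable has integral 0 by convention, so the bound holds in
  every case and estimates can continue in \<open>ennreal\<close>.\<close>

lemma norm_integral_le_nn_integral:
  fixes f :: "'a \<Rightarrow> 'b::{banach, second_countable_topology}"
  shows "ennreal (norm (integral\<^sup>L M f)) \<le> (\<integral>\<^sup>+ x. ennreal (norm (f x)) \<partial>M)"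
  by (cases "integrable M f") (simp_all add: integral_norm_bound_ennreal not_integrable_integral_eq)

lemma ft_measurable [measurable (raw)]:
  assumes [measurable]: "p \<in> borel_measurable borel"
  shows "ft p \<in> borel_measurable borel"
  unfolding ft_def[abs_def] by measurable

lemma norm_ft_le: "cmod (ft p w) \<le> (LINT x|lborel. cmod (p x))"
  unfolding ft_def by (rule order_trans[OF integral_norm_bound]) (simp add: norm_mult)

lemma ft_diff:
  assumes "integrable lborel p" "integrable lborel q"
  shows "ft (\<lambda>x. p x - q x) w = ft p w - ft q w"
  unfolding ft_def using assms
  by (simp add: left_diff_distrib integrable_mult_exp_imaginary)

lemma integrable_mult_pair:
  fixes p q :: "real \<Rightarrow> complex"
  assumes p: "integrable lborel p" and q: "integrable lborel q"
    and h [measurable]: "case_prod h \<in> borel_measurable (borel \<Otimes>\<^sub>M borel)" and "\<And>x y. cmod (h x y) \<le> 1"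
  shows "integrable (lborel \<Otimes>\<^sub>M lborel) (\<lambda>(x, y). p x * q y * h x y)"
proof -
  have [measurable]: "p \<in> borel_measurable borel" "q \<in> borel_measurable borel" using p q by auto
  have *: "integrable (lborel \<Otimes>\<^sub>M lborel) (\<lambda>(x, y). p x * q y)"
  proof (rule lborel_pair.Fubini_integrable)
    show "integrable lborel (\<lambda>x. LINT y|lborel. cmod (case (x, y) of (x, y) \<Rightarrow> p x * q y))"
      using p q by (simp add: norm_mult)
    show "AE x in lborel. integrable lborel (\<lambda>y. case (x, y) of (x, y) \<Rightarrow> p x * q y)"
      using q by simp
  qed measurable
  show ?thesis
    by (rule Bochner_Integration.integrable_bound[OF *])
       (use assms(4) in \<open>auto simp: norm_mult split: prod.splits intro!: mult_left_le\<close>)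
qed

text \<open>Fubini, as the kernel is symmetric in \<open>w\<close> and \<open>x\<close>. With
  Gaussian factors in \<open>q\<close>, this exchange is the source of both the inversion formula
  and the norm estimate.\<close>

lemma ft_multiplication:
  assumes p: "integrable lborel p" and q: "integrable lborel q"
  shows "(LINT w|lborel. q w * ft p w) = (LINT x|lborel. p x * ft q x)"
proof -
  have [measurable]: "p \<in> borel_measurable borel" "q \<in> borel_measurable borel" using p q by auto
  have "integrable (lborel \<Otimes>\<^sub>M lborel) (\<lambda>(w, x). q w * p x * exp (- (\<i> * of_real w * of_real x)))"
    by (intro integrable_mult_pair p q) auto
  from lborel_pair.Fubini_integral[OF this]
  have "(LINT x|lborel. LINT w|lborel. q w * p x * exp (- (\<i> * of_real w * of_real x)))
      = (LINT w|lborel. LINT x|lborel. q w * p x * exp (- (\<i> * of_real w * of_real x)))" .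
  moreover have "(LINT w|lborel. q w * p x * exp (- (\<i> * of_real w * of_real x))) = p x * ft q x" for x
    unfolding ft_def by (subst integral_mult_right_zero[symmetric]) (simp add: mult_ac)
  moreover have "(LINT x|lborel. q w * p x * exp (- (\<i> * of_real w * of_real x))) = q w * ft p w" for w
    unfolding ft_def by (subst integral_mult_right_zero[symmetric]) (simp add: mult_ac)
  ultimately show ?thesis by simp
qed

section \<open>Gaussian weights and regularized Fourier inversion\<close>

definition gauss :: "real \<Rightarrow> real \<Rightarrow> real" where
  "gauss s w = exp (- (w / s)\<^sup>2 / 2)"

lemma gauss_eq_normal_density:
  assumes "s > 0"
  shows "gauss s w = s * sqrt (2 * pi) * normal_density 0 s w"
  using assms by (simp add: gauss_def normal_density_def real_sqrt_mult power_divide)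

lemma gauss_bounds [simp]: "0 \<le> gauss s w" "0 < gauss s w" "gauss s w \<le> 1"
  by (simp_all add: gauss_def)

lemma gauss_measurable [measurable]: "gauss s \<in> borel_measurable borel"
  unfolding gauss_def[abs_def] by measurable

lemma integrable_gauss: "s > 0 \<Longrightarrow> integrable lborel (gauss s)"
  using integrable_mult_right[OF integrable_normal_density[of s 0], of "s * sqrt (2 * pi)"]
  by (simp add: gauss_eq_normal_density cong: Bochner_Integration.integrable_cong)

lemma gauss_tendsto_1: "(\<lambda>n. gauss (real (Suc n)) w) \<longlonglongrightarrow> 1"
proof -
  have "(\<lambda>n. w / real (Suc n)) \<longlonglongrightarrow> 0"
    by (intro LIMSEQ_Suc lim_const_over_n)
  then have "(\<lambda>n. exp (- (w / real (Suc n))\<^sup>2 / 2)) \<longlonglongrightarrow> exp (- 0\<^sup>2 / 2)"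
    by (intro tendsto_intros) auto
  then show ?thesis by (simp add: gauss_def)
qed

lemma ft_std_normal_density:
  "(LINT t|lborel. of_real (std_normal_density t) * exp (- (\<i> * of_real u * of_real t)))
     = of_real (exp (- u\<^sup>2 / 2))"
proof -
  have "char std_normal_distribution (- u) = of_real (exp (- (- u)\<^sup>2 / 2))"
    by (simp add: char_std_normal_distribution)
  then show ?thesis
    unfolding char_def by (subst (asm) integral_density) (auto simp: scaleR_conv_of_real mult.assoc)
qed

text \<open>The characteristic function of the standard normal law is its density up to a factor,
  and the substitution \<open>w = s * t\<close> carries this over. A weight of height 1 and width
  \<open>s\<close> becomes a bump of mass \<open>2 * pi\<close> and width \<open>1 / s\<close>, an
  approximate identity as \<open>s\<close> grows.\<close>

lemma ft_gauss:
  assumes s: "s > 0"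
  shows "ft (\<lambda>w. of_real (gauss s w)) u = of_real (2 * pi * normal_density 0 (1 / s) u)"
proof -
  have "ft (\<lambda>w. of_real (gauss s w)) u
      = s *\<^sub>R (LINT t|lborel. of_real (gauss s (0 + s * t)) * exp (- (\<i> * of_real u * of_real (0 + s * t))))"
    unfolding ft_def using s by (subst lborel_integral_real_affine[where c = s and t = 0]) auto
  also have "(LINT t|lborel. of_real (gauss s (0 + s * t)) * exp (- (\<i> * of_real u * of_real (0 + s * t))))
      = (LINT t|lborel. of_real (sqrt (2 * pi)) * (of_real (std_normal_density t) * exp (- (\<i> * of_real (s * u) * of_real t))))"
  proof (rule Bochner_Integration.integral_cong[OF refl])
    fix t
    have "gauss s (0 + s * t) = sqrt (2 * pi) * std_normal_density t"
      using s by (simp add: gauss_def std_normal_density_def)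
    moreover have "\<i> * of_real u * of_real (0 + s * t) = \<i> * of_real (s * u) * complex_of_real t" by simp
    ultimately show "of_real (gauss s (0 + s * t)) * exp (- (\<i> * of_real u * of_real (0 + s * t)))
      = complex_of_real (sqrt (2 * pi)) * (of_real (std_normal_density t) * exp (- (\<i> * of_real (s * u) * of_real t)))"
      by (simp only: of_real_mult mult.assoc)
  qed
  also have "\<dots> = of_real (sqrt (2 * pi) * exp (- (s * u)\<^sup>2 / 2))"
    unfolding integral_mult_right_zero ft_std_normal_density by simp
  also have "s *\<^sub>R \<dots> = complex_of_real (s * (sqrt (2 * pi) * exp (- (s * u)\<^sup>2 / 2)))"
    by (simp add: scaleR_conv_of_real)
  also have "s * (sqrt (2 * pi) * exp (- (s * u)\<^sup>2 / 2)) = 2 * pi * normal_density 0 (1 / s) u"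
  proof -
    have "2 * pi = sqrt (2 * pi) * sqrt (2 * pi)" by simp
    then show ?thesis
      using s by (simp add: normal_density_def real_sqrt_divide real_sqrt_mult power_divide
          power_mult_distrib field_simps)
  qed
  finally show ?thesis .
qed

text \<open>The multiplication formula with a modulated weight: modulation by \<open>x\<close> moves
  the transformed Gaussian to the centre \<open>x\<close>. The damped inverse integral of
  \<open>ft p\<close> thus becomes a smoothing of \<open>p\<close> around \<open>x\<close>.\<close>

lemma gauss_weighted_inversion:
  assumes p: "integrable lborel p" and s: "s > 0"
  shows "(LINT w|lborel. of_real (gauss s w) * exp (\<i> * of_real x * of_real w) * ft p w)
    = (LINT y|lborel. p y * of_real (2 * pi * normal_density 0 (1 / s) (y - x)))"
proof -
  have int: "integrable lborel (\<lambda>w. complex_of_real (gauss s w) * exp (\<i> * of_real x * of_real w))"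
    by (intro integrable_mult_exp_imaginary integrable_of_real integrable_gauss s)
  have "ft (\<lambda>w. of_real (gauss s w) * exp (\<i> * of_real x * of_real w)) y
      = of_real (2 * pi * normal_density 0 (1 / s) (y - x))" for y
  proof -
    have "ft (\<lambda>w. of_real (gauss s w) * exp (\<i> * of_real x * of_real w)) y
        = ft (\<lambda>w. of_real (gauss s w)) (y - x)"
      unfolding ft_def
      by (intro Bochner_Integration.integral_cong refl)
         (simp add: mult.assoc exp_add[symmetric] algebra_simps del: of_real_exp)
    then show ?thesis by (simp add: ft_gauss[OF s])
  qed
  with ft_multiplication[OF p int] show ?thesis by simp
qed

section \<open>Bessel's inequality\<close>

lemma nn_integral_fatou_le:
  fixes u :: "nat \<Rightarrow> 'a \<Rightarrow> ennreal"
  assumes "\<And>n. u n \<in> borel_measurable M" "AE x in M. (\<lambda>n. u n x) \<longlonglongrightarrow> v x"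
    and "\<And>n. (\<integral>\<^sup>+ x. u n x \<partial>M) \<le> c n" and "c \<longlonglongrightarrow> C"
  shows "(\<integral>\<^sup>+ x. v x \<partial>M) \<le> C"
proof -
  have "(\<integral>\<^sup>+ x. v x \<partial>M) = (\<integral>\<^sup>+ x. liminf (\<lambda>n. u n x) \<partial>M)"
    using assms(2) by (intro nn_integral_cong_AE) (auto simp: lim_imp_Liminf)
  also have "\<dots> \<le> liminf (\<lambda>n. \<integral>\<^sup>+ x. u n x \<partial>M)" by (intro nn_integral_liminf assms)
  also have "\<dots> \<le> liminf c" by (intro Liminf_mono always_eventually allI assms)
  also have "\<dots> = C" using assms(4) by (simp add: lim_imp_Liminf)
  finally show ?thesis .
qed

lemma nn_integral_normal_density_shift:
  assumes "s > 0"
  shows "(\<integral>\<^sup>+ y. ennreal (normal_density 0 s (y - x)) \<partial>lborel) = 1"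
    "(\<integral>\<^sup>+ y. ennreal (normal_density 0 s (x - y)) \<partial>lborel) = 1"
proof -
  have "normal_density 0 s (y - x) = normal_density x s y"
    "normal_density 0 s (x - y) = normal_density x s y" for y
    by (simp_all add: normal_density_def power2_commute)
  moreover have "(\<integral>\<^sup>+ y. ennreal (normal_density x s y) \<partial>lborel) = 1"
    using assms by (subst nn_integral_eq_integral) auto
  ultimately show "(\<integral>\<^sup>+ y. ennreal (normal_density 0 s (y - x)) \<partial>lborel) = 1"
    "(\<integral>\<^sup>+ y. ennreal (normal_density 0 s (x - y)) \<partial>lborel) = 1" by simp_all
qed

text \<open>Pairing \<open>ft p\<close> with its weighted conjugate \<open>q\<close> and exchanging
  the transform turns the left side into an integral of \<open>p\<close> against a smoothing of its
  own conjugate. Smoothing by a probability density does not raise the quadratic norm, so the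
  constant is just the mass \<open>2 * pi\<close> of the transformed Gaussian.\<close>

lemma gauss_weighted_bessel:
  assumes p: "integrable lborel p" and p2: "integrable lborel (\<lambda>x. (cmod (p x))\<^sup>2)" and s: "s > 0"
  shows "(\<integral>\<^sup>+ w. ennreal (gauss s w * (cmod (ft p w))\<^sup>2) \<partial>lborel)
    \<le> ennreal (2 * pi * (LINT x|lborel. (cmod (p x))\<^sup>2))"
proof -
  have [measurable]: "p \<in> borel_measurable borel" using p by auto
  let ?N = "\<lambda>x y. normal_density 0 (1 / s) (y - x)"
  define A where "A = (LINT x|lborel. cmod (p x))"
  have A: "cmod (ft p w) \<le> A" for w unfolding A_def by (rule norm_ft_le)
  define q where "q = (\<lambda>w. of_real (gauss s w) * cnj (ft p w))"
  have q: "integrable lborel q"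
  proof (rule Bochner_Integration.integrable_bound)
    show "integrable lborel (\<lambda>w. A * gauss s w)" by (intro integrable_mult_right integrable_gauss s)
    have "A \<ge> 0" by (simp add: A_def)
    then show "AE w in lborel. norm (q w) \<le> norm (A * gauss s w)"
      using A by (auto simp: q_def norm_mult mult.commute[of A] intro!: mult_left_mono)
  qed (simp add: q_def)
  have gq: "gauss s w * (cmod (ft p w))\<^sup>2 = Re (q w * ft p w)" for w
  proof -
    have "q w * ft p w = of_real (gauss s w * (cmod (ft p w))\<^sup>2)"
      by (simp only: q_def of_real_mult complex_norm_square) (simp add: mult_ac)
    then show ?thesis by simp
  qed
  have iq: "integrable lborel (\<lambda>w. q w * ft p w)"
  proof (rule Bochner_Integration.integrable_bound)
    show "integrable lborel (\<lambda>w. A * cmod (q w))" using q by auto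
    show "AE w in lborel. norm (q w * ft p w) \<le> norm (A * cmod (q w))"
      using A order_trans[OF norm_ge_zero A] by (auto simp: norm_mult mult.commute[of A] intro!: mult_left_mono)
  qed (simp add: q_def)
  have ig: "integrable lborel (\<lambda>w. gauss s w * (cmod (ft p w))\<^sup>2)" unfolding gq by (rule integrable_bounded_linear[OF bounded_linear_Re iq])
  have ftq: "ft q x = cnj (LINT y|lborel. p y * of_real (2 * pi * ?N x y))" for x
  proof -
    have "ft q x = (LINT w|lborel. cnj (of_real (gauss s w) * exp (\<i> * of_real x * of_real w) * ft p w))"
      unfolding ft_def[of q] by (intro Bochner_Integration.integral_cong refl) (simp add: q_def exp_cnj mult_ac)
    also have "\<dots> = cnj (LINT w|lborel. of_real (gauss s w) * exp (\<i> * of_real x * of_real w) * ft p w)"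
      by (rule Bochner_Integration.integral_cnj)
    finally show ?thesis by (simp only: gauss_weighted_inversion[OF p s])
  qed
  have ftq_le: "ennreal (cmod (ft q x)) \<le> (\<integral>\<^sup>+ y. ennreal (cmod (p y) * (2 * pi * ?N x y)) \<partial>lborel)" for x
  proof -
    have "ennreal (cmod (ft q x)) \<le> ennreal (cmod (LINT y|lborel. p y * of_real (2 * pi * ?N x y)))"
      unfolding ftq by simp
    also have "\<dots> \<le> (\<integral>\<^sup>+ y. ennreal (norm (p y * of_real (2 * pi * ?N x y))) \<partial>lborel)"
      by (rule norm_integral_le_nn_integral)
    finally show ?thesis by (simp add: norm_mult abs_mult)
  qed
  have "(\<integral>\<^sup>+ w. ennreal (gauss s w * (cmod (ft p w))\<^sup>2) \<partial>lborel) = ennreal (LINT w|lborel. gauss s w * (cmod (ft p w))\<^sup>2)"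
    by (intro nn_integral_eq_integral ig) simp
  also have "(LINT w|lborel. gauss s w * (cmod (ft p w))\<^sup>2) = Re (LINT w|lborel. q w * ft p w)"
    unfolding gq by (rule integral_bounded_linear[OF bounded_linear_Re iq])
  also have "(LINT w|lborel. q w * ft p w) = (LINT x|lborel. p x * ft q x)" by (rule ft_multiplication[OF p q])
  also have "ennreal (Re \<dots>) \<le> ennreal (cmod \<dots>)" by (intro ennreal_leI complex_Re_le_cmod)
  also have "\<dots> \<le> (\<integral>\<^sup>+ x. ennreal (norm (p x * ft q x)) \<partial>lborel)" by (rule norm_integral_le_nn_integral)
  also have "\<dots> \<le> (\<integral>\<^sup>+ x. ennreal (cmod (p x)) * (\<integral>\<^sup>+ y. ennreal (cmod (p y) * (2 * pi * ?N x y)) \<partial>lborel) \<partial>lborel)"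
  proof (intro nn_integral_mono)
    fix x
    show "ennreal (norm (p x * ft q x))
        \<le> ennreal (cmod (p x)) * (\<integral>\<^sup>+ y. ennreal (cmod (p y) * (2 * pi * ?N x y)) \<partial>lborel)"
      unfolding norm_mult ennreal_mult[OF norm_ge_zero norm_ge_zero] by (intro mult_left_mono ftq_le) simp
  qed
  also have "\<dots> = (\<integral>\<^sup>+ x. \<integral>\<^sup>+ y. ennreal (cmod (p x) * (cmod (p y) * (2 * pi * ?N x y))) \<partial>lborel \<partial>lborel)"
    by (subst nn_integral_cmult[symmetric]) (auto simp: ennreal_mult)
  also have "\<dots> \<le> (\<integral>\<^sup>+ x. \<integral>\<^sup>+ y. ennreal (pi * (cmod (p x))\<^sup>2) * ennreal (?N x y)
      + ennreal (pi * (cmod (p y))\<^sup>2) * ennreal (?N x y) \<partial>lborel \<partial>lborel)"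
  proof (intro nn_integral_mono)
    \<comment> \<open>Splitting by \<open>2 * a * b \<le> a\<^sup>2 + b\<^sup>2\<close> leaves in
      each half a square in one variable only, so the density integrates to 1 over the
      other.\<close>
    fix x y
    have "2 * (cmod (p x) * cmod (p y)) \<le> (cmod (p x))\<^sup>2 + (cmod (p y))\<^sup>2"
      using sum_squares_bound[of "cmod (p x)" "cmod (p y)"] by simp
    then have "(2 * (cmod (p x) * cmod (p y))) * (pi * ?N x y) \<le> ((cmod (p x))\<^sup>2 + (cmod (p y))\<^sup>2) * (pi * ?N x y)"
      by (intro mult_right_mono) auto
    then show "ennreal (cmod (p x) * (cmod (p y) * (2 * pi * ?N x y)))
       \<le> ennreal (pi * (cmod (p x))\<^sup>2) * ennreal (?N x y) + ennreal (pi * (cmod (p y))\<^sup>2) * ennreal (?N x y)"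
      by (simp add: ennreal_mult[symmetric] ennreal_plus[symmetric] ennreal_leI algebra_simps del: ennreal_plus)
  qed
  also have "\<dots> = (\<integral>\<^sup>+ x. \<integral>\<^sup>+ y. ennreal (pi * (cmod (p x))\<^sup>2) * ennreal (?N x y) \<partial>lborel \<partial>lborel)
      + (\<integral>\<^sup>+ x. \<integral>\<^sup>+ y. ennreal (pi * (cmod (p y))\<^sup>2) * ennreal (?N x y) \<partial>lborel \<partial>lborel)"
    by (subst nn_integral_add, simp, simp)+ simp
  also have "(\<integral>\<^sup>+ x. \<integral>\<^sup>+ y. ennreal (pi * (cmod (p y))\<^sup>2) * ennreal (?N x y) \<partial>lborel \<partial>lborel)
      = (\<integral>\<^sup>+ y. \<integral>\<^sup>+ x. ennreal (pi * (cmod (p y))\<^sup>2) * ennreal (?N x y) \<partial>lborel \<partial>lborel)"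
    by (rule lborel_pair.Fubini') simp
  also have "\<dots> = (\<integral>\<^sup>+ y. ennreal (pi * (cmod (p y))\<^sup>2) \<partial>lborel)"
    using s by (subst nn_integral_cmult) (auto simp: nn_integral_normal_density_shift)
  also have "(\<integral>\<^sup>+ x. \<integral>\<^sup>+ y. ennreal (pi * (cmod (p x))\<^sup>2) * ennreal (?N x y) \<partial>lborel \<partial>lborel)
      = (\<integral>\<^sup>+ y. ennreal (pi * (cmod (p y))\<^sup>2) \<partial>lborel)"
    using s by (subst nn_integral_cmult) (auto simp: nn_integral_normal_density_shift)
  also have "(\<integral>\<^sup>+ y. ennreal (pi * (cmod (p y))\<^sup>2) \<partial>lborel) = ennreal (pi * (LINT x|lborel. (cmod (p x))\<^sup>2))"
    using p2 by (subst nn_integral_eq_integral) auto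
  also have "\<dots> + \<dots> = ennreal (2 * pi * (LINT x|lborel. (cmod (p x))\<^sup>2))"
    by (simp add: ennreal_plus[symmetric] del: ennreal_plus)
  finally show ?thesis .
qed

text \<open>The weighted bound does not depend on the weight, and the weights tend to 1, so Fatou
  removes them.\<close>

lemma bessel:
  assumes p: "integrable lborel p" and p2: "integrable lborel (\<lambda>x. (cmod (p x))\<^sup>2)"
  shows "(\<integral>\<^sup>+ w. ennreal ((cmod (ft p w))\<^sup>2) \<partial>lborel) \<le> ennreal (2 * pi * (LINT x|lborel. (cmod (p x))\<^sup>2))"
proof (rule nn_integral_fatou_le)
  have [measurable]: "p \<in> borel_measurable borel" using p by auto
  show "(\<lambda>w. ennreal (gauss (real (Suc n)) w * (cmod (ft p w))\<^sup>2)) \<in> borel_measurable lborel" for n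
    by simp
  show "AE w in lborel. (\<lambda>n. ennreal (gauss (real (Suc n)) w * (cmod (ft p w))\<^sup>2)) \<longlonglongrightarrow> ennreal ((cmod (ft p w))\<^sup>2)"
  proof (rule AE_I2, rule tendsto_ennrealI)
    fix w
    show "(\<lambda>n. gauss (real (Suc n)) w * (cmod (ft p w))\<^sup>2) \<longlonglongrightarrow> (cmod (ft p w))\<^sup>2"
      using tendsto_mult[OF gauss_tendsto_1 tendsto_const] by force
  qed
  show "(\<integral>\<^sup>+ w. ennreal (gauss (real (Suc n)) w * (cmod (ft p w))\<^sup>2) \<partial>lborel)
      \<le> ennreal (2 * pi * (LINT x|lborel. (cmod (p x))\<^sup>2))" for n
    by (rule gauss_weighted_bessel[OF p p2]) simp
qed simp

subsection \<open>The spectral density of a positive definite function\<close>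

lemma norm_diff_power2_le: "(cmod (a - b))\<^sup>2 \<le> 2 * (cmod a)\<^sup>2 + 2 * (cmod b)\<^sup>2"
proof -
  have "(cmod (a - b))\<^sup>2 \<le> (cmod a + cmod b)\<^sup>2" by (intro power_mono norm_triangle_ineq4) simp
  also have "\<dots> \<le> 2 * (cmod a)\<^sup>2 + 2 * (cmod b)\<^sup>2"
    using sum_squares_bound[of "cmod a" "cmod b"] by (simp add: power2_sum)
  finally show ?thesis .
qed

lemma mult_le_weighted_squares:
  fixes a b c :: real
  assumes "c > 0"
  shows "a * b \<le> c * a\<^sup>2 + b\<^sup>2 / c"
proof -
  have "2 * (a * b) = 2 * ((sqrt c * a) * (b / sqrt c))" using assms by simp
  also have "\<dots> \<le> (sqrt c * a)\<^sup>2 + (b / sqrt c)\<^sup>2"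
    using sum_squares_bound[of "sqrt c * a" "b / sqrt c"] by (simp only: mult.assoc)
  also have "\<dots> = c * a\<^sup>2 + b\<^sup>2 / c" using assms by (simp add: power_mult_distrib power_divide)
  finally have "2 * (a * b) \<le> c * a\<^sup>2 + b\<^sup>2 / c" .
  moreover have "0 \<le> c * a\<^sup>2 + b\<^sup>2 / c" using assms by simp
  ultimately show ?thesis by linarith
qed

text \<open>On the whole line a quadratic norm does not control the integral of the modulus, but an
  integrable weight repairs this. The parameter \<open>c\<close> balances the two terms: for
  \<open>C\<close> of order \<open>4^-n\<close>, the choice \<open>c = 2^n\<close> makes both of
  order \<open>2^-n\<close>.\<close>

lemma nn_integral_gauss_mult_le:
  assumes d [measurable]: "d \<in> borel_measurable borel" and s: "s > 0" and c: "c > 0"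
    and C: "C \<ge> 0" and le: "(\<integral>\<^sup>+ w. ennreal ((cmod (d w))\<^sup>2) \<partial>lborel) \<le> ennreal C"
  shows "(\<integral>\<^sup>+ w. ennreal (gauss s w * cmod (d w)) \<partial>lborel)
    \<le> ennreal (c * C + (LINT w|lborel. gauss s w) / c)"
proof -
  have "(\<integral>\<^sup>+ w. ennreal (gauss s w * cmod (d w)) \<partial>lborel)
      \<le> (\<integral>\<^sup>+ w. ennreal c * ennreal ((cmod (d w))\<^sup>2) + ennreal (gauss s w / c) \<partial>lborel)"
  proof (intro nn_integral_mono)
    fix w
    have "(gauss s w)\<^sup>2 \<le> gauss s w" by (simp add: power2_eq_square mult_left_le)
    then have "(gauss s w)\<^sup>2 / c \<le> gauss s w / c" using c by (intro divide_right_mono) auto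
    then have "gauss s w * cmod (d w) \<le> c * (cmod (d w))\<^sup>2 + gauss s w / c"
      using mult_le_weighted_squares[OF c, of "cmod (d w)" "gauss s w"] by (simp add: mult.commute)
    then have "ennreal (gauss s w * cmod (d w)) \<le> ennreal (c * (cmod (d w))\<^sup>2 + gauss s w / c)" by (rule ennreal_leI)
    also have "\<dots> = ennreal c * ennreal ((cmod (d w))\<^sup>2) + ennreal (gauss s w / c)"
      using c by (simp add: ennreal_mult[symmetric] ennreal_plus[symmetric] del: ennreal_plus)
    finally show "ennreal (gauss s w * cmod (d w)) \<le> ennreal c * ennreal ((cmod (d w))\<^sup>2) + ennreal (gauss s w / c)" .
  qed
  also have "\<dots> = ennreal c * (\<integral>\<^sup>+ w. ennreal ((cmod (d w))\<^sup>2) \<partial>lborel) + (\<integral>\<^sup>+ w. ennreal (gauss s w / c) \<partial>lborel)"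
    by (subst nn_integral_add) (auto simp: nn_integral_cmult)
  also have "(\<integral>\<^sup>+ w. ennreal (gauss s w / c) \<partial>lborel) = ennreal ((LINT w|lborel. gauss s w) / c)"
    using c by (subst nn_integral_eq_integral) (auto intro: integrable_gauss s)
  also have "ennreal c * (\<integral>\<^sup>+ w. ennreal ((cmod (d w))\<^sup>2) \<partial>lborel) + \<dots>
      \<le> ennreal c * ennreal C + ennreal ((LINT w|lborel. gauss s w) / c)"
    by (intro add_right_mono mult_left_mono le) simp
  also have "ennreal c * ennreal C = ennreal (c * C)" using c by (simp add: ennreal_mult')
  also have "ennreal (c * C) + ennreal ((LINT w|lborel. gauss s w) / c)
      = ennreal (c * C + (LINT w|lborel. gauss s w) / c)"
    using c C by (simp add: ennreal_plus[symmetric] del: ennreal_plus)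
  finally show ?thesis .
qed

text \<open>The weighted integrals of the increments are summable, so the weighted increments have a
  finite sum almost everywhere, and the positive weight can be divided out at each point.
  Telescoping then gives convergence.\<close>

lemma L2_cauchy_AE_convergent:
  fixes u :: "nat \<Rightarrow> real \<Rightarrow> complex"
  assumes [measurable]: "\<And>n. u n \<in> borel_measurable borel" and C: "C \<ge> 0"
    and le: "\<And>n. (\<integral>\<^sup>+ w. ennreal ((cmod (u (Suc n) w - u n w))\<^sup>2) \<partial>lborel) \<le> ennreal (C * (1/4) ^ n)"
  shows "AE w in lborel. convergent (\<lambda>n. u n w)"
proof -
  define G where "G = (LINT w|lborel. gauss 1 w)"
  have G: "G \<ge> 0" by (simp add: G_def)
  have le': "(\<integral>\<^sup>+ w. ennreal (gauss 1 w * cmod (u (Suc n) w - u n w)) \<partial>lborel) \<le> ennreal ((C + G) * (1/2) ^ n)" for n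
  proof -
    have "(\<integral>\<^sup>+ w. ennreal (gauss 1 w * cmod (u (Suc n) w - u n w)) \<partial>lborel)
        \<le> ennreal (2 ^ n * (C * (1/4) ^ n) + G / 2 ^ n)"
      unfolding G_def using C by (intro nn_integral_gauss_mult_le le) auto
    also have "2 ^ n * (C * (1/4) ^ n) + G / 2 ^ n = (C + G) * (1/2) ^ n"
    proof -
      have "(2::real) ^ n * (1/4) ^ n = (2 * (1/4)) ^ n" by (rule power_mult_distrib[symmetric])
      then have "(2::real) ^ n * (C * (1/4) ^ n) = C * (1/2) ^ n" by (simp add: mult.left_commute)
      moreover have "G / 2 ^ n = G * (1/2) ^ n" by (simp add: power_one_over)
      ultimately show ?thesis by (simp only: distrib_right)
    qed
    finally show ?thesis .
  qed
  have "(\<integral>\<^sup>+ w. (\<Sum>n. ennreal (gauss 1 w * cmod (u (Suc n) w - u n w))) \<partial>lborel)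
      = (\<Sum>n. \<integral>\<^sup>+ w. ennreal (gauss 1 w * cmod (u (Suc n) w - u n w)) \<partial>lborel)"
    by (rule nn_integral_suminf) simp
  also have "\<dots> \<le> (\<Sum>n. ennreal ((C + G) * (1/2) ^ n))"
    by (intro suminf_le le') auto
  also have "\<dots> = ennreal (\<Sum>n. (C + G) * (1/2) ^ n)"
    using C G by (intro suminf_ennreal2 summable_mult summable_geometric) auto
  also have "\<dots> < \<infinity>" by simp
  finally have "AE w in lborel. (\<Sum>n. ennreal (gauss 1 w * cmod (u (Suc n) w - u n w))) \<noteq> \<infinity>"
    by (intro nn_integral_noteq_infinite) auto
  then show ?thesis
  proof eventually_elim
    case (elim w)
    then have "summable (\<lambda>n. gauss 1 w * cmod (u (Suc n) w - u n w))"
      by (intro summable_suminf_not_top) auto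
    then have "summable (\<lambda>n. cmod (u (Suc n) w - u n w))"
      using summable_mult_D[of "gauss 1 w"] by (metis gauss_bounds(2) less_numeral_extra(3))
    then have "summable (\<lambda>n. u (Suc n) w - u n w)" by (rule summable_norm_cancel)
    then have "convergent (\<lambda>n. \<Sum>i<n. u (Suc i) w - u i w)" by (simp add: summable_iff_convergent)
    then have "convergent (\<lambda>n. u n w - u 0 w)" by (simp only: sum_lessThan_telescope[of "\<lambda>n. u n w"])
    then have "convergent (\<lambda>n. (u n w - u 0 w) + u 0 w)" by (intro convergent_add convergent_const)
    then show ?case by simp
  qed
qed

section \<open>The limiting density and its inversion formula\<close>

definition ift :: "(real \<Rightarrow> real) \<Rightarrow> real \<Rightarrow> complex" where
  "ift F x = (LINT w|lborel. of_real (F w) * exp (\<i> * of_real w * of_real x)) / (2 * of_real pi)"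

text \<open>Rescaling by \<open>y = x + t / s\<close> trades the concentrating kernel for a fixed
  normal density, with \<open>p\<close> evaluated ever closer to \<open>x\<close>; dominated
  convergence then works with one majorant.\<close>

lemma integral_shift_normal_density:
  assumes s: "s > 0"
  shows "(LINT y|lborel. (p y :: complex) * of_real (2 * pi * normal_density 0 (1 / s) (y - x)))
    = 2 * of_real pi * (LINT t|lborel. p (x + t / s) * of_real (std_normal_density t))"
proof -
  have "(LINT y|lborel. p y * of_real (2 * pi * normal_density 0 (1 / s) (y - x)))
      = \<bar>1 / s\<bar> *\<^sub>R (LINT t|lborel. p (x + 1 / s * t) * of_real (2 * pi * normal_density 0 (1 / s) (x + 1 / s * t - x)))"
    using s by (intro lborel_integral_real_affine) auto
  also have "\<dots> = (LINT t|lborel. 2 * of_real pi * (p (x + t / s) * of_real (std_normal_density t)))"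
    unfolding integral_scaleR_right[symmetric]
  proof (intro Bochner_Integration.integral_cong refl)
    fix t
    have *: "std_normal_density t = \<bar>1 / s\<bar> * normal_density 0 (1 / s) (x + 1 / s * t - x)"
      using s by (simp add: normal_density_def real_sqrt_divide real_sqrt_mult power_divide)
    show "\<bar>1 / s\<bar> *\<^sub>R (p (x + 1 / s * t) * of_real (2 * pi * normal_density 0 (1 / s) (x + 1 / s * t - x)))
      = 2 * of_real pi * (p (x + t / s) * of_real (std_normal_density t))"
      unfolding * by (simp add: scaleR_conv_of_real)
  qed
  finally show ?thesis by simp
qed

lemma truncated_fourier_eq_ft: "truncated_fourier f R = ft (\<lambda>x. indicator {-R..R} x *\<^sub>R f x)"
  by (simp add: fun_eq_iff truncated_fourier_def ft_def set_lebesgue_integral_def)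

text \<open>Up to a positive factor the transform at \<open>w\<close> is a normal average of the
  modulated \<open>f\<close>, so its real part is nonnegative. It is real because conjugating the
  integrand amounts to reflecting \<open>x\<close>, which leaves the integral unchanged.\<close>

lemma ft_gauss_nonneg:
  fixes f :: "real \<Rightarrow> complex"
  assumes pd: "positive_definite f" and cont: "continuous_on UNIV f" and s: "s > 0"
  shows "ft (\<lambda>x. f x * of_real (gauss s x)) w \<in> \<real>" "0 \<le> Re (ft (\<lambda>x. f x * of_real (gauss s x)) w)"
proof -
  let ?e = "\<lambda>x. exp (- (\<i> * of_real w * of_real x))"
  have "ft (\<lambda>x. f x * of_real (gauss s x)) w = (LINT x|lborel. of_real (s * sqrt (2 * pi)) * (normal_density 0 s x *\<^sub>R (f x * ?e x)))"
    unfolding ft_def gauss_eq_normal_density[OF s]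
    by (intro Bochner_Integration.integral_cong refl) (simp add: scaleR_conv_of_real)
  also have "\<dots> = of_real (s * sqrt (2 * pi)) * (LINT x|lborel. normal_density 0 s x *\<^sub>R (f x * ?e x))"
    by (rule integral_mult_right_zero)
  finally have "Re (ft (\<lambda>x. f x * of_real (gauss s x)) w)
      = s * sqrt (2 * pi) * Re (LINT x|lborel. normal_density 0 s x *\<^sub>R (f x * ?e x))"
    by (simp only: Re_complex_of_real times_complex.simps Im_complex_of_real mult_zero_left diff_zero)
  moreover have "0 \<le> Re (LINT x|lborel. normal_density 0 s x *\<^sub>R (f x * ?e x))"
    by (intro positive_definite_normal_average positive_definite_modulate pd s continuous_intros cont)
  ultimately show "0 \<le> Re (ft (\<lambda>x. f x * of_real (gauss s x)) w)" using s by simp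
  have "cnj (ft (\<lambda>x. f x * of_real (gauss s x)) w)
      = (LINT x|lborel. cnj (f x * of_real (gauss s x) * ?e x))"
    unfolding ft_def by (rule Bochner_Integration.integral_cnj[symmetric])
  also have "\<dots> = (LINT x|lborel. f (0 + -1 * x) * of_real (gauss s (0 + -1 * x)) * ?e (0 + -1 * x))"
  proof (intro Bochner_Integration.integral_cong refl)
    fix x
    have "f (- x) = cnj (f x)" using pd unfolding positive_definite_iff_qform by blast
    then show "cnj (f x * of_real (gauss s x) * ?e x)
        = f (0 + -1 * x) * of_real (gauss s (0 + -1 * x)) * ?e (0 + -1 * x)"
      by (simp add: exp_cnj gauss_def)
  qed
  also have "\<dots> = ft (\<lambda>x. f x * of_real (gauss s x)) w"
    unfolding ft_def by (subst (2) lborel_integral_real_affine[where c = "-1" and t = 0]) auto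
  finally show "ft (\<lambda>x. f x * of_real (gauss s x)) w \<in> \<real>" by (simp add: Reals_cnj_iff)
qed

lemma square_integrable_gauss_tendsto:
  fixes f :: "real \<Rightarrow> complex"
  assumes si: "square_integrable f"
  shows "(\<lambda>k. LINT x|lborel. (cmod (f x * of_real (gauss (real (Suc k)) x) - f x))\<^sup>2) \<longlonglongrightarrow> 0"
proof -
  have [measurable]: "f \<in> borel_measurable borel" and f2: "integrable lborel (\<lambda>x. (cmod (f x))\<^sup>2)"
    using si by (auto simp: square_integrable_def)
  have "(\<lambda>k. LINT x|lborel. (cmod (f x * of_real (gauss (real (Suc k)) x) - f x))\<^sup>2) \<longlonglongrightarrow> (LINT x::real|lborel. 0)"
  proof (rule integral_dominated_convergence[where w = "\<lambda>x. (cmod (f x))\<^sup>2"])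
    show "AE x in lborel. (\<lambda>k. (cmod (f x * of_real (gauss (real (Suc k)) x) - f x))\<^sup>2) \<longlonglongrightarrow> 0"
    proof (rule AE_I2)
      fix x
      have "(\<lambda>k. (cmod (f x * of_real (gauss (real (Suc k)) x) - f x))\<^sup>2) \<longlonglongrightarrow> (cmod (f x * of_real 1 - f x))\<^sup>2"
        by (intro tendsto_intros gauss_tendsto_1)
      then show "(\<lambda>k. (cmod (f x * of_real (gauss (real (Suc k)) x) - f x))\<^sup>2) \<longlonglongrightarrow> 0" by simp
    qed
    show "AE x in lborel. norm ((cmod (f x * of_real (gauss (real (Suc k)) x) - f x))\<^sup>2) \<le> (cmod (f x))\<^sup>2" for k
    proof (rule AE_I2)
      fix x
      have "f x * of_real (gauss (real (Suc k)) x) - f x = - (f x * of_real (1 - gauss (real (Suc k)) x))"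
        by (simp add: algebra_simps)
      then have "cmod (f x * of_real (gauss (real (Suc k)) x) - f x) = cmod (f x) * (1 - gauss (real (Suc k)) x)"
        by (simp only: norm_minus_cancel norm_mult norm_of_real) simp
      also have "\<dots> \<le> cmod (f x)" by (intro mult_left_le) auto
      finally show "norm ((cmod (f x * of_real (gauss (real (Suc k)) x) - f x))\<^sup>2) \<le> (cmod (f x))\<^sup>2"
        by (simp add: power_mono)
    qed
  qed (use f2 in auto)
  then show ?thesis by simp
qed

proposition spectral_density:
  fixes f :: "real \<Rightarrow> complex"
  assumes si: "square_integrable f" and pd: "positive_definite f" and cont: "continuous_on UNIV f"
  obtains F :: "real \<Rightarrow> real" where "F \<in> borel_measurable borel" "\<And>w. 0 \<le> F w"
    "integrable lborel F" "integrable lborel (\<lambda>w. (F w)\<^sup>2)"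
    "f = ift F" "has_fourier_transform f (\<lambda>w. of_real (F w))"
proof -
  have f_meas [measurable]: "f \<in> borel_measurable borel" and f2: "integrable lborel (\<lambda>x. (cmod (f x))\<^sup>2)"
    using si by (auto simp: square_integrable_def)
  define c where "c = Re (f 0)"
  have c: "c \<ge> 0" "\<And>x. cmod (f x) \<le> c" using positive_definite_norm_le[OF pd] by (auto simp: c_def)
  \<comment> \<open>Errors below \<open>4^-n\<close> leave room for the factor \<open>2^n\<close>
    lost in passing to weighted integrals of the modulus; \<open>k n \<ge> n\<close> makes the
    damping disappear along the chosen sequence.\<close>
  have "\<exists>k\<ge>n. (LINT x|lborel. (cmod (f x * of_real (gauss (real (Suc k)) x) - f x))\<^sup>2) < (1/4) ^ n" for n
    using eventually_conj[OF eventually_ge_at_top[of n]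
        order_tendstoD(2)[OF square_integrable_gauss_tendsto[OF si], of "(1/4) ^ n"]]
    by (auto dest: eventually_happens)
  then obtain k where k: "\<And>n. k n \<ge> n"
    "\<And>n. (LINT x|lborel. (cmod (f x * of_real (gauss (real (Suc (k n))) x) - f x))\<^sup>2) < (1/4) ^ n"
    by metis
  define g where "g = (\<lambda>n x. f x * of_real (gauss (real (Suc (k n))) x))"
  have g_meas [measurable]: "g n \<in> borel_measurable borel" for n by (simp add: g_def)
  have g_le: "cmod (g n x) \<le> cmod (f x)" for n x
    by (simp add: g_def norm_mult mult_left_le)
  have g_int: "integrable lborel (g n)" for n
  proof (rule Bochner_Integration.integrable_bound)
    show "integrable lborel (\<lambda>x. c * gauss (real (Suc (k n))) x)" by (intro integrable_mult_right integrable_gauss) simp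
    show "AE x in lborel. norm (g n x) \<le> norm (c * gauss (real (Suc (k n))) x)"
      using c by (auto simp: g_def norm_mult intro!: mult_right_mono)
  qed simp
  have g2: "integrable lborel (\<lambda>x. (cmod (g n x))\<^sup>2)" for n
    by (rule Bochner_Integration.integrable_bound[OF f2]) (auto intro!: power_mono g_le)
  have diff2: "integrable lborel (\<lambda>x. (cmod (p x - q x))\<^sup>2)"
    if [measurable]: "p \<in> borel_measurable borel" "q \<in> borel_measurable borel"
      and "integrable lborel (\<lambda>x. (cmod (p x))\<^sup>2)" "integrable lborel (\<lambda>x. (cmod (q x))\<^sup>2)"
    for p q :: "real \<Rightarrow> complex"
  proof (rule Bochner_Integration.integrable_bound)
    show "integrable lborel (\<lambda>x. 2 * (cmod (p x))\<^sup>2 + 2 * (cmod (q x))\<^sup>2)" using that by auto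
    show "AE x in lborel. norm ((cmod (p x - q x))\<^sup>2) \<le> norm (2 * (cmod (p x))\<^sup>2 + 2 * (cmod (q x))\<^sup>2)"
      using norm_diff_power2_le by auto
  qed simp
  have gf2: "integrable lborel (\<lambda>x. (cmod (g n x - f x))\<^sup>2)" for n
    by (rule diff2[OF g_meas f_meas g2 f2])
  have bessel_diff: "(\<integral>\<^sup>+ w. ennreal ((cmod (ft q w - ft (g n) w))\<^sup>2) \<partial>lborel)
      \<le> ennreal (2 * pi * (LINT x|lborel. (cmod (q x - g n x))\<^sup>2))"
    if q: "integrable lborel q" "integrable lborel (\<lambda>x. (cmod (q x))\<^sup>2)" for q n
  proof -
    have "q \<in> borel_measurable borel" using q by auto
    then show ?thesis
      using bessel[OF Bochner_Integration.integrable_diff[OF q(1) g_int] diff2[OF _ g_meas q(2) g2]]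
      by (simp add: ft_diff q g_int)
  qed
  have g_tendsto: "(\<lambda>n. g n x) \<longlonglongrightarrow> f x" for x
  proof -
    have "filterlim k at_top sequentially"
      using k(1) by (intro filterlim_at_top_mono[OF filterlim_ident]) auto
    then have "(\<lambda>n. gauss (real (Suc (k n))) x) \<longlonglongrightarrow> 1"
      by (rule filterlim_compose[OF gauss_tendsto_1])
    then have "(\<lambda>n. f x * of_real (gauss (real (Suc (k n))) x)) \<longlonglongrightarrow> f x * of_real 1"
      by (intro tendsto_intros)
    then show ?thesis by (simp add: g_def)
  qed
  have err_tendsto: "(\<lambda>n. LINT x|lborel. (cmod (q x - g n x))\<^sup>2) \<longlonglongrightarrow> (LINT x|lborel. (cmod (q x - f x))\<^sup>2)"
    if [measurable]: "q \<in> borel_measurable borel" and q2: "integrable lborel (\<lambda>x. (cmod (q x))\<^sup>2)" for q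
  proof (rule integral_dominated_convergence[where w = "\<lambda>x. 2 * (cmod (q x))\<^sup>2 + 2 * (cmod (f x))\<^sup>2"])
    show "AE x in lborel. (\<lambda>n. (cmod (q x - g n x))\<^sup>2) \<longlonglongrightarrow> (cmod (q x - f x))\<^sup>2"
      by (intro AE_I2 tendsto_intros g_tendsto)
    show "AE x in lborel. norm ((cmod (q x - g n x))\<^sup>2) \<le> 2 * (cmod (q x))\<^sup>2 + 2 * (cmod (f x))\<^sup>2" for n
    proof (rule AE_I2)
      fix x
      have "(cmod (g n x))\<^sup>2 \<le> (cmod (f x))\<^sup>2" by (intro power_mono g_le) simp
      then show "norm ((cmod (q x - g n x))\<^sup>2) \<le> 2 * (cmod (q x))\<^sup>2 + 2 * (cmod (f x))\<^sup>2"
        using norm_diff_power2_le[of "q x" "g n x"] unfolding real_norm_def abs_power2 by linarith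
    qed
  qed (use f2 q2 in auto)
  have conv: "AE w in lborel. convergent (\<lambda>n. ft (g n) w)"
  proof (rule L2_cauchy_AE_convergent)
    fix n
    have "(LINT x|lborel. (cmod (g (Suc n) x - g n x))\<^sup>2)
        \<le> (LINT x|lborel. 2 * (cmod (g (Suc n) x - f x))\<^sup>2 + 2 * (cmod (g n x - f x))\<^sup>2)"
    proof (rule integral_mono)
      fix x
      show "(cmod (g (Suc n) x - g n x))\<^sup>2 \<le> 2 * (cmod (g (Suc n) x - f x))\<^sup>2 + 2 * (cmod (g n x - f x))\<^sup>2"
        using norm_diff_power2_le[of "g (Suc n) x - f x" "g n x - f x"] by simp
    next
      show "integrable lborel (\<lambda>x. (cmod (g (Suc n) x - g n x))\<^sup>2)" by (rule diff2[OF g_meas g_meas g2 g2])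
      show "integrable lborel (\<lambda>x. 2 * (cmod (g (Suc n) x - f x))\<^sup>2 + 2 * (cmod (g n x - f x))\<^sup>2)"
        by (intro Bochner_Integration.integrable_add integrable_mult_right gf2)
    qed
    also have "\<dots> = 2 * (LINT x|lborel. (cmod (g (Suc n) x - f x))\<^sup>2) + 2 * (LINT x|lborel. (cmod (g n x - f x))\<^sup>2)"
      by (subst Bochner_Integration.integral_add) (simp_all add: gf2)
    also have "\<dots> \<le> 2 * (1/4) ^ Suc n + 2 * (1/4) ^ n"
      using k(2)[of n] k(2)[of "Suc n"] by (intro add_mono mult_left_mono) (simp_all add: g_def)
    also have "\<dots> \<le> 4 * (1/4) ^ n" by simp
    finally have "2 * pi * (LINT x|lborel. (cmod (g (Suc n) x - g n x))\<^sup>2) \<le> 2 * pi * (4 * (1/4) ^ n)"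
      by (rule mult_left_mono) simp
    also have "\<dots> = 8 * pi * (1/4) ^ n" by simp
    finally show "(\<integral>\<^sup>+ w. ennreal ((cmod (ft (g (Suc n)) w - ft (g n) w))\<^sup>2) \<partial>lborel) \<le> ennreal (8 * pi * (1/4) ^ n)"
      by (intro order_trans[OF bessel_diff[OF g_int g2]] ennreal_leI)
  qed auto
  \<comment> \<open>\<open>max 0\<close> makes the density nonnegative everywhere, including the
    null set where \<open>lim\<close> has no meaningful value. Real parts suffice because the damped
    transforms are real.\<close>
  define F where "F = (\<lambda>w. max 0 (lim (\<lambda>n. Re (ft (g n) w))))"
  from conv have F_lim: "AE w in lborel. (\<lambda>n. ft (g n) w) \<longlonglongrightarrow> of_real (F w)"
  proof eventually_elim
    case (elim w)
    then obtain l where l: "(\<lambda>n. ft (g n) w) \<longlonglongrightarrow> l" by (auto simp: convergent_def)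
    have r: "ft (g n) w = of_real (Re (ft (g n) w))" "0 \<le> Re (ft (g n) w)" for n
      using ft_gauss_nonneg[OF pd cont, of "real (Suc (k n))" w] by (simp_all add: g_def)
    from tendsto_Re[OF l] have "lim (\<lambda>n. Re (ft (g n) w)) = Re l" by (rule limI)
    moreover have "0 \<le> Re l" by (rule LIMSEQ_le_const[OF tendsto_Re[OF l]]) (use r in auto)
    ultimately have "F w = Re l" by (simp add: F_def)
    moreover have "(\<lambda>n. complex_of_real (Re (ft (g n) w))) \<longlonglongrightarrow> of_real (Re l)"
      by (intro tendsto_intros tendsto_Re l)
    ultimately show ?case by (simp only: r(1)[symmetric])
  qed
  have F_meas [measurable]: "F \<in> borel_measurable borel" unfolding F_def by measurable
  have F_nonneg: "0 \<le> F w" for w by (simp add: F_def)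
  \<comment> \<open>Bessel's inequality with one argument already in the limit. It is used with
    \<open>q = 0\<close> for the norm of \<open>F\<close>, with \<open>q = g n\<close> for the rate
    of convergence, and with truncations of \<open>f\<close> for the transform in quadratic
    mean.\<close>
  have key: "(\<integral>\<^sup>+ w. ennreal ((cmod (ft q w - of_real (F w)))\<^sup>2) \<partial>lborel)
      \<le> ennreal (2 * pi * (LINT x|lborel. (cmod (q x - f x))\<^sup>2))"
    if q: "integrable lborel q" "integrable lborel (\<lambda>x. (cmod (q x))\<^sup>2)" for q
  proof (rule nn_integral_fatou_le)
    have [measurable]: "q \<in> borel_measurable borel" using q by auto
    show "AE w in lborel. (\<lambda>n. ennreal ((cmod (ft q w - ft (g n) w))\<^sup>2)) \<longlonglongrightarrow> ennreal ((cmod (ft q w - of_real (F w)))\<^sup>2)"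
      using F_lim by eventually_elim (intro tendsto_intros tendsto_ennrealI)
    show "(\<lambda>n. ennreal (2 * pi * (LINT x|lborel. (cmod (q x - g n x))\<^sup>2))) \<longlonglongrightarrow> ennreal (2 * pi * (LINT x|lborel. (cmod (q x - f x))\<^sup>2))"
      by (intro tendsto_intros tendsto_ennrealI err_tendsto q) simp
    show "(\<lambda>w. ennreal ((cmod (ft q w - ft (g n) w))\<^sup>2)) \<in> borel_measurable lborel" for n by simp
  qed (rule bessel_diff[OF q])
  have F2: "integrable lborel (\<lambda>w. (F w)\<^sup>2)"
  proof -
    have "(\<integral>\<^sup>+ w. ennreal ((F w)\<^sup>2) \<partial>lborel) \<le> ennreal (2 * pi * (LINT x|lborel. (cmod (f x))\<^sup>2))"
      using key[of "\<lambda>_. 0"] by (simp add: ft_def)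
    also have "\<dots> < \<infinity>" by simp
    finally show ?thesis by (intro integrableI_nonneg) auto
  qed
  \<comment> \<open>Regularized inversion at the point 0: the weighted mass of the nonnegative
    transform is \<open>2 * pi\<close> times a normal average of \<open>g n\<close>, hence at most
    \<open>2 * pi * c\<close>. Fatou removes the weight here, and a further use passes the bound on
    to \<open>F\<close>.\<close>
  have ft_g_bound: "(\<integral>\<^sup>+ w. ennreal (Re (ft (g n) w)) \<partial>lborel) \<le> ennreal (2 * pi * c)" for n
  proof (rule nn_integral_fatou_le)
    fix m
    have r: "ft (g n) w = of_real (Re (ft (g n) w))" "0 \<le> Re (ft (g n) w)" for w
      using ft_gauss_nonneg[OF pd cont, of "real (Suc (k n))" w] by (simp_all add: g_def)
    let ?G = "gauss (real (Suc m))"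
    have int: "integrable lborel (\<lambda>w. ?G w * Re (ft (g n) w))"
    proof (rule Bochner_Integration.integrable_bound)
      show "integrable lborel (\<lambda>w. ?G w * (LINT x|lborel. cmod (g n x)))"
        by (intro integrable_mult_left integrable_gauss) simp
      have "\<bar>Re (ft (g n) w)\<bar> \<le> \<bar>LINT x|lborel. cmod (g n x)\<bar>" for w
        using abs_Re_le_cmod[of "ft (g n) w"] norm_ft_le[of "g n" w] by linarith
      then show "AE w in lborel. norm (?G w * Re (ft (g n) w)) \<le> norm (?G w * (LINT x|lborel. cmod (g n x)))"
        by (auto simp: abs_mult intro!: mult_left_mono)
    qed simp
    have "(\<integral>\<^sup>+ w. ennreal (?G w * Re (ft (g n) w)) \<partial>lborel) = ennreal (LINT w|lborel. ?G w * Re (ft (g n) w))"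
      using r by (intro nn_integral_eq_integral int) auto
    also have "(LINT w|lborel. ?G w * Re (ft (g n) w)) \<le> cmod (of_real (LINT w|lborel. ?G w * Re (ft (g n) w)))"
      by simp
    also have "complex_of_real (LINT w|lborel. ?G w * Re (ft (g n) w))
        = (LINT w|lborel. of_real (?G w) * exp (\<i> * of_real 0 * of_real w) * ft (g n) w)"
      unfolding integral_complex_of_real[symmetric]
      by (intro Bochner_Integration.integral_cong refl) (simp add: r(1)[symmetric])
    also have "\<dots> = (LINT y|lborel. g n y * of_real (2 * pi * normal_density 0 (1 / real (Suc m)) (y - 0)))"
      by (rule gauss_weighted_inversion[OF g_int]) simp
    also have "cmod \<dots> \<le> (LINT y|lborel. 2 * pi * c * normal_density 0 (1 / real (Suc m)) y)"
    proof (rule Bochner_Integration.integral_norm_bound_integral)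
      fix y
      have "cmod (g n y) \<le> c" using g_le c(2) order_trans by blast
      then have "cmod (g n y) * (2 * pi * normal_density 0 (1 / real (Suc m)) y)
          \<le> c * (2 * pi * normal_density 0 (1 / real (Suc m)) y)"
        by (intro mult_right_mono) auto
      then show "norm (g n y * of_real (2 * pi * normal_density 0 (1 / real (Suc m)) (y - 0)))
          \<le> 2 * pi * c * normal_density 0 (1 / real (Suc m)) y"
        by (simp add: norm_mult abs_mult mult_ac)
    next
      show "integrable lborel (\<lambda>y. g n y * of_real (2 * pi * normal_density 0 (1 / real (Suc m)) (y - 0)))"
      proof (rule Bochner_Integration.integrable_bound)
        show "integrable lborel (\<lambda>y. c * (2 * pi * normal_density 0 (1 / real (Suc m)) y))" by simp
        have "cmod (g n y) \<le> c" for y using g_le c(2) order_trans by blast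
        then show "AE y in lborel. norm (g n y * of_real (2 * pi * normal_density 0 (1 / real (Suc m)) (y - 0)))
            \<le> norm (c * (2 * pi * normal_density 0 (1 / real (Suc m)) y))"
          using c(1) by (auto simp: norm_mult abs_mult intro!: mult_right_mono)
      qed simp
    qed simp
    also have "\<dots> = 2 * pi * c" by simp
    finally show "(\<integral>\<^sup>+ w. ennreal (?G w * Re (ft (g n) w)) \<partial>lborel) \<le> ennreal (2 * pi * c)"
      by (simp add: ennreal_leI)
  next
    show "AE w in lborel. (\<lambda>m. ennreal (gauss (real (Suc m)) w * Re (ft (g n) w))) \<longlonglongrightarrow> ennreal (Re (ft (g n) w))"
      by (rule AE_I2, rule tendsto_ennrealI)
         (use tendsto_mult[OF gauss_tendsto_1 tendsto_const] in force)
  qed auto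
  have "(\<integral>\<^sup>+ w. ennreal (F w) \<partial>lborel) \<le> ennreal (2 * pi * c)"
  proof (rule nn_integral_fatou_le)
    show "AE w in lborel. (\<lambda>n. ennreal (Re (ft (g n) w))) \<longlonglongrightarrow> ennreal (F w)"
      using F_lim
    proof eventually_elim
      case (elim w)
      from tendsto_Re[OF this] show ?case by (intro tendsto_ennrealI) simp
    qed
    show "(\<integral>\<^sup>+ w. ennreal (Re (ft (g n) w)) \<partial>lborel) \<le> ennreal (2 * pi * c)" for n by (rule ft_g_bound)
  qed auto
  also have "\<dots> < \<infinity>" by simp
  finally have F_int: "integrable lborel F" using F_nonneg by (intro integrableI_nonneg) auto

  \<comment> \<open>Regularized inversion of \<open>g n\<close> is passed to the limit at a fixed
    width: the smoothed side by domination with \<open>c\<close>, the frequency side by the rate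
    from \<open>key\<close>, where the weight turns quadratic closeness into closeness of
    integrals.\<close>
  have smoothed: "(LINT w|lborel. of_real (gauss s w) * exp (\<i> * of_real x * of_real w) * of_real (F w))
      = 2 * of_real pi * (LINT t|lborel. f (x + t / s) * of_real (std_normal_density t))" (is "?L = ?R")
    if s: "s > 0" for s x
  proof -
    define I where "I n = (LINT w|lborel. of_real (gauss s w) * exp (\<i> * of_real x * of_real w) * ft (g n) w)" for n
    have "I \<longlonglongrightarrow> ?R"
    proof -
      have Ieq: "I = (\<lambda>n. 2 * of_real pi * (LINT t|lborel. g n (x + t / s) * of_real (std_normal_density t)))"
        unfolding I_def gauss_weighted_inversion[OF g_int s] by (intro ext integral_shift_normal_density[OF s])
      have "(\<lambda>n. 2 * of_real pi * (LINT t|lborel. g n (x + t / s) * of_real (std_normal_density t))) \<longlonglongrightarrow> ?R"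
      proof (intro tendsto_mult tendsto_const integral_dominated_convergence[where w = "\<lambda>t. c * std_normal_density t"])
        show "AE t in lborel. (\<lambda>n. g n (x + t / s) * of_real (std_normal_density t)) \<longlonglongrightarrow> f (x + t / s) * of_real (std_normal_density t)"
          by (intro AE_I2 tendsto_intros g_tendsto)
        have "cmod (g n y) \<le> c" for n y using g_le c(2) order_trans by blast
        then show "AE t in lborel. norm (g n (x + t / s) * of_real (std_normal_density t)) \<le> c * std_normal_density t" for n
          by (auto simp: norm_mult intro!: mult_right_mono)
      qed auto
      then show ?thesis unfolding Ieq .
    qed
    moreover have "I \<longlonglongrightarrow> ?L"
    proof (rule LIM_zero_cancel, rule Lim_null_comparison)
      define G where "G = (LINT w|lborel. gauss s w)"
      have b: "cmod (I n - ?L) \<le> (2 * pi + G) * (1/2) ^ n" for n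
      proof -
        have i1: "integrable lborel (\<lambda>w. of_real (gauss s w) * exp (\<i> * of_real x * of_real w) * ft (g n) w)"
        proof (rule Bochner_Integration.integrable_bound)
          show "integrable lborel (\<lambda>w. gauss s w * (LINT x|lborel. cmod (g n x)))"
            by (intro integrable_mult_left integrable_gauss s)
          have "cmod (ft (g n) w) \<le> \<bar>LINT x|lborel. cmod (g n x)\<bar>" for w
            using norm_ft_le[of "g n" w] by linarith
          then show "AE w in lborel. norm (of_real (gauss s w) * exp (\<i> * of_real x * of_real w) * ft (g n) w)
              \<le> norm (gauss s w * (LINT x|lborel. cmod (g n x)))"
            by (auto simp: norm_mult abs_mult intro!: mult_left_mono)
        qed simp
        have i2: "integrable lborel (\<lambda>w. of_real (gauss s w) * exp (\<i> * of_real x * of_real w) * complex_of_real (F w))"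
        proof (rule Bochner_Integration.integrable_bound[OF F_int])
          show "AE w in lborel. norm (of_real (gauss s w) * exp (\<i> * of_real x * of_real w) * complex_of_real (F w)) \<le> norm (F w)"
            by (auto simp: norm_mult intro!: mult_right_le_one_le mult_left_le_one_le)
        qed simp
        have "I n - ?L = (LINT w|lborel. of_real (gauss s w) * exp (\<i> * of_real x * of_real w) * (ft (g n) w - of_real (F w)))"
          unfolding I_def right_diff_distrib by (rule Bochner_Integration.integral_diff[OF i1 i2, symmetric])
        then have "ennreal (cmod (I n - ?L)) \<le> (\<integral>\<^sup>+ w. ennreal (cmod (of_real (gauss s w) * exp (\<i> * of_real x * of_real w) * (ft (g n) w - of_real (F w)))) \<partial>lborel)"
          by (simp only: norm_integral_le_nn_integral)
        also have "\<dots> = (\<integral>\<^sup>+ w. ennreal (gauss s w * cmod (ft (g n) w - of_real (F w))) \<partial>lborel)"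
          by (simp add: norm_mult)
        also have "\<dots> \<le> ennreal (2 ^ n * (2 * pi * (1/4) ^ n) + G / 2 ^ n)"
          unfolding G_def
        proof (rule nn_integral_gauss_mult_le[OF _ s])
          have "ennreal (2 * pi * (LINT x|lborel. (cmod (g n x - f x))\<^sup>2)) \<le> ennreal (2 * pi * (1/4) ^ n)"
            using k(2)[of n] by (intro ennreal_leI mult_left_mono) (auto simp: g_def)
          with key[OF g_int g2, of n]
          show "(\<integral>\<^sup>+ w. ennreal ((cmod (ft (g n) w - of_real (F w)))\<^sup>2) \<partial>lborel) \<le> ennreal (2 * pi * (1/4) ^ n)"
            by (rule order_trans)
        qed auto
        also have "2 ^ n * (2 * pi * (1/4) ^ n) + G / 2 ^ n = (2 * pi + G) * (1/2) ^ n"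
        proof -
          have "(2::real) ^ n * (1/4) ^ n = (2 * (1/4)) ^ n" by (rule power_mult_distrib[symmetric])
          then have "(2::real) ^ n * (2 * pi * (1/4) ^ n) = 2 * pi * (1/2) ^ n" by (simp add: mult.left_commute)
          moreover have "G / 2 ^ n = G * (1/2) ^ n" by (simp add: power_one_over)
          ultimately show ?thesis by (simp only: distrib_right)
        qed
        finally show ?thesis by (subst (asm) ennreal_le_iff) (auto simp: G_def)
      qed
      then show "\<forall>\<^sub>F n in sequentially. norm (I n - ?L) \<le> (2 * pi + G) * (1/2) ^ n" by simp
      show "(\<lambda>n. (2 * pi + G) * (1/2) ^ n) \<longlonglongrightarrow> 0"
        by (intro tendsto_mult_right_zero LIMSEQ_power_zero) simp
    qed
    ultimately show ?thesis by (rule LIMSEQ_unique[rotated])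
  qed
  have "f x = ift F x" for x
  proof -
    \<comment> \<open>Now the weight is removed. The frequency side is dominated by
      \<open>F\<close>; on the other side, continuity of \<open>f\<close> identifies the limit at
      every \<open>x\<close> and not merely almost everywhere.\<close>
    let ?L = "\<lambda>m. LINT w|lborel. of_real (gauss (real (Suc m)) w) * exp (\<i> * of_real x * of_real w) * complex_of_real (F w)"
    have "?L \<longlonglongrightarrow> (LINT w|lborel. 1 * exp (\<i> * of_real x * of_real w) * complex_of_real (F w))"
    proof (rule integral_dominated_convergence[OF _ _ F_int])
      show "AE w in lborel. (\<lambda>m. of_real (gauss (real (Suc m)) w) * exp (\<i> * of_real x * of_real w) * complex_of_real (F w))
          \<longlonglongrightarrow> 1 * exp (\<i> * of_real x * of_real w) * complex_of_real (F w)"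
        using tendsto_of_real[OF gauss_tendsto_1, where ?'a = complex] by (intro AE_I2 tendsto_intros) simp
      show "AE w in lborel. norm (of_real (gauss (real (Suc m)) w) * exp (\<i> * of_real x * of_real w) * complex_of_real (F w)) \<le> F w" for m
        using F_nonneg by (auto simp: norm_mult intro!: mult_left_le_one_le)
    qed auto
    moreover have "?L \<longlonglongrightarrow> 2 * of_real pi * f x"
    proof -
      have "(\<lambda>m. LINT t|lborel. f (x + t / real (Suc m)) * of_real (std_normal_density t))
          \<longlonglongrightarrow> (LINT t|lborel. f x * of_real (std_normal_density t))"
      proof (rule integral_dominated_convergence[where w = "\<lambda>t. c * std_normal_density t"])
        show "AE t in lborel. (\<lambda>m. f (x + t / real (Suc m)) * of_real (std_normal_density t)) \<longlonglongrightarrow> f x * of_real (std_normal_density t)"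
        proof (rule AE_I2)
          fix t
          have "(\<lambda>m. t / real (Suc m)) \<longlonglongrightarrow> 0" by (intro LIMSEQ_Suc lim_const_over_n)
          then have "(\<lambda>m. x + t / real (Suc m)) \<longlonglongrightarrow> x + 0" by (intro tendsto_intros)
          moreover have "isCont f (x + 0)" using cont by (simp add: continuous_on_eq_continuous_at)
          ultimately have "(\<lambda>m. f (x + t / real (Suc m))) \<longlonglongrightarrow> f (x + 0)" by (rule isCont_tendsto_compose[rotated])
          then show "(\<lambda>m. f (x + t / real (Suc m)) * of_real (std_normal_density t)) \<longlonglongrightarrow> f x * of_real (std_normal_density t)"
            by (intro tendsto_intros) simp
        qed
        show "AE t in lborel. norm (f (x + t / real (Suc m)) * of_real (std_normal_density t)) \<le> c * std_normal_density t" for m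
          using c(2) by (auto simp: norm_mult intro!: mult_right_mono)
      qed auto
      moreover have "(LINT t|lborel. f x * of_real (std_normal_density t)) = f x"
        by (subst integral_mult_right_zero) (simp only: integral_complex_of_real integral_normal_density, simp)
      ultimately have "(\<lambda>m. 2 * of_real pi * (LINT t|lborel. f (x + t / real (Suc m)) * of_real (std_normal_density t)))
          \<longlonglongrightarrow> 2 * of_real pi * f x" by (intro tendsto_intros) simp
      then show ?thesis by (simp only: smoothed of_nat_0_less_iff zero_less_Suc)
    qed
    ultimately have "2 * of_real pi * f x = (LINT w|lborel. 1 * exp (\<i> * of_real x * of_real w) * complex_of_real (F w))"
      by (rule LIMSEQ_unique[rotated])
    then show ?thesis by (simp add: ift_def mult_ac field_simps)
  qed
  then have f_eq: "f = ift F" by blast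
  have ht: "has_fourier_transform f (\<lambda>w. of_real (F w))"
    unfolding has_fourier_transform_def
  proof (intro conjI)
    show "square_integrable (\<lambda>w. of_real (F w))" using F2 by (simp add: square_integrable_def)
    \<comment> \<open>The squared quadratic distance of \<open>f\<close> from its truncation; by
      \<open>key\<close>, \<open>2 * pi\<close> times it bounds the error of the truncated
      transform.\<close>
    define tail where "tail R = (LINT x|lborel. (cmod (indicator {-R..R} x *\<^sub>R f x - f x))\<^sup>2)" for R
    have "(tail \<longlongrightarrow> (LINT x::real|lborel. 0)) at_top"
      unfolding tail_def
    proof (rule integral_dominated_convergence_at_top[where w = "\<lambda>x. (cmod (f x))\<^sup>2"])
      show "\<forall>\<^sub>F R in at_top. AE x in lborel. norm ((cmod (indicator {-R..R} x *\<^sub>R f x - f x))\<^sup>2) \<le> (cmod (f x))\<^sup>2"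
        by (auto simp: indicator_def)
      show "AE x in lborel. ((\<lambda>R. (cmod (indicator {-R..R} x *\<^sub>R f x - f x))\<^sup>2) \<longlongrightarrow> 0) at_top"
      proof (rule AE_I2)
        fix x :: real
        have "\<forall>\<^sub>F R in at_top. \<bar>x\<bar> \<le> R" by (rule eventually_ge_at_top)
        then have "\<forall>\<^sub>F R in at_top. 0 = (cmod (indicator {-R..R} x *\<^sub>R f x - f x))\<^sup>2"
          by eventually_elim (auto simp: indicator_def)
        then show "((\<lambda>R. (cmod (indicator {-R..R} x *\<^sub>R f x - f x))\<^sup>2) \<longlongrightarrow> 0) at_top"
          by (rule Lim_transform_eventually[OF tendsto_const])
      qed
    qed (use f2 in auto)
    then have "((\<lambda>R. ennreal (2 * pi * tail R)) \<longlongrightarrow> ennreal (2 * pi * 0)) at_top"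
      by (intro tendsto_ennrealI tendsto_intros) simp
    then have up: "((\<lambda>R. ennreal (2 * pi * tail R)) \<longlongrightarrow> 0) at_top" by simp
    have le: "(\<integral>\<^sup>+ w. ennreal ((cmod (truncated_fourier f R w - of_real (F w)))\<^sup>2) \<partial>lborel) \<le> ennreal (2 * pi * tail R)" for R
      unfolding truncated_fourier_eq_ft tail_def
    proof (rule key)
      show "integrable lborel (\<lambda>x. indicator {-R..R} x *\<^sub>R f x)"
        using borel_integrable_compact[of "{-R..R}" f] cont continuous_on_subset
        by (auto simp: set_integrable_def[symmetric] intro!: borel_integrable_compact)
      show "integrable lborel (\<lambda>x. (cmod (indicator {-R..R} x *\<^sub>R f x))\<^sup>2)"
        by (rule Bochner_Integration.integrable_bound[OF f2]) (auto simp: indicator_def)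
    qed
    show "((\<lambda>R. \<integral>\<^sup>+ w. ennreal ((cmod (truncated_fourier f R w - of_real (F w)))\<^sup>2) \<partial>lborel) \<longlongrightarrow> 0) at_top"
      by (rule tendsto_sandwich[OF _ _ tendsto_const up]) (simp_all add: le)
  qed fact
  show thesis by (rule that[OF F_meas F_nonneg F_int F2 f_eq ht])
qed

subsection \<open>Inverse transforms of nonnegative densities\<close>

lemma integrable_of_real_mult_exp:
  assumes "integrable lborel (F :: real \<Rightarrow> real)"
  shows "integrable lborel (\<lambda>w. complex_of_real (F w) * exp (\<i> * of_real w * of_real x))"
  using integrable_mult_exp_imaginary(2)[of "\<lambda>w. complex_of_real (F w)" x] assms
  by (simp add: mult_ac)

lemma ift_eq_ft: "ift F x = ft (\<lambda>w. of_real (F w)) (- x) / (2 * of_real pi)"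
  by (simp add: ift_def ft_def mult_ac)

lemma ift_add:
  assumes "integrable lborel F" "integrable lborel G"
  shows "ift (\<lambda>w. F w + G w) x = ift F x + ift G x"
  unfolding ift_def using assms
  by (simp add: distrib_right integrable_of_real_mult_exp add_divide_distrib)

lemma ift_cong_AE:
  assumes "F \<in> borel_measurable borel" "G \<in> borel_measurable borel" "AE w in lborel. F w = G w"
  shows "ift F = ift G"
  unfolding ift_def using assms by (intro ext arg_cong2[where f = "(/)"] integral_cong_AE refl) auto

text \<open>This symmetry carries statements about nonnegative frequencies over to nonpositive
  ones.\<close>

lemma ift_reflect: "ift (\<lambda>w. F (- w)) x = ift F (- x)"
proof -
  have "(LINT w|lborel. of_real (F w) * exp (\<i> * of_real w * of_real (- x)))
      = \<bar>-1\<bar> *\<^sub>R (LINT w|lborel. complex_of_real (F (0 + -1 * w)) * exp (\<i> * of_real (0 + -1 * w) * of_real (- x)))"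
    by (rule lborel_integral_real_affine) simp
  then show ?thesis by (simp add: ift_def)
qed

lemma isCont_ift:
  assumes F: "integrable lborel F"
  shows "isCont (ift F) x"
proof -
  have [measurable]: "F \<in> borel_measurable borel" using F by auto
  have "((\<lambda>y. LINT w|lborel. of_real (F w) * exp (\<i> * of_real w * of_real y))
      \<longlongrightarrow> (LINT w|lborel. complex_of_real (F w) * exp (\<i> * of_real w * of_real x))) (at x)"
    unfolding tendsto_at_iff_sequentially o_def
  proof (intro allI impI)
    fix X assume X: "X \<longlonglongrightarrow> x"
    show "(\<lambda>n. LINT w|lborel. of_real (F w) * exp (\<i> * of_real w * of_real (X n)))
      \<longlonglongrightarrow> (LINT w|lborel. complex_of_real (F w) * exp (\<i> * of_real w * of_real x))"
    proof (rule integral_dominated_convergence[where w = "\<lambda>w. \<bar>F w\<bar>"])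
      show "AE w in lborel. (\<lambda>n. complex_of_real (F w) * exp (\<i> * of_real w * of_real (X n)))
          \<longlonglongrightarrow> complex_of_real (F w) * exp (\<i> * of_real w * of_real x)"
        by (intro AE_I2 tendsto_intros X)
      show "AE w in lborel. norm (complex_of_real (F w) * exp (\<i> * of_real w * of_real (X n))) \<le> \<bar>F w\<bar>" for n
        by (simp add: norm_mult)
    qed (use F in auto)
  qed
  then show ?thesis unfolding isCont_def ift_def by (intro tendsto_intros) auto
qed

text \<open>The easy half of Bochner's theorem: up to the factor \<open>2 * pi\<close>, the
  quadratic form is the integral of \<open>F\<close> times the squared modulus of the trigonometric
  polynomial \<open>S\<close>.\<close>

lemma positive_definite_ift:
  assumes F: "integrable lborel F" and F0: "\<And>w. 0 \<le> F w"
  shows "positive_definite (ift F)"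
  unfolding positive_definite_iff_qform
proof (intro conjI allI)
  fix x
  have "cnj (LINT w|lborel. complex_of_real (F w) * exp (\<i> * of_real w * of_real x))
      = (LINT w|lborel. cnj (complex_of_real (F w) * exp (\<i> * of_real w * of_real x)))"
    by (rule Bochner_Integration.integral_cnj[symmetric])
  also have "\<dots> = (LINT w|lborel. complex_of_real (F w) * exp (\<i> * of_real w * of_real (- x)))"
    by (intro Bochner_Integration.integral_cong refl) (simp add: exp_cnj)
  finally show "ift F (- x) = cnj (ift F x)" by (simp add: ift_def)
next
  fix m and x :: "nat \<Rightarrow> real" and c :: "nat \<Rightarrow> complex"
  define S where "S w = (\<Sum>i<m. cnj (c i) * exp (\<i> * of_real w * of_real (x i)))" for w :: real
  let ?t = "\<lambda>i j w. cnj (c i) * (complex_of_real (F w) * exp (\<i> * of_real w * of_real (x i - x j))) * c j"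
  have int: "integrable lborel (?t i j)" for i j
    by (intro integrable_mult_left integrable_mult_right integrable_of_real_mult_exp F)
  have "cnj (c i) * ift F (x i - x j) * c j = (LINT w|lborel. ?t i j w) / (2 * of_real pi)" for i j
    by (simp add: ift_def)
  then have "(\<Sum>i<m. \<Sum>j<m. cnj (c i) * ift F (x i - x j) * c j)
      = (\<Sum>i<m. \<Sum>j<m. (LINT w|lborel. ?t i j w)) / (2 * of_real pi)"
    by (simp only: sum_divide_distrib)
  also have "(\<Sum>i<m. \<Sum>j<m. (LINT w|lborel. ?t i j w)) = (LINT w|lborel. (\<Sum>i<m. \<Sum>j<m. ?t i j w))"
    by (simp only: Bochner_Integration.integral_sum int Bochner_Integration.integrable_sum)
  also have "\<dots> = (LINT w|lborel. complex_of_real (F w * (cmod (S w))\<^sup>2))"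
  proof (intro Bochner_Integration.integral_cong refl)
    fix w
    have t: "?t i j w = of_real (F w) * ((cnj (c i) * exp (\<i> * of_real w * of_real (x i))) * cnj (cnj (c j) * exp (\<i> * of_real w * of_real (x j))))" for i j
    proof -
      have "exp (\<i> * of_real w * of_real (x i - x j)) = exp (\<i> * of_real w * of_real (x i)) * cnj (exp (\<i> * of_real w * of_real (x j)))"
        unfolding exp_cnj exp_add[symmetric] by (simp add: algebra_simps)
      then show ?thesis by simp
    qed
    have "S w * cnj (S w) = (\<Sum>i<m. \<Sum>j<m. (cnj (c i) * exp (\<i> * of_real w * of_real (x i))) * cnj (cnj (c j) * exp (\<i> * of_real w * of_real (x j))))"
      unfolding S_def cnj_sum by (rule sum_product)
    then have "(\<Sum>i<m. \<Sum>j<m. ?t i j w) = of_real (F w) * (S w * cnj (S w))"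
      by (simp only: t sum_distrib_left)
    then show "(\<Sum>i<m. \<Sum>j<m. ?t i j w) = complex_of_real (F w * (cmod (S w))\<^sup>2)"
      by (simp only: of_real_mult complex_norm_square)
  qed
  also have "\<dots> = of_real (LINT w|lborel. F w * (cmod (S w))\<^sup>2)" by (rule integral_complex_of_real)
  finally have "(\<Sum>i<m. \<Sum>j<m. cnj (c i) * ift F (x i - x j) * c j)
      = of_real ((LINT w|lborel. F w * (cmod (S w))\<^sup>2) / (2 * pi))" by (simp only: of_real_divide of_real_mult of_real_numeral)
  moreover have "0 \<le> (LINT w|lborel. F w * (cmod (S w))\<^sup>2) / (2 * pi)"
    using F0 by (intro divide_nonneg_pos Bochner_Integration.integral_nonneg mult_nonneg_nonneg) auto
  ultimately show "0 \<le> Re (\<Sum>i<m. \<Sum>j<m. cnj (c i) * ift F (x i - x j) * c j)"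
    by (simp only: Re_complex_of_real)
qed

text \<open>Up to a reflection and the factor \<open>2 * pi\<close>, the inverse transform is a
  forward transform of an integrable and square integrable function, so \<open>bessel\<close>
  applies to it.\<close>

lemma square_integrable_ift:
  assumes F: "integrable lborel F" and F2: "integrable lborel (\<lambda>w. (F w)\<^sup>2)"
  shows "square_integrable (ift F)"
proof -
  have [measurable]: "F \<in> borel_measurable borel" using F by auto
  let ?p = "\<lambda>w. complex_of_real (F w)"
  have "(\<integral>\<^sup>+ w. ennreal ((cmod (ft ?p w))\<^sup>2) \<partial>lborel) \<le> ennreal (2 * pi * (LINT x|lborel. (cmod (?p x))\<^sup>2))"
    using F F2 by (intro bessel) auto
  also have "\<dots> < \<infinity>" by simp
  finally have "integrable lborel (\<lambda>w. (cmod (ft ?p w))\<^sup>2)" by (intro integrableI_nonneg) auto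
  from lborel_integrable_real_affine[OF this, of "-1" 0]
  have "integrable lborel (\<lambda>w. (cmod (ft ?p (- w)))\<^sup>2 / (2 * pi)\<^sup>2)" by simp
  moreover have "(cmod (ift F x))\<^sup>2 = (cmod (ft ?p (- x)))\<^sup>2 / (2 * pi)\<^sup>2" for x
    by (simp add: ift_eq_ft norm_divide norm_mult power_divide)
  moreover have "ift F \<in> borel_measurable borel"
    using isCont_ift[OF F] by (intro borel_measurable_continuous_onI) (simp add: continuous_on_eq_continuous_at)
  ultimately show ?thesis by (simp add: square_integrable_def)
qed

lemma ift_0: "ift F 0 = of_real ((LINT w|lborel. F w) / (2 * pi))"
  by (simp add: ift_def)

text \<open>The values at 0 show that the masses agree. Divided by this mass, both densities define
  probability laws whose characteristic functions are multiples of the inverse transforms, and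
  Levy's uniqueness theorem applies.\<close>

lemma ift_inject:
  assumes F: "integrable lborel F" "\<And>w. 0 \<le> F w" and G: "integrable lborel G" "\<And>w. 0 \<le> G w"
    and eq: "ift F = ift G"
  shows "AE w in lborel. F w = G w"
proof -
  have [measurable]: "F \<in> borel_measurable borel" "G \<in> borel_measurable borel" using F G by auto
  define c where "c = (LINT w|lborel. F w)"
  have "complex_of_real (c / (2 * pi)) = complex_of_real ((LINT w|lborel. G w) / (2 * pi))"
    using fun_cong[OF eq, of 0] by (simp only: ift_0 c_def)
  then have cG: "c = (LINT w|lborel. G w)" by simp
  show ?thesis
  \<comment> \<open>Normalization fails for mass 0, but then both nonnegative densities vanish
    almost everywhere.\<close>
  proof (cases "c = 0")
    case True
    have "AE w in lborel. F w = 0"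
      using integral_nonneg_eq_0_iff_AE[of lborel F] F True by (simp add: c_def)
    moreover have "AE w in lborel. G w = 0"
      using integral_nonneg_eq_0_iff_AE[of lborel G] G True by (simp add: cG)
    ultimately show ?thesis by eventually_elim simp
  next
    case False
    then have c: "c > 0" using F by (simp add: c_def less_le)
    define M where "M = (\<lambda>H :: real \<Rightarrow> real. density lborel (\<lambda>w. ennreal (H w / c)))"
    have M: "real_distribution (M H) \<and> char (M H) = (\<lambda>t. 2 * of_real pi * ift H t / of_real c)"
      if H: "integrable lborel H" "\<And>w. 0 \<le> H w" "(LINT w|lborel. H w) = c" for H
    proof
      have [measurable]: "H \<in> borel_measurable borel" using H by auto
      have "emeasure (M H) (space (M H)) = (\<integral>\<^sup>+ w. ennreal (H w / c) \<partial>lborel)"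
        by (simp add: M_def emeasure_density)
      also have "\<dots> = ennreal (LINT w|lborel. H w / c)"
        using H c by (intro nn_integral_eq_integral) auto
      also have "\<dots> = 1" using H c by simp
      finally show "real_distribution (M H)"
        unfolding real_distribution_def real_distribution_axioms_def by (auto simp: M_def intro: prob_spaceI)
      show "char (M H) = (\<lambda>t. 2 * of_real pi * ift H t / of_real c)"
      proof
        fix t
        have "char (M H) t = (LINT w|lborel. (H w / c) *\<^sub>R iexp (t * w))"
          unfolding char_def M_def using H c by (intro integral_density) auto
        also have "\<dots> = (LINT w|lborel. complex_of_real (H w) * exp (\<i> * of_real w * of_real t) / of_real c)"
          by (intro Bochner_Integration.integral_cong refl) (simp add: scaleR_conv_of_real mult_ac)
        finally show "char (M H) t = 2 * of_real pi * ift H t / of_real c" by (simp add: ift_def)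
      qed
    qed
    have "M F = M G"
      using M[OF F c_def[symmetric]] M[OF G cG[symmetric]] eq by (intro Levy_uniqueness) auto
    then have "AE w in lborel. ennreal (F w / c) = ennreal (G w / c)"
      unfolding M_def by (intro sigma_finite_measure.density_unique[OF sigma_finite_lborel]) auto
    then show ?thesis
    proof eventually_elim
      case (elim w)
      then show ?case using F(2)[of w] G(2)[of w] c by simp
    qed
  qed
qed

lemma has_fourier_transform_cong_AE:
  assumes "has_fourier_transform f F" "G \<in> borel_measurable borel" "AE w in lborel. F w = G w"
  shows "has_fourier_transform f G"
proof -
  have [measurable]: "F \<in> borel_measurable borel"
    using assms(1) by (auto simp: has_fourier_transform_def square_integrable_def)
  have "integrable lborel (\<lambda>w. (cmod (F w))\<^sup>2) = integrable lborel (\<lambda>w. (cmod (G w))\<^sup>2)"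
    using assms(2,3) by (intro integrable_cong_AE) auto
  moreover have "(\<integral>\<^sup>+ w. ennreal ((cmod (truncated_fourier f R w - F w))\<^sup>2) \<partial>lborel)
      = (\<integral>\<^sup>+ w. ennreal ((cmod (truncated_fourier f R w - G w))\<^sup>2) \<partial>lborel)" for R
    using assms(3) by (intro nn_integral_cong_AE) auto
  ultimately show ?thesis
    using assms(1,2) by (simp add: has_fourier_transform_def square_integrable_def)
qed

text \<open>The spectral density of \<open>ift F\<close> is determined by \<open>ift F\<close>, hence equal to \<open>F\<close>.\<close>

lemma has_fourier_transform_ift:
  assumes F: "integrable lborel F" "\<And>w. 0 \<le> F w" and F2: "integrable lborel (\<lambda>w. (F w)\<^sup>2)"
  shows "has_fourier_transform (ift F) (\<lambda>w. of_real (F w))"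
proof (rule spectral_density)
  show "square_integrable (ift F)" by (rule square_integrable_ift[OF F(1) F2])
  show "positive_definite (ift F)" by (rule positive_definite_ift[OF F])
  show "continuous_on UNIV (ift F)" using isCont_ift[OF F(1)] by (simp add: continuous_on_eq_continuous_at)
  have [measurable]: "F \<in> borel_measurable borel" using F by auto
  fix G assume G: "integrable lborel G" "\<And>w. 0 \<le> G w" "ift F = ift G" "has_fourier_transform (ift F) (\<lambda>w. of_real (G w))"
  have "AE w in lborel. G w = F w" by (rule ift_inject[OF G(1,2) F G(3)[symmetric]])
  then show ?thesis by (intro has_fourier_transform_cong_AE[OF G(4)]) auto
qed

lemma essential_support_subset:
  assumes "closed S" "\<And>w. w \<notin> S \<Longrightarrow> F w = 0"
  shows "essential_support F \<subseteq> S"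
proof -
  have "open (- S)" "AE w in lborel. w \<in> - S \<longrightarrow> F w = 0" using assms by auto
  then show ?thesis unfolding essential_support_def by blast
qed

subsection \<open>Boundary values of holomorphic functions\<close>

text \<open>A consequence of \<open>y \<le> exp y\<close> at \<open>y = w * c\<close>. Being uniform
  in \<open>w\<close>, it controls the derivative of \<open>exp (\<i> * w * z)\<close> on the half
  plane above height \<open>c\<close>.\<close>

lemma mult_exp_minus_le:
  fixes w c :: real
  assumes "c > 0" "w \<ge> 0"
  shows "w * exp (- (w * c)) \<le> 1 / c"
proof -
  have "w * c \<le> exp (w * c)" using exp_ge_add_one_self[of "w * c"] by linarith
  then have "(w * c) * exp (- (w * c)) \<le> exp (w * c) * exp (- (w * c))" by (intro mult_right_mono) auto
  then have "(w * c) * exp (- (w * c)) \<le> 1" by (simp add: exp_add[symmetric])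
  then show ?thesis using assms by (simp add: field_simps)
qed

lemma norm_exp_upper_half_plane:
  assumes "0 \<le> w" "0 \<le> Im z"
  shows "cmod (exp (\<i> * of_real w * z)) \<le> 1"
  using assms by (simp add: norm_exp_eq_Re)

text \<open>The extension is the same integral with \<open>x\<close> replaced by \<open>z\<close>:
  for \<open>w \<ge> 0\<close> the exponential has modulus at most 1 on the closed upper half plane.
  Domination by the modulus of \<open>F\<close> gives the boundary limits; in the interior, a
  Lipschitz bound uniform in \<open>w\<close> permits differentiation under the integral.\<close>

lemma holomorphic_boundary_value_ift:
  assumes F: "integrable lborel F" and supp: "\<And>w. w < 0 \<Longrightarrow> F w = 0"
  shows "holomorphic_boundary_value {z. 0 < Im z} (ift F)"
proof -
  have [measurable]: "F \<in> borel_measurable borel" using F by auto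
  define G where "G z = (LINT w|lborel. complex_of_real (F w) * exp (\<i> * of_real w * z))" for z
  have bound: "cmod (complex_of_real (F w) * exp (\<i> * of_real w * z)) \<le> \<bar>F w\<bar>" if "0 \<le> Im z" for w z
  proof (cases "w < 0")
    case False
    then show ?thesis using norm_exp_upper_half_plane[of w z] that by (auto simp: norm_mult intro!: mult_left_le)
  qed (simp add: supp)
  have int: "integrable lborel (\<lambda>w. complex_of_real (F w) * exp (\<i> * of_real w * z))" if "0 \<le> Im z" for z
    by (rule Bochner_Integration.integrable_bound[OF F]) (use bound[OF that] in auto)
  have lim: "(G \<longlongrightarrow> G z) (at z within {z. 0 < Im z})" if "0 \<le> Im z" for z
    unfolding tendsto_at_iff_sequentially o_def
  proof (intro allI impI)
    fix X assume X: "\<forall>i. X i \<in> {z. 0 < Im z} - {z}" "X \<longlonglongrightarrow> z"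
    show "(\<lambda>n. G (X n)) \<longlonglongrightarrow> G z"
      unfolding G_def
    proof (rule integral_dominated_convergence[where w = "\<lambda>w. \<bar>F w\<bar>"])
      show "AE w in lborel. (\<lambda>n. complex_of_real (F w) * exp (\<i> * of_real w * X n))
          \<longlonglongrightarrow> complex_of_real (F w) * exp (\<i> * of_real w * z)"
        by (intro AE_I2 tendsto_intros X)
      show "AE w in lborel. norm (complex_of_real (F w) * exp (\<i> * of_real w * X n)) \<le> \<bar>F w\<bar>" for n
        using X(1) by (intro AE_I2 bound) (auto intro: less_imp_le)
    qed (use F in auto)
  qed
  have "G field_differentiable at z" if z: "0 < Im z" for z
  proof -
    \<comment> \<open>Staying above half the height of \<open>z\<close> gives a convex open
      neighbourhood on which the derivative of the exponential is bounded uniformly in the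
      frequency.\<close>
    define c where "c = Im z / 2"
    define S where "S = {y. c < Im y}"
    have c: "c > 0" using z by (simp add: c_def)
    have zS: "z \<in> S" using z by (simp add: S_def c_def)
    have S: "open S" "convex S"
      unfolding S_def by (auto intro!: open_halfspace_Im_gt convex_halfspace_Im_gt)
    have lip: "cmod (exp (\<i> * of_real w * y) - exp (\<i> * of_real w * z)) \<le> 1 / c * cmod (y - z)"
      if "w \<ge> 0" "y \<in> S" for w y
    proof (rule field_differentiable_bound[OF S(2)])
      fix u assume u: "u \<in> S"
      show "((\<lambda>z. exp (\<i> * of_real w * z)) has_field_derivative exp (\<i> * of_real w * u) * (\<i> * of_real w)) (at u within S)"
        by (auto intro!: derivative_eq_intros)
      have "w * exp (- (w * Im u)) \<le> w * exp (- (w * c))"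
        using u that by (intro mult_left_mono) (auto simp: S_def intro: mult_left_mono)
      also have "\<dots> \<le> 1 / c" by (rule mult_exp_minus_le) fact+
      finally show "cmod (exp (\<i> * of_real w * u) * (\<i> * of_real w)) \<le> 1 / c"
        using that by (simp add: norm_mult norm_exp_eq_Re mult.commute)
    qed (use that zS in auto)
    have "((\<lambda>y. (G y - G z) / (y - z)) \<longlongrightarrow> (LINT w|lborel. complex_of_real (F w) * (exp (\<i> * of_real w * z) * (\<i> * of_real w)))) (at z within S)"
      unfolding tendsto_at_iff_sequentially o_def
    proof (intro allI impI)
      fix X assume X: "\<forall>i. X i \<in> S - {z}" "X \<longlonglongrightarrow> z"
      have XS: "X n \<in> S" "X n \<noteq> z" "0 \<le> Im (X n)" for n
        using X(1) c by (auto simp: S_def intro: less_imp_le less_trans)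
      let ?q = "\<lambda>n w. complex_of_real (F w) * ((exp (\<i> * of_real w * X n) - exp (\<i> * of_real w * z)) / (X n - z))"
      have quot: "(G (X n) - G z) / (X n - z) = (LINT w|lborel. ?q n w)" for n
      proof -
        have "(G (X n) - G z) / (X n - z) = (LINT w|lborel. complex_of_real (F w) * exp (\<i> * of_real w * X n) - complex_of_real (F w) * exp (\<i> * of_real w * z)) / (X n - z)"
          unfolding G_def using XS z
          by (intro arg_cong2[where f = "(/)"] Bochner_Integration.integral_diff[symmetric] int refl) auto
        also have "\<dots> = (LINT w|lborel. ?q n w)"
          unfolding integral_divide_zero[symmetric]
          by (intro Bochner_Integration.integral_cong refl) (simp add: right_diff_distrib)
        finally show ?thesis .
      qed
      have "(\<lambda>n. LINT w|lborel. ?q n w) \<longlonglongrightarrow> (LINT w|lborel. complex_of_real (F w) * (exp (\<i> * of_real w * z) * (\<i> * of_real w)))"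
      proof (rule integral_dominated_convergence[where w = "\<lambda>w. \<bar>F w\<bar> * (1 / c)"])
        show "AE w in lborel. (\<lambda>n. ?q n w) \<longlonglongrightarrow> complex_of_real (F w) * (exp (\<i> * of_real w * z) * (\<i> * of_real w))"
        proof (intro AE_I2 tendsto_mult tendsto_const)
          fix w :: real
          have "((\<lambda>z. exp (\<i> * of_real w * z)) has_field_derivative exp (\<i> * of_real w * z) * (\<i> * of_real w)) (at z within S)"
            by (auto intro!: derivative_eq_intros)
          then show "(\<lambda>n. (exp (\<i> * of_real w * X n) - exp (\<i> * of_real w * z)) / (X n - z)) \<longlonglongrightarrow> exp (\<i> * of_real w * z) * (\<i> * of_real w)"
            unfolding has_field_derivative_iff tendsto_at_iff_sequentially o_def using X by blast
        qed
        show "AE w in lborel. norm (?q n w) \<le> \<bar>F w\<bar> * (1 / c)" for n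
        proof (rule AE_I2)
          fix w
          show "norm (?q n w) \<le> \<bar>F w\<bar> * (1 / c)"
          proof (cases "w < 0")
            case False
            then have "cmod ((exp (\<i> * of_real w * X n) - exp (\<i> * of_real w * z)) / (X n - z)) \<le> 1 / c"
              using lip[of w "X n"] XS[of n] by (simp add: norm_divide divide_le_eq)
            then show ?thesis unfolding norm_mult norm_of_real by (intro mult_left_mono) auto
          qed (simp add: supp)
        qed
      qed (use F in auto)
      then show "(\<lambda>n. (G (X n) - G z) / (X n - z)) \<longlonglongrightarrow> (LINT w|lborel. complex_of_real (F w) * (exp (\<i> * of_real w * z) * (\<i> * of_real w)))"
        unfolding quot .
    qed
    then have "(G has_field_derivative (LINT w|lborel. complex_of_real (F w) * (exp (\<i> * of_real w * z) * (\<i> * of_real w)))) (at z within S)"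
      unfolding has_field_derivative_iff .
    then show ?thesis using at_within_open[OF zS S(1)] by (auto simp: field_differentiable_def)
  qed
  then have "G holomorphic_on {z. 0 < Im z}" by (auto simp: holomorphic_on_def intro: field_differentiable_at_within)
  then have "(\<lambda>z. G z / (2 * of_real pi)) holomorphic_on {z. 0 < Im z}" by (intro holomorphic_intros) auto
  moreover have "((\<lambda>z. G z / (2 * of_real pi)) \<longlongrightarrow> ift F x) (at (of_real x) within {z. 0 < Im z})" for x
    using lim[of "of_real x"] unfolding ift_def G_def by (intro tendsto_intros) auto
  ultimately show ?thesis unfolding holomorphic_boundary_value_def by blast
qed

text \<open>Negation exchanges the two half planes and, unlike conjugation, is holomorphic.\<close>

lemma holomorphic_boundary_value_reflect:
  assumes "holomorphic_boundary_value {z. 0 < Im z} g"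
  shows "holomorphic_boundary_value {z. Im z < 0} (\<lambda>x. g (- x))"
proof -
  obtain G where G: "G holomorphic_on {z. 0 < Im z}"
    "\<And>x. (G \<longlongrightarrow> g x) (at (complex_of_real x) within {z. 0 < Im z})"
    using assms unfolding holomorphic_boundary_value_def by blast
  have "(G \<circ> uminus) holomorphic_on {z. Im z < 0}"
    by (rule holomorphic_on_compose_gen[OF _ G(1)]) (auto intro!: holomorphic_intros)
  moreover have "((G \<circ> uminus) \<longlongrightarrow> g (- x)) (at (complex_of_real x) within {z. Im z < 0})" for x
  proof -
    have "filterlim uminus (at (complex_of_real (- x)) within {z. 0 < Im z}) (at (complex_of_real x) within {z. Im z < 0})"
      unfolding filterlim_at by (auto intro!: tendsto_eq_intros simp: eventually_at_filter)
    from filterlim_compose[OF G(2) this] show ?thesis by (simp add: o_def)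
  qed
  ultimately show ?thesis unfolding holomorphic_boundary_value_def by blast
qed

subsection \<open>Fejer means\<close>

lemma sum_symmetric_interval:
  "(\<Sum>n = - int N..int N. f n) = f 0 + (\<Sum>j<N. f (int (Suc j)) + f (- int (Suc j)))"
  for f :: "int \<Rightarrow> 'a::comm_monoid_add"
proof (induction N)
  case (Suc N)
  have "{- int (Suc N)..int (Suc N)} = insert (int (Suc N)) (insert (- int (Suc N)) {- int N..int N})"
    by auto
  then show ?case using Suc by (simp add: add_ac)
qed simp

lemma cesaro_means_null:
  fixes c :: "nat \<Rightarrow> complex"
  assumes "c \<longlonglongrightarrow> 0"
  shows "(\<lambda>N. (\<Sum>j<N. c j) / of_nat (Suc N)) \<longlonglongrightarrow> 0"
proof (rule LIMSEQ_I)
  fix e :: real assume e: "e > 0"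
  from LIMSEQ_D[OF assms, of "e / 2"] e obtain n0 where n0: "\<And>n. n \<ge> n0 \<Longrightarrow> cmod (c n) < e / 2" by auto
  define B where "B = (\<Sum>j<n0. cmod (c j))"
  \<comment> \<open>Beyond \<open>n1\<close> the fixed initial part \<open>B\<close> costs less than
    \<open>e / 2\<close> after division; the remaining terms cost the other half.\<close>
  obtain n1 where n1: "B < real n1 * (e / 2)" using reals_Archimedean3[of "e / 2"] e by auto
  have "cmod ((\<Sum>j<N. c j) / of_nat (Suc N)) < e" if "N \<ge> max n0 n1" for N
  proof -
    have "cmod (\<Sum>j<N. c j) \<le> (\<Sum>j<N. cmod (c j))" by (rule norm_sum)
    also have "\<dots> = B + (\<Sum>j\<in>{n0..<N}. cmod (c j))"
      unfolding B_def lessThan_atLeast0 using that by (intro sum.atLeastLessThan_concat[symmetric]) auto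
    also have "(\<Sum>j\<in>{n0..<N}. cmod (c j)) \<le> (\<Sum>j\<in>{n0..<N}. e / 2)"
      by (intro sum_mono order.strict_implies_order[OF n0]) auto
    also have "\<dots> \<le> real N * (e / 2)" using e by (simp add: mult_right_mono)
    also have "B + real N * (e / 2) < real (Suc N) * e"
    proof -
      have "real n1 * (e / 2) \<le> real N * (e / 2)" using that e by (intro mult_right_mono) auto
      moreover have "real (Suc N) * e = 2 * (real N * (e / 2)) + e" by (simp add: algebra_simps)
      moreover have "0 \<le> real N * (e / 2)" using e by simp
      ultimately show ?thesis using n1 e by linarith
    qed
    finally show ?thesis by (simp add: norm_divide divide_less_eq mult.commute del: of_nat_Suc)
  qed
  then show "\<exists>n0. \<forall>N\<ge>n0. cmod ((\<Sum>j<N. c j) / of_nat (Suc N) - 0) < e"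
    by (intro exI[of _ "max n0 n1"]) (simp del: of_nat_Suc)
qed

text \<open>Term \<open>j\<close> occurs in exactly \<open>N - j\<close> of the partial sums. After
  division by \<open>Suc N\<close>, the gap between the last partial sum and the average is a mean
  of the numbers \<open>Suc j * a j\<close>.\<close>

lemma sum_partial_sums:
  fixes a :: "nat \<Rightarrow> complex"
  shows "(\<Sum>M<Suc N. \<Sum>j<M. a j) = of_nat (Suc N) * (\<Sum>j<N. a j) - (\<Sum>j<N. of_nat (Suc j) * a j)"
  by (induction N) (simp_all add: algebra_simps)

text \<open>Tauber's condition in paired form: since the sums are symmetric, it concerns the joint
  contribution of opposite indices. Sums and averages then differ by a Cesaro mean of a null
  sequence.\<close>

lemma symmetric_sums_from_cesaro:
  fixes b :: "int \<Rightarrow> complex"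
  assumes null: "(\<lambda>j. of_nat (Suc j) * (b (int (Suc j)) + b (- int (Suc j)))) \<longlonglongrightarrow> 0"
    and lim: "(\<lambda>N. (\<Sum>M<Suc N. \<Sum>n = - int M..int M. b n) / of_nat (Suc N)) \<longlonglongrightarrow> L"
  shows "(\<lambda>N. \<Sum>n = - int N..int N. b n) \<longlonglongrightarrow> L"
proof -
  define a where "a j = b (int (Suc j)) + b (- int (Suc j))" for j
  have S: "(\<Sum>n = - int N..int N. b n) = b 0 + (\<Sum>j<N. a j)" for N
    unfolding sum_symmetric_interval a_def ..
  have eq: "(\<Sum>M<Suc N. \<Sum>n = - int M..int M. b n) / of_nat (Suc N) + (\<Sum>j<N. of_nat (Suc j) * a j) / of_nat (Suc N)
      = (\<Sum>n = - int N..int N. b n)" for N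
  proof -
    have "(\<Sum>M<Suc N. \<Sum>n = - int M..int M. b n) = of_nat (Suc N) * b 0 + (\<Sum>M<Suc N. \<Sum>j<M. a j)"
      unfolding S sum.distrib by (simp del: sum.lessThan_Suc)
    also have "\<dots> + (\<Sum>j<N. of_nat (Suc j) * a j) = of_nat (Suc N) * (\<Sum>n = - int N..int N. b n)"
      unfolding sum_partial_sums S by (simp add: algebra_simps)
    finally show ?thesis
      by (simp only: add_divide_distrib[symmetric]) (simp del: of_nat_Suc)
  qed
  have "(\<lambda>N. (\<Sum>j<N. of_nat (Suc j) * a j) / of_nat (Suc N)) \<longlonglongrightarrow> 0"
    by (rule cesaro_means_null) (use null in \<open>simp only: a_def\<close>)
  from tendsto_add[OF lim this] show ?thesis unfolding eq by simp
qed

text \<open>The kernel is written as a squared exponential sum rather than as a quotient of sines,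
  so that nonnegativity, and continuity at the multiples of \<open>2 * pi\<close>, are
  immediate.\<close>

definition fejer :: "nat \<Rightarrow> real \<Rightarrow> real" where
  "fejer N t = (cmod (\<Sum>k<N. exp (\<i> * of_nat k * of_real t)))\<^sup>2 / real N"

lemma fejer_nonneg [simp]: "0 \<le> fejer N t"
  by (simp add: fejer_def)

lemma continuous_on_fejer [continuous_intros]:
  "continuous_on A g \<Longrightarrow> continuous_on A (\<lambda>x. fejer N (g x))"
  unfolding fejer_def divide_inverse by (intro continuous_intros)

lemma fejer_measurable [measurable]: "fejer N \<in> borel_measurable borel"
  by (intro borel_measurable_continuous_onI continuous_intros)

text \<open>By induction: in the double sum behind the squared modulus, the new index
  \<open>N\<close> adds a row, a column and a corner, whose index differences run exactly once from
  \<open>-N\<close> to \<open>N\<close>.\<close>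

lemma fejer_eq_cesaro:
  "complex_of_real (fejer N t) = (\<Sum>M<N. \<Sum>n = - int M..int M. exp (\<i> * of_int n * of_real t)) / of_nat N"
proof -
  define e where "e n = exp (\<i> * of_int n * complex_of_real t)" for n :: int
  have e_add: "e (m - n) = e m * cnj (e n)" for m n
    unfolding e_def exp_cnj exp_add[symmetric] by (simp add: algebra_simps)
  have "(\<Sum>M<N. \<Sum>n = - int M..int M. e n) = (\<Sum>k<N. e (int k)) * cnj (\<Sum>k<N. e (int k))"
  proof (induction N)
    case (Suc N)
    define A where "A = (\<Sum>k<N. e (int k))"
    have 1: "(\<Sum>j<N. e (int (Suc j))) = e (int N) * cnj A"
    proof -
      have "(\<Sum>j<N. e (int (Suc j))) = (\<Sum>j<N. e (int (Suc (N - Suc j))))"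
        by (rule sum.nat_diff_reindex[symmetric])
      also have "\<dots> = (\<Sum>j<N. e (int N - int j))"
        by (intro sum.cong refl arg_cong[where f = e]) auto
      finally show ?thesis by (simp add: e_add A_def sum_distrib_left)
    qed
    have "e (- n) = cnj (e n)" for n using e_add[of 0 n] by (simp add: e_def)
    then have "(\<Sum>j<N. e (- int (Suc j))) = cnj (\<Sum>j<N. e (int (Suc j)))" by (simp only: cnj_sum)
    then have 2: "(\<Sum>j<N. e (- int (Suc j))) = A * cnj (e (int N))" unfolding 1 by simp
    have "(\<Sum>n = - int N..int N. e n) = 1 + e (int N) * cnj A + A * cnj (e (int N))"
      unfolding sum_symmetric_interval sum.distrib 1 2 by (simp add: e_def)
    moreover have "e (int N) * cnj (e (int N)) = 1" using e_add[of "int N" "int N"] by (simp add: e_def)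
    ultimately show ?case using Suc by (simp add: A_def algebra_simps)
  qed simp
  moreover have "fejer N t = (cmod (\<Sum>k<N. e (int k)))\<^sup>2 / real N" by (simp add: fejer_def e_def)
  ultimately show ?thesis by (simp only: e_def of_real_divide complex_norm_square of_real_of_nat_eq)
qed

text \<open>In closed form the geometric sum has a numerator of modulus at most 2, whatever
  \<open>N\<close> is; away from the multiples of \<open>2 * pi\<close> the kernel therefore decays
  like \<open>1 / N\<close>.\<close>

lemma fejer_le:
  assumes "exp (\<i> * complex_of_real t) \<noteq> 1"
  shows "fejer N t \<le> 4 / (real N * (cmod (1 - exp (\<i> * of_real t)))\<^sup>2)"
proof -
  define z where "z = exp (\<i> * complex_of_real t)"
  have z: "z \<noteq> 1" "cmod z = 1" using assms by (auto simp: z_def norm_exp_eq_Re)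
  have zk: "exp (\<i> * of_nat k * of_real t) = z ^ k" for k
    by (simp add: z_def exp_of_nat_mult[symmetric] mult_ac)
  have "(\<Sum>k<N. exp (\<i> * of_nat k * of_real t)) = (1 - z ^ N) / (1 - z)"
    unfolding zk using z by (simp add: sum_gp_strict)
  then have "cmod (\<Sum>k<N. exp (\<i> * of_nat k * of_real t)) = cmod (1 - z ^ N) / cmod (1 - z)"
    by (simp add: norm_divide)
  also have "\<dots> \<le> 2 / cmod (1 - z)"
    using norm_triangle_ineq4[of 1 "z ^ N"] z by (intro divide_right_mono) (auto simp: norm_power)
  finally have "(cmod (\<Sum>k<N. exp (\<i> * of_nat k * of_real t)))\<^sup>2 \<le> (2 / cmod (1 - z))\<^sup>2"
    by (intro power_mono) auto
  then have "fejer N t \<le> (2 / cmod (1 - z))\<^sup>2 / real N"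
    unfolding fejer_def by (intro divide_right_mono) auto
  then show ?thesis by (simp add: z_def power_divide mult.commute)
qed

lemma integral_exp_Icc:
  fixes c :: complex
  assumes "c \<noteq> 0" "a \<le> b"
  shows "(LINT x|lborel. indicator {a..b} x *\<^sub>R exp (c * of_real x)) = (exp (c * of_real b) - exp (c * of_real a)) / c"
proof -
  have "(LINT x|lborel. indicator {a..b} x *\<^sub>R exp (c * of_real x)) = exp (c * of_real b) / c - exp (c * of_real a) / c"
  proof (rule integral_FTC_Icc[OF assms(2)])
    fix x :: real
    have "((\<lambda>x. exp (c * x) / c) has_field_derivative exp (c * of_real x)) (at (of_real x))"
      using assms by (auto intro!: derivative_eq_intros)
    from has_vector_derivative_real_field[OF this]
    show "((\<lambda>x. exp (c * of_real x) / c) has_vector_derivative exp (c * of_real x)) (at x within {a..b})"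
      by (rule has_vector_derivative_at_within)
  qed (intro continuous_intros)
  then show ?thesis by (simp add: diff_divide_distrib)
qed

lemma integral_exp_period:
  "(LINT x|lborel. indicator {-pi..pi} x *\<^sub>R exp (\<i> * of_int n * of_real (t - x))) = (if n = 0 then 2 * of_real pi else 0)"
proof (cases "n = 0")
  case False
  define c where "c = - (\<i> * of_int n)"
  have "(LINT x|lborel. indicator {-pi..pi} x *\<^sub>R exp (\<i> * of_int n * of_real (t - x)))
      = (LINT x|lborel. exp (\<i> * of_int n * of_real t) * (indicator {-pi..pi} x *\<^sub>R exp (c * of_real x)))"
    by (intro Bochner_Integration.integral_cong refl)
       (simp add: c_def algebra_simps flip: exp_add)
  also have "\<dots> = exp (\<i> * of_int n * of_real t) * ((exp (c * of_real pi) - exp (c * of_real (- pi))) / c)"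
    unfolding integral_mult_right_zero using False by (subst integral_exp_Icc) (auto simp: c_def)
  also have "exp (c * of_real pi) = exp (c * of_real (- pi))"
  proof -
    have "c * of_real pi = c * of_real (- pi) + of_real (of_int (2 * (- n)) * pi) * \<i>"
      by (simp add: c_def algebra_simps)
    then show ?thesis unfolding exp_eq by blast
  qed
  finally show ?thesis using False by simp
qed (simp add: scaleR_conv_of_real)

lemma integrable_indicator_mult_continuous:
  fixes g :: "real \<Rightarrow> 'a::{banach, second_countable_topology}"
  assumes "continuous_on UNIV g"
  shows "integrable lborel (\<lambda>x. indicator {a..b} x *\<^sub>R g x)"
  using borel_integrable_compact[of "{a..b}" g] continuous_on_subset[OF assms]
  by (simp add: set_integrable_def)

text \<open>Each of the averaged partial sums contains frequency 0 exactly once, and all other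
  frequencies integrate to 0 over a period.\<close>

lemma integral_fejer:
  assumes "N > 0"
  shows "(LINT x|lborel. indicator {-pi..pi} x * fejer N (t - x)) = 2 * pi"
proof -
  let ?e = "\<lambda>n x. exp (\<i> * of_int n * complex_of_real (t - x))"
  have int: "integrable lborel (\<lambda>x. indicator {-pi..pi} x *\<^sub>R ?e n x)" for n
    by (intro integrable_indicator_mult_continuous continuous_intros)
  have "complex_of_real (LINT x|lborel. indicator {-pi..pi} x * fejer N (t - x))
      = (LINT x|lborel. complex_of_real (indicator {-pi..pi} x * fejer N (t - x)))"
    by (rule integral_complex_of_real[symmetric])
  also have "\<dots> = (LINT x|lborel. (\<Sum>M<N. \<Sum>n = - int M..int M. indicator {-pi..pi} x *\<^sub>R ?e n x) / of_nat N)"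
    by (intro Bochner_Integration.integral_cong refl)
       (simp add: fejer_eq_cesaro scaleR_conv_of_real sum_distrib_left)
  also have "\<dots> = (\<Sum>M<N. \<Sum>n = - int M..int M. (LINT x|lborel. indicator {-pi..pi} x *\<^sub>R ?e n x)) / of_nat N"
    by (simp only: integral_divide_zero Bochner_Integration.integral_sum int Bochner_Integration.integrable_sum)
  also have "\<dots> = (\<Sum>M<N. 2 * of_real pi) / of_nat N"
    unfolding integral_exp_period by simp
  also have "\<dots> = complex_of_real (2 * pi)" using assms by simp
  finally show ?thesis by (simp only: of_real_eq_iff)
qed

lemma integrable_mult_fejer:
  assumes [measurable]: "g \<in> borel_measurable borel" and le: "\<And>x. cmod (g x) \<le> indicator {-pi..pi} x * B"
  shows "integrable lborel (\<lambda>x. g x * of_real (fejer N (t - x)))"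
proof (rule Bochner_Integration.integrable_bound)
  show "integrable lborel (\<lambda>x. B * (indicator {-pi..pi} x *\<^sub>R fejer N (t - x)))"
    by (intro integrable_mult_right integrable_indicator_mult_continuous continuous_intros)
  have "cmod (g x * of_real (fejer N (t - x))) \<le> norm (B * (indicator {-pi..pi} x *\<^sub>R fejer N (t - x)))" for x
  proof -
    have "cmod (g x) \<le> indicator {-pi..pi} x * \<bar>B\<bar>" using le[of x] by (auto simp: indicator_def split: if_splits)
    then have "cmod (g x) * fejer N (t - x) \<le> (indicator {-pi..pi} x * \<bar>B\<bar>) * fejer N (t - x)"
      by (intro mult_right_mono) auto
    then show ?thesis by (simp add: norm_mult abs_mult mult_ac)
  qed
  then show "AE x in lborel. norm (g x * of_real (fejer N (t - x))) \<le> norm (B * (indicator {-pi..pi} x *\<^sub>R fejer N (t - x)))"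
    by simp
qed measurable

text \<open>A nonnegative kernel of mean 1 cannot raise the bound of \<open>g\<close>. Uniformity in
  \<open>N\<close> and \<open>t\<close> is what supplies the majorant for the sampling
  series.\<close>

lemma fejer_mean_bound:
  assumes [measurable]: "g \<in> borel_measurable borel" and le: "\<And>x. cmod (g x) \<le> indicator {-pi..pi} x" and N: "N > 0"
  shows "cmod ((LINT x|lborel. g x * of_real (fejer N (t - x))) / (2 * of_real pi)) \<le> 1"
proof -
  have "cmod (LINT x|lborel. g x * of_real (fejer N (t - x))) \<le> (LINT x|lborel. indicator {-pi..pi} x *\<^sub>R fejer N (t - x))"
  proof (rule Bochner_Integration.integral_norm_bound_integral)
    show "integrable lborel (\<lambda>x. g x * of_real (fejer N (t - x)))"
      using le by (intro integrable_mult_fejer[where B = 1]) auto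
    show "integrable lborel (\<lambda>x. indicator {-pi..pi} x *\<^sub>R fejer N (t - x))"
      by (intro integrable_indicator_mult_continuous continuous_intros)
    show "norm (g x * of_real (fejer N (t - x))) \<le> indicator {-pi..pi} x *\<^sub>R fejer N (t - x)" for x
      using le[of x] by (auto simp: norm_mult intro!: mult_right_mono)
  qed
  also have "\<dots> = 2 * pi" using integral_fejer[OF N] by simp
  finally show ?thesis by (simp add: norm_divide norm_mult)
qed

lemma fejer_mean_tendsto:
  assumes g_meas [measurable]: "g \<in> borel_measurable borel" and le: "\<And>x. cmod (g x) \<le> indicator {-pi..pi} x"
    and t: "-pi < t" "t < pi" and cont: "isCont g t"
  shows "(\<lambda>N. (LINT x|lborel. g x * of_real (fejer (Suc N) (t - x))) / (2 * of_real pi)) \<longlonglongrightarrow> g t"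
proof -
  have g1: "cmod (g x) \<le> 1" for x by (rule order_trans[OF le]) (simp add: indicator_def)
  let ?I = "\<lambda>N. LINT x|lborel. g x * of_real (fejer (Suc N) (t - x))"
  have "(\<lambda>N. ?I N - 2 * of_real pi * g t) \<longlonglongrightarrow> 0"
  proof (rule LIMSEQ_I)
    fix e :: real assume e: "e > 0"
    \<comment> \<open>The kernel has integral \<open>2 * pi\<close>, so an oscillation of this size
      near \<open>t\<close> contributes \<open>e / 2\<close>.\<close>
    define \<epsilon> where "\<epsilon> = e / (4 * pi)"
    have \<epsilon>: "\<epsilon> > 0" using e by (simp add: \<epsilon>_def)
    from cont[unfolded continuous_at_eps_delta, rule_format, OF \<epsilon>] obtain d where
      d: "d > 0" "\<And>x. dist x t < d \<Longrightarrow> dist (g x) (g t) < \<epsilon>" by blast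
    \<comment> \<open>The part of the period away from \<open>t\<close>. As \<open>t\<close> is an
      interior point, \<open>t - x\<close> is nonzero and smaller than \<open>2 * pi\<close> in
      modulus there, so \<open>1 - exp (\<i> * (t - x))\<close> has no zero on \<open>K\<close> and
      compactness bounds it away from 0.\<close>
    define K where "K = {-pi..pi} \<inter> {x. d \<le> \<bar>x - t\<bar>}"
    have "compact K" unfolding K_def
      by (intro compact_Int_closed closed_Collect_le continuous_intros) auto
    have nz: "exp (\<i> * complex_of_real (t - x)) \<noteq> 1" if "x \<in> K" for x
    proof
      assume "exp (\<i> * complex_of_real (t - x)) = 1"
      then obtain n :: int where n: "t - x = of_int (2 * n) * pi" by (auto simp: exp_eq_1)
      have "\<bar>t - x\<bar> < 2 * pi" "t - x \<noteq> 0" using that t d by (auto simp: K_def abs_if)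
      then have "\<bar>real_of_int n\<bar> < 1" "n \<noteq> 0" using n by (auto simp: abs_mult)
      then show False by linarith
    qed
    obtain m where m: "m > 0" "\<And>x. x \<in> K \<Longrightarrow> m \<le> cmod (1 - exp (\<i> * of_real (t - x)))"
    proof (cases "K = {}")
      case False
      have "continuous_on K (\<lambda>x. cmod (1 - exp (\<i> * of_real (t - x))))" by (intro continuous_intros)
      from continuous_attains_inf[OF \<open>compact K\<close> False this] obtain x0 where
        x0: "x0 \<in> K" "\<And>x. x \<in> K \<Longrightarrow> cmod (1 - exp (\<i> * of_real (t - x0))) \<le> cmod (1 - exp (\<i> * of_real (t - x)))" by blast
      show ?thesis by (rule that[OF _ x0(2)]) (use nz[OF x0(1)] in auto)
    qed (use that[of 1] in auto)
    \<comment> \<open>The constant 4 of \<open>fejer_le\<close> times 2, the largest possible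
      difference of two values of \<open>g\<close>.\<close>
    define C where "C = 8 / m\<^sup>2"
    have C: "C > 0" using m by (simp add: C_def)
    have bound: "cmod (?I N - 2 * of_real pi * g t) \<le> e / 2 + 2 * pi * (C / real (Suc N))" for N
    proof -
      let ?f = "\<lambda>x. fejer (Suc N) (t - x)" and ?i = "\<lambda>x. indicator {-pi..pi} x :: real"
      have i1: "integrable lborel (\<lambda>x. g x * of_real (?f x))"
        using le by (intro integrable_mult_fejer[where B = 1]) auto
      have i2: "integrable lborel (\<lambda>x. ?i x *\<^sub>R ?f x)"
        by (intro integrable_indicator_mult_continuous continuous_intros)
      have "integrable lborel (\<lambda>x. complex_of_real (?i x *\<^sub>R ?f x))" using i2 by (rule integrable_of_real)
      then have i3: "integrable lborel (\<lambda>x. g t * complex_of_real (?i x * ?f x))"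
        by (intro integrable_mult_right) simp
      have "2 * of_real pi * g t = g t * complex_of_real (LINT x|lborel. ?i x * ?f x)"
        by (subst integral_fejer) auto
      also have "\<dots> = (LINT x|lborel. g t * complex_of_real (?i x * ?f x))"
        by (simp only: integral_complex_of_real integral_mult_right_zero)
      finally have eqI: "?I N - 2 * of_real pi * g t = (LINT x|lborel. g x * of_real (?f x) - g t * complex_of_real (?i x * ?f x))"
        by (simp only: Bochner_Integration.integral_diff[OF i1 i3])
      have "cmod (?I N - 2 * of_real pi * g t) \<le> (LINT x|lborel. \<epsilon> * (?i x *\<^sub>R ?f x) + ?i x *\<^sub>R (C / real (Suc N)))"
        unfolding eqI
      proof (rule Bochner_Integration.integral_norm_bound_integral)
        show "integrable lborel (\<lambda>x. g x * of_real (?f x) - g t * complex_of_real (?i x * ?f x))"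
          by (rule Bochner_Integration.integrable_diff[OF i1 i3])
        show "integrable lborel (\<lambda>x. \<epsilon> * (?i x *\<^sub>R ?f x) + ?i x *\<^sub>R (C / real (Suc N)))"
          by (intro Bochner_Integration.integrable_add integrable_mult_right i2 integrable_indicator_mult_continuous continuous_intros)
        fix x
        show "norm (g x * of_real (?f x) - g t * complex_of_real (?i x * ?f x)) \<le> \<epsilon> * (?i x *\<^sub>R ?f x) + ?i x *\<^sub>R (C / real (Suc N))"
        proof (cases "x \<in> {-pi..pi}")
          case False
          then show ?thesis using le[of x] by simp
        next
          case True
          have eq: "norm (g x * of_real (?f x) - g t * complex_of_real (?i x * ?f x)) = cmod (g x - g t) * ?f x"
            using True by (simp add: norm_mult flip: left_diff_distrib)
          show ?thesis
          proof (cases "x \<in> K")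
            case xK: True
            have "?f x \<le> 4 / (real (Suc N) * (cmod (1 - exp (\<i> * of_real (t - x))))\<^sup>2)" by (rule fejer_le[OF nz[OF xK]])
            also have "\<dots> \<le> 4 / (real (Suc N) * m\<^sup>2)"
              using m(1) m(2)[OF xK] by (intro divide_left_mono mult_left_mono power_mono mult_pos_pos) auto
            also have "\<dots> = (C / real (Suc N)) / 2" by (simp add: C_def)
            finally have f: "?f x \<le> (C / real (Suc N)) / 2" .
            have "cmod (g x - g t) \<le> 2" using norm_triangle_ineq4[of "g x" "g t"] g1[of x] g1[of t] by linarith
            then have "cmod (g x - g t) * ?f x \<le> 2 * ((C / real (Suc N)) / 2)" by (intro mult_mono f) auto
            moreover have "2 * (y / 2) = y" for y :: real by simp
            ultimately have "cmod (g x - g t) * ?f x \<le> C / real (Suc N)" by (simp only:)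
            moreover have "0 \<le> \<epsilon> * ?f x" using \<epsilon> by simp
            ultimately show ?thesis unfolding eq using True by (simp del: of_nat_Suc)
          next
            case False
            then have "cmod (g x - g t) \<le> \<epsilon>" using d(2)[of x] True by (auto simp: K_def dist_norm dist_real_def)
            then have "cmod (g x - g t) * ?f x \<le> \<epsilon> * ?f x" by (intro mult_right_mono) auto
            moreover have "0 \<le> C / real (Suc N)" using C by simp
            ultimately show ?thesis unfolding eq using True by simp
          qed
        qed
      qed
      also have "\<dots> = \<epsilon> * (LINT x|lborel. ?i x *\<^sub>R ?f x) + (LINT x|lborel. ?i x *\<^sub>R (C / real (Suc N)))"
        unfolding integral_mult_right_zero[symmetric]
        by (intro Bochner_Integration.integral_add integrable_mult_right i2 integrable_indicator_mult_continuous continuous_intros)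
      also have "\<dots> = e / 2 + 2 * pi * (C / real (Suc N))"
      proof -
        have "(LINT x|lborel. ?i x *\<^sub>R ?f x) = 2 * pi" using integral_fejer[of "Suc N" t] by simp
        moreover have "(LINT x|lborel. ?i x *\<^sub>R (C / real (Suc N))) = 2 * pi * (C / real (Suc N))" by simp
        moreover have "\<epsilon> * (2 * pi) = e / 2" by (simp add: \<epsilon>_def)
        ultimately show ?thesis by (simp only:)
      qed
      finally show ?thesis .
    qed
    have "(\<lambda>N. 2 * pi * (C / real (Suc N))) \<longlonglongrightarrow> 2 * pi * 0"
      by (intro tendsto_intros LIMSEQ_Suc lim_const_over_n)
    then have "\<forall>\<^sub>F N in sequentially. 2 * pi * (C / real (Suc N)) < e / 2"
      using e by (intro order_tendstoD(2)) auto
    then obtain N0 where N0: "\<And>N. N \<ge> N0 \<Longrightarrow> 2 * pi * (C / real (Suc N)) < e / 2"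
      by (auto simp: eventually_sequentially)
    have "\<forall>N\<ge>N0. norm (?I N - 2 * of_real pi * g t - 0) < e"
    proof (intro allI impI)
      fix N assume "N \<ge> N0"
      from bound[of N] N0[OF this] show "norm (?I N - 2 * of_real pi * g t - 0) < e" unfolding diff_zero by linarith
    qed
    then show "\<exists>N0. \<forall>N\<ge>N0. norm (?I N - 2 * of_real pi * g t - 0) < e" by blast
  qed
  then have "?I \<longlonglongrightarrow> 2 * of_real pi * g t" by (rule LIM_zero_cancel)
  then have "(\<lambda>N. ?I N / (2 * of_real pi)) \<longlonglongrightarrow> (2 * of_real pi * g t) / (2 * of_real pi)"
    by (intro tendsto_intros) auto
  then show ?thesis by simp
qed

subsection \<open>The sampling series\<close>

definition half_band :: "real \<Rightarrow> real \<Rightarrow> complex" where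
  "half_band a x = indicator {0..pi} x *\<^sub>R exp (\<i> * of_real a * of_real x)"

text \<open>The representative modulo \<open>2 * pi\<close> in the half-open interval from
  \<open>-pi\<close> to \<open>pi\<close>. Samples at the integer multiples of \<open>h\<close> see
  a frequency \<open>v\<close> only through \<open>wrap (v * h)\<close>.\<close>

definition wrap :: "real \<Rightarrow> real" where
  "wrap t = t - 2 * pi * of_int \<lfloor>(t + pi) / (2 * pi)\<rfloor>"

definition cesaro_kernel :: "nat \<Rightarrow> real \<Rightarrow> real \<Rightarrow> complex" where
  "cesaro_kernel N a t =
     (\<Sum>M<N. \<Sum>n = - int M..int M. exp (\<i> * of_int n * of_real t) * plus_kernel (a - of_int n)) / of_nat N"

lemma half_band_measurable [measurable]: "half_band a \<in> borel_measurable borel"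
  unfolding half_band_def[abs_def] by measurable

lemma wrap_measurable [measurable]: "wrap \<in> borel_measurable borel"
  unfolding wrap_def[abs_def] by measurable

lemma norm_half_band_le: "cmod (half_band a x) \<le> indicator {-pi..pi} x"
  by (auto simp: half_band_def indicator_def norm_exp_eq_Re)

lemma norm_half_band_le_1: "cmod (half_band a x) \<le> 1"
  by (rule order_trans[OF norm_half_band_le]) (simp add: indicator_def)

lemma wrap_bounds: "- pi \<le> wrap t" "wrap t < pi"
proof -
  define y where "y = (t + pi) / (2 * pi)"
  have y: "t + pi = 2 * pi * y" by (simp add: y_def)
  have "2 * pi * of_int \<lfloor>y\<rfloor> \<le> 2 * pi * y" "2 * pi * y < 2 * pi * (of_int \<lfloor>y\<rfloor> + 1)"
    by (intro mult_left_mono mult_strict_left_mono; linarith?; simp)+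
  then have "2 * pi * of_int \<lfloor>(t + pi) / (2 * pi)\<rfloor> \<le> t + pi"
    "t + pi < 2 * pi * of_int \<lfloor>(t + pi) / (2 * pi)\<rfloor> + 2 * pi"
    unfolding y y_def[symmetric] by (simp_all add: distrib_left)
  then show "- pi \<le> wrap t" "wrap t < pi" by (simp_all add: wrap_def)
qed

lemma wrap_eq_self:
  assumes "\<bar>t\<bar> < pi"
  shows "wrap t = t"
proof -
  have "\<lfloor>(t + pi) / (2 * pi)\<rfloor> = 0" using assms by (auto simp: floor_eq_iff field_simps)
  then show ?thesis by (simp add: wrap_def)
qed

lemma half_band_integrable: "integrable lborel (half_band a)"
  unfolding half_band_def[abs_def] by (intro integrable_indicator_mult_continuous continuous_intros)

lemma plus_kernel_eq_integral:
  "plus_kernel t = (LINT x|lborel. half_band t x) / (2 * of_real pi)"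
proof (cases "t = 0")
  case True
  then show ?thesis by (simp add: plus_kernel_def half_band_def scaleR_conv_of_real)
next
  case False
  then show ?thesis
    unfolding half_band_def by (subst integral_exp_Icc) (auto simp: plus_kernel_def mult_ac)
qed

lemma norm_plus_kernel_le: "cmod (plus_kernel t) \<le> 1"
proof -
  have "cmod (LINT x|lborel. half_band t x) \<le> (LINT x|lborel. indicator {-pi..pi} x)"
    by (intro Bochner_Integration.integral_norm_bound_integral half_band_integrable norm_half_band_le) auto
  then show ?thesis unfolding plus_kernel_eq_integral by (simp add: norm_divide norm_mult)
qed

text \<open>While \<open>n\<close> is at most twice \<open>a\<close> in modulus, the trivial bound 1
  suffices; beyond that, the distance from \<open>a\<close> to \<open>n\<close> is at least half of
  the modulus of \<open>n\<close> and the denominator of the kernel takes over.\<close>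

lemma norm_plus_kernel_decay: "\<bar>real_of_int n\<bar> * cmod (plus_kernel (a - of_int n)) \<le> 2 * \<bar>a\<bar> + 2"
proof (cases "\<bar>real_of_int n\<bar> \<le> 2 * \<bar>a\<bar>")
  case True
  then have "\<bar>real_of_int n\<bar> * cmod (plus_kernel (a - of_int n)) \<le> 2 * \<bar>a\<bar> * 1"
    by (intro mult_mono norm_plus_kernel_le) auto
  then show ?thesis by simp
next
  case False
  define t where "t = a - of_int n"
  have t: "\<bar>real_of_int n\<bar> \<le> 2 * \<bar>t\<bar>" "t \<noteq> 0" using False by (auto simp: t_def abs_if split: if_splits)
  have "cmod (exp (of_real pi * \<i> * of_real t) - 1) \<le> 2"
    using norm_triangle_ineq4[of "exp (of_real pi * \<i> * complex_of_real t)" 1] by (simp add: norm_exp_eq_Re)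
  moreover have "cmod (plus_kernel t) = cmod (exp (of_real pi * \<i> * of_real t) - 1) / (2 * pi * \<bar>t\<bar>)"
    using t by (simp add: plus_kernel_def norm_divide norm_mult)
  ultimately have "cmod (plus_kernel t) \<le> 2 / (2 * pi * \<bar>t\<bar>)"
    by (simp only:) (rule divide_right_mono; simp)
  then have "\<bar>real_of_int n\<bar> * cmod (plus_kernel t) \<le> (2 * \<bar>t\<bar>) * (2 / (2 * pi * \<bar>t\<bar>))"
    using t by (intro mult_mono) auto
  also have "\<dots> = 2 / pi" using t by simp
  also have "\<dots> \<le> 2" using pi_gt3 by (simp add: field_simps)
  finally show ?thesis unfolding t_def by simp
qed

text \<open>Averaging partial Fourier sums is convolution with the Fejer kernel: the coefficients
  are written as integrals of \<open>half_band a\<close> and the finite sums are taken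
  inside.\<close>

lemma cesaro_kernel_eq_fejer_mean:
  "cesaro_kernel N a t = (LINT x|lborel. half_band a x * of_real (fejer N (t - x))) / (2 * of_real pi)"
proof -
  have int: "integrable lborel (\<lambda>x. half_band a x * exp (\<i> * of_int n * of_real (t - x)))" for n
    unfolding half_band_def mult_scaleR_left
    by (intro integrable_indicator_mult_continuous continuous_intros)
  have term_eq: "exp (\<i> * of_int n * of_real t) * plus_kernel (a - of_int n)
      = (LINT x|lborel. half_band a x * exp (\<i> * of_int n * of_real (t - x))) / (2 * of_real pi)" for n
  proof -
    have "exp (\<i> * of_int n * of_real t) * half_band (a - of_int n) x = half_band a x * exp (\<i> * of_int n * of_real (t - x))" for x
      by (simp add: half_band_def algebra_simps flip: exp_add)
    then have "exp (\<i> * of_int n * of_real t) * (LINT x|lborel. half_band (a - of_int n) x)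
        = (LINT x|lborel. half_band a x * exp (\<i> * of_int n * of_real (t - x)))"
      by (simp only: integral_mult_right_zero[symmetric])
    then show ?thesis unfolding plus_kernel_eq_integral by (simp only: times_divide_eq_right)
  qed
  have "cesaro_kernel N a t = (\<Sum>M<N. \<Sum>n = - int M..int M. (LINT x|lborel. half_band a x * exp (\<i> * of_int n * of_real (t - x)))) / of_nat N / (2 * of_real pi)"
    unfolding cesaro_kernel_def term_eq by (simp add: sum_divide_distrib mult.commute)
  also have "(\<Sum>M<N. \<Sum>n = - int M..int M. (LINT x|lborel. half_band a x * exp (\<i> * of_int n * of_real (t - x)))) / of_nat N
      = (LINT x|lborel. (\<Sum>M<N. \<Sum>n = - int M..int M. half_band a x * exp (\<i> * of_int n * of_real (t - x))) / of_nat N)"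
    by (simp only: integral_divide_zero Bochner_Integration.integral_sum int Bochner_Integration.integrable_sum)
  also have "\<dots> = (LINT x|lborel. half_band a x * of_real (fejer N (t - x)))"
    unfolding fejer_eq_cesaro by (simp only: sum_distrib_left[symmetric] times_divide_eq_right)
  finally show ?thesis .
qed

lemma cesaro_kernel_wrap: "cesaro_kernel N a (wrap t) = cesaro_kernel N a t"
proof -
  have "exp (\<i> * of_int n * of_real (wrap t)) = exp (\<i> * of_int n * of_real t)" for n
  proof -
    have "\<i> * of_int n * of_real (wrap t)
        = \<i> * of_int n * of_real t + of_real (of_int (2 * (- n * \<lfloor>(t + pi) / (2 * pi)\<rfloor>)) * pi) * \<i>"
      by (simp add: wrap_def algebra_simps)
    then show ?thesis unfolding exp_eq by blast
  qed
  then show ?thesis by (simp add: cesaro_kernel_def)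
qed

lemma norm_cesaro_kernel_le: "N > 0 \<Longrightarrow> cmod (cesaro_kernel N a t) \<le> 1"
  unfolding cesaro_kernel_eq_fejer_mean by (rule fejer_mean_bound[OF half_band_measurable norm_half_band_le])

lemma isCont_half_band:
  assumes "- pi < x" "x < pi" "x \<noteq> 0"
  shows "isCont (half_band a) x"
proof (cases "x > 0")
  case True
  have "\<forall>\<^sub>F y in nhds x. y \<in> {0<..<pi}" using True assms by (intro eventually_nhds_in_open) auto
  then have "\<forall>\<^sub>F y in nhds x. half_band a y = exp (\<i> * of_real a * of_real y)"
    by eventually_elim (auto simp: half_band_def)
  then have "isCont (half_band a) x \<longleftrightarrow> isCont (\<lambda>y. exp (\<i> * of_real a * of_real y)) x" by (rule isCont_cong)
  moreover have "isCont (\<lambda>y. exp (\<i> * of_real a * complex_of_real y)) x" by (intro continuous_intros)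
  ultimately show ?thesis by blast
next
  case False
  then have "\<forall>\<^sub>F y in nhds x. y \<in> {..<0}" using assms by (intro eventually_nhds_in_open) auto
  then have "\<forall>\<^sub>F y in nhds x. half_band a y = 0"
    by eventually_elim (auto simp: half_band_def)
  then have "isCont (half_band a) x \<longleftrightarrow> isCont (\<lambda>y. 0 :: complex) x" by (rule isCont_cong)
  then show ?thesis by simp
qed

text \<open>The exclusions are the points where the periodic extension of \<open>half_band a\<close>
  jumps: 0 and the common end of two periods.\<close>

lemma cesaro_kernel_tendsto:
  assumes "wrap t \<noteq> - pi" "wrap t \<noteq> 0"
  shows "(\<lambda>N. cesaro_kernel (Suc N) a t) \<longlonglongrightarrow> half_band a (wrap t)"
proof -
  have "- pi < wrap t" "wrap t < pi" using wrap_bounds[of t] assms by auto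
  then have "(\<lambda>N. cesaro_kernel (Suc N) a (wrap t)) \<longlonglongrightarrow> half_band a (wrap t)"
    unfolding cesaro_kernel_eq_fejer_mean
    using assms by (intro fejer_mean_tendsto half_band_measurable norm_half_band_le isCont_half_band)
  then show ?thesis unfolding cesaro_kernel_wrap .
qed

text \<open>Either excluded value forces \<open>w\<close> to be an integer multiple of
  \<open>pi / h\<close>, and these form a countable set.\<close>

lemma AE_wrap:
  assumes "h > 0"
  shows "AE w in lborel. wrap (w * h) \<noteq> - pi \<and> wrap (w * h) \<noteq> 0"
proof -
  define A where "A = range (\<lambda>k::int. of_int k * pi / h)"
  have "countable A" unfolding A_def by simp
  then have "AE w in lborel. w \<notin> A"
    by (intro AE_not_in countable_imp_null_set_lborel)
  then show ?thesis
  proof eventually_elim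
    case (elim w)
    define k where "k = \<lfloor>(w * h + pi) / (2 * pi)\<rfloor>"
    have k: "w * h = wrap (w * h) + of_int (2 * k) * pi" by (simp add: wrap_def k_def)
    have "w \<in> A" if "wrap (w * h) = of_int j * pi" for j
    proof -
      have "w * h = of_int (j + 2 * k) * pi" using k that by (simp add: algebra_simps)
      then have "w = of_int (j + 2 * k) * pi / h" using assms by (simp add: field_simps)
      then show ?thesis unfolding A_def by blast
    qed
    from this[of 0] this[of "-1"] elim show ?case by auto
  qed
qed

section \<open>Decay of the samples at infinity\<close>

lemma ift_uniform_modulus:
  assumes F: "integrable lborel F" and e: "e > 0"
  obtains d where "d > 0" "\<And>x u. \<bar>u\<bar> \<le> d \<Longrightarrow> cmod (ift F (x + u) - ift F x) \<le> e"
proof -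
  have [measurable]: "F \<in> borel_measurable borel" using F by auto
  \<comment> \<open>A modulus of continuity independent of \<open>x\<close>: a shift by
    \<open>u\<close> multiplies the integrand by a phase, and only this phase minus 1
    enters.\<close>
  define r where "r u = (LINT w|lborel. \<bar>F w\<bar> * cmod (exp (\<i> * of_real w * of_real u) - 1))" for u
  have b: "cmod (exp (\<i> * of_real w * complex_of_real u) - 1) \<le> 2" for w u
    using norm_triangle_ineq4[of "exp (\<i> * of_real w * complex_of_real u)" 1] by simp
  have bF: "norm (\<bar>F w\<bar> * cmod (exp (\<i> * of_real w * complex_of_real u) - 1)) \<le> \<bar>F w\<bar> * 2" for w u
    using b[of w u] by (simp add: mult_left_mono)
  have int: "integrable lborel (\<lambda>w. \<bar>F w\<bar> * cmod (exp (\<i> * of_real w * of_real u) - 1))" for u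
    by (rule Bochner_Integration.integrable_bound[where f = "\<lambda>w. \<bar>F w\<bar> * 2"]) (use F bF in auto)
  have "(r \<longlongrightarrow> (LINT w::real|lborel. 0)) (at 0)"
    unfolding tendsto_at_iff_sequentially o_def
  proof (intro allI impI)
    fix X assume X: "X \<longlonglongrightarrow> (0::real)"
    show "(\<lambda>n. r (X n)) \<longlonglongrightarrow> (LINT w::real|lborel. 0)"
      unfolding r_def
    proof (rule integral_dominated_convergence[where w = "\<lambda>w. \<bar>F w\<bar> * 2"])
      show "AE w in lborel. (\<lambda>n. \<bar>F w\<bar> * cmod (exp (\<i> * of_real w * of_real (X n)) - 1)) \<longlonglongrightarrow> 0"
      proof (rule AE_I2)
        fix w :: real
        have "(\<lambda>n. \<bar>F w\<bar> * cmod (exp (\<i> * of_real w * of_real (X n)) - 1)) \<longlonglongrightarrow> \<bar>F w\<bar> * cmod (exp (\<i> * of_real w * of_real 0) - 1)"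
          by (intro tendsto_intros X)
        then show "(\<lambda>n. \<bar>F w\<bar> * cmod (exp (\<i> * of_real w * of_real (X n)) - 1)) \<longlonglongrightarrow> 0" by simp
      qed
    qed (use F bF in auto)
  qed
  then have "\<forall>\<^sub>F u in at 0. r u < e" using e by (intro order_tendstoD(2)) auto
  then obtain d where d: "d > 0" "\<And>u. u \<noteq> 0 \<Longrightarrow> \<bar>u\<bar> < d \<Longrightarrow> r u < e"
    by (auto simp: eventually_at dist_real_def)
  have r: "cmod (ift F (x + u) - ift F x) \<le> r u" for x u
  proof -
    let ?E = "\<lambda>w x. complex_of_real (F w) * exp (\<i> * of_real w * of_real x)"
    have "ift F (x + u) - ift F x = (LINT w|lborel. ?E w (x + u) - ?E w x) / (2 * of_real pi)"
      unfolding ift_def diff_divide_distrib[symmetric]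
      by (intro arg_cong2[where f = "(/)"] Bochner_Integration.integral_diff[symmetric] integrable_of_real_mult_exp F refl)
    then have "cmod (ift F (x + u) - ift F x) = cmod (LINT w|lborel. ?E w (x + u) - ?E w x) / (2 * pi)"
      by (simp add: norm_divide norm_mult)
    also have "\<dots> \<le> r u / 1"
    proof (rule frac_le)
      show "cmod (LINT w|lborel. ?E w (x + u) - ?E w x) \<le> r u"
        unfolding r_def
      proof (rule Bochner_Integration.integral_norm_bound_integral[OF _ int])
        show "integrable lborel (\<lambda>w. ?E w (x + u) - ?E w x)"
          by (intro Bochner_Integration.integrable_diff integrable_of_real_mult_exp F)
        fix w
        have "?E w (x + u) - ?E w x = ?E w x * (exp (\<i> * of_real w * of_real u) - 1)"
          by (simp add: algebra_simps flip: exp_add)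
        then show "norm (?E w (x + u) - ?E w x) \<le> \<bar>F w\<bar> * cmod (exp (\<i> * of_real w * of_real u) - 1)"
          by (simp add: norm_mult)
      qed
      show "0 \<le> r u" unfolding r_def by (intro Bochner_Integration.integral_nonneg) auto
      show "1 \<le> 2 * pi" using pi_gt3 by linarith
    qed auto
    finally show ?thesis by simp
  qed
  show thesis
  proof
    \<comment> \<open>Halving \<open>d\<close> allows a weak inequality where the limit gives a
      strict one; \<open>u = 0\<close>, which a limit at 0 leaves out, is immediate.\<close>
    show "d / 2 > 0" using d by simp
    fix x u :: real assume "\<bar>u\<bar> \<le> d / 2"
    then show "cmod (ift F (x + u) - ift F x) \<le> e"
      using d(1) d(2)[of u] r[of x u] e by (cases "u = 0") auto
  qed
qed

text \<open>A uniformly continuous square integrable function vanishes at infinity.\<close>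

lemma ift_vanishes_at_infinity:
  assumes F: "integrable lborel F" and F2: "integrable lborel (\<lambda>w. (F w)\<^sup>2)"
    and X: "filterlim (\<lambda>n. \<bar>X n\<bar>) at_top sequentially"
  shows "(\<lambda>n. ift F (X n)) \<longlonglongrightarrow> 0"
proof (rule LIMSEQ_I)
  fix e :: real assume e: "e > 0"
  define f where "f = ift F"
  have f2: "integrable lborel (\<lambda>x. (cmod (f x))\<^sup>2)" and [measurable]: "f \<in> borel_measurable borel"
    using square_integrable_ift[OF F F2] by (auto simp: f_def square_integrable_def)
  obtain d where d: "d > 0" "\<And>x u. \<bar>u\<bar> \<le> d \<Longrightarrow> cmod (f (x + u) - f x) \<le> e / 2"
    using ift_uniform_modulus[OF F, of "e / 2"] e unfolding f_def by auto
  \<comment> \<open>The mass of the squared modulus in a window of fixed length to the right of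
    \<open>X n\<close>. It vanishes as the window escapes, and uniform continuity lets it control
    the value at \<open>X n\<close> itself.\<close>
  define J where "J n = (LINT y|lborel. indicator {X n..X n + d} y *\<^sub>R (cmod (f y))\<^sup>2)" for n
  have Ji: "integrable lborel (\<lambda>y. indicator {X n..X n + d} y *\<^sub>R (cmod (f y))\<^sup>2)" for n
    by (rule Bochner_Integration.integrable_bound[OF f2]) (auto simp: indicator_def)
  have "J \<longlonglongrightarrow> (LINT y::real|lborel. 0)"
    unfolding J_def
  proof (rule integral_dominated_convergence[where w = "\<lambda>x. (cmod (f x))\<^sup>2"])
    show "AE y in lborel. (\<lambda>n. indicator {X n..X n + d} y *\<^sub>R (cmod (f y))\<^sup>2) \<longlonglongrightarrow> 0"
    proof (rule AE_I2)
      fix y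
      have "\<forall>\<^sub>F n in sequentially. \<bar>y\<bar> + d + 1 \<le> \<bar>X n\<bar>" using X unfolding filterlim_at_top by blast
      then have "\<forall>\<^sub>F n in sequentially. 0 = indicator {X n..X n + d} y *\<^sub>R (cmod (f y))\<^sup>2"
        by eventually_elim (use d(1) in \<open>auto simp: indicator_def abs_if split: if_splits\<close>)
      then show "(\<lambda>n. indicator {X n..X n + d} y *\<^sub>R (cmod (f y))\<^sup>2) \<longlonglongrightarrow> 0"
        by (rule Lim_transform_eventually[OF tendsto_const])
    qed
  qed (use f2 in \<open>auto simp: indicator_def\<close>)
  \<comment> \<open>With the factor 1/8 the final estimate is
    \<open>d * e\<^sup>2 / 4 + d * e\<^sup>2 / 2\<close>, below
    \<open>d * e\<^sup>2\<close>.\<close>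
  then have "\<forall>\<^sub>F n in sequentially. J n < d * (e\<^sup>2 / 8)"
    using e d by (intro order_tendstoD(2)) auto
  then obtain n0 where n0: "\<And>n. n \<ge> n0 \<Longrightarrow> J n < d * (e\<^sup>2 / 8)" by (auto simp: eventually_sequentially)
  have "cmod (f (X n)) < e" if "n \<ge> n0" for n
  proof -
    let ?i = "\<lambda>y. indicator {X n..X n + d} y :: real"
    have "(LINT y|lborel. ?i y *\<^sub>R (cmod (f (X n)))\<^sup>2) \<le> (LINT y|lborel. 2 * (?i y *\<^sub>R (cmod (f y))\<^sup>2) + ?i y *\<^sub>R (e\<^sup>2 / 2))"
    proof (rule integral_mono)
      show "integrable lborel (\<lambda>y. ?i y *\<^sub>R (cmod (f (X n)))\<^sup>2)"
        by (intro integrable_indicator_mult_continuous continuous_intros)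
      show "integrable lborel (\<lambda>y. 2 * (?i y *\<^sub>R (cmod (f y))\<^sup>2) + ?i y *\<^sub>R (e\<^sup>2 / 2))"
        by (intro Bochner_Integration.integrable_add integrable_mult_right Ji integrable_indicator_mult_continuous continuous_intros)
      fix y
      show "?i y *\<^sub>R (cmod (f (X n)))\<^sup>2 \<le> 2 * (?i y *\<^sub>R (cmod (f y))\<^sup>2) + ?i y *\<^sub>R (e\<^sup>2 / 2)"
      proof (cases "y \<in> {X n..X n + d}")
        case True
        then have "cmod (f (X n + (y - X n)) - f (X n)) \<le> e / 2" by (intro d) auto
        then have "(cmod (f y - f (X n)))\<^sup>2 \<le> (e / 2)\<^sup>2" by (intro power_mono) auto
        moreover have "(cmod (f (X n)))\<^sup>2 \<le> 2 * (cmod (f y))\<^sup>2 + 2 * (cmod (f y - f (X n)))\<^sup>2"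
          using norm_diff_power2_le[of "f y" "f y - f (X n)"] by simp
        moreover have "2 * (e / 2)\<^sup>2 = e\<^sup>2 / 2" by (simp add: power2_eq_square)
        ultimately have "(cmod (f (X n)))\<^sup>2 \<le> 2 * (cmod (f y))\<^sup>2 + e\<^sup>2 / 2" by linarith
        then show ?thesis using True by simp
      qed simp
    qed
    also have "\<dots> = 2 * J n + (LINT y|lborel. ?i y *\<^sub>R (e\<^sup>2 / 2))"
      unfolding J_def integral_mult_right_zero[symmetric]
      by (intro Bochner_Integration.integral_add integrable_mult_right Ji integrable_indicator_mult_continuous continuous_intros)
    finally have "d * (cmod (f (X n)))\<^sup>2 \<le> 2 * J n + d * (e\<^sup>2 / 2)" using d(1) by simp
    also have "\<dots> < d * e\<^sup>2"
    proof -
      have "d * (e\<^sup>2 / 8) = d * e\<^sup>2 / 8" "d * (e\<^sup>2 / 2) = d * e\<^sup>2 / 2" by simp_all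
      moreover have "0 < d * e\<^sup>2" using d(1) e by simp
      ultimately show ?thesis using n0[OF that] by linarith
    qed
    finally have "(cmod (f (X n)))\<^sup>2 < e\<^sup>2" using d(1) by simp
    then show ?thesis using e by (simp add: power2_less_imp_less)
  qed
  then show "\<exists>n0. \<forall>n\<ge>n0. norm (ift F (X n) - 0) < e" unfolding f_def by auto
qed

text \<open>For a fixed step the sum is known exactly, but aliased: the cut-off acts on folded
  frequencies. Decay of the samples together with the \<open>O(1/n)\<close> kernel gives the
  Tauberian condition; the bound 1 on the averaged kernels makes the modulus of \<open>F\<close> a
  majorant for the averages.\<close>

proposition sampling_series:
  assumes F: "integrable lborel F" and F2: "integrable lborel (\<lambda>w. (F w)\<^sup>2)" and h: "h > 0"
  shows "(\<lambda>N. \<Sum>n = - int N..int N. ift F (of_int n * h) * plus_kernel (w / h - of_int n))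
    \<longlonglongrightarrow> (LINT v|lborel. of_real (F v) * half_band (w / h) (wrap (v * h))) / (2 * of_real pi)"
proof (rule symmetric_sums_from_cesaro)
  have [measurable]: "F \<in> borel_measurable borel" using F by auto
  let ?b = "\<lambda>n. ift F (of_int n * h) * plus_kernel (w / h - of_int n)"
  \<comment> \<open>The sign \<open>s\<close> treats both tails of the series at once.\<close>
  have lim: "(\<lambda>j. of_nat (Suc j) * ?b (s * int (Suc j))) \<longlonglongrightarrow> 0" if s: "\<bar>s\<bar> = 1" for s :: int
  proof (rule Lim_null_comparison)
    define C where "C = 2 * \<bar>w / h\<bar> + 2"
    show "\<forall>\<^sub>F j in sequentially. norm (of_nat (Suc j) * ?b (s * int (Suc j))) \<le> C * cmod (ift F (of_int (s * int (Suc j)) * h))"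
    proof (rule always_eventually, rule allI)
      fix j
      have "\<bar>real_of_int (s * int (Suc j))\<bar> = real (Suc j)" using s by (simp add: abs_mult flip: of_int_abs del: of_nat_Suc)
      then have "real (Suc j) * cmod (plus_kernel (w / h - of_int (s * int (Suc j)))) \<le> C"
        using norm_plus_kernel_decay[of "s * int (Suc j)" "w / h"] by (simp only: C_def)
      then have "real (Suc j) * cmod (plus_kernel (w / h - of_int (s * int (Suc j)))) * cmod (ift F (of_int (s * int (Suc j)) * h))
          \<le> C * cmod (ift F (of_int (s * int (Suc j)) * h))" by (intro mult_right_mono) auto
      then show "norm (of_nat (Suc j) * ?b (s * int (Suc j))) \<le> C * cmod (ift F (of_int (s * int (Suc j)) * h))"
        by (simp only: norm_mult norm_of_nat mult_ac)
    qed
    have "filterlim (\<lambda>j. \<bar>of_int (s * int (Suc j)) * h\<bar>) at_top sequentially"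
    proof -
      have "\<bar>of_int (s * int (Suc j)) * h\<bar> = h * real (Suc j)" for j
      proof -
        have "\<bar>of_int (s * int (Suc j)) * h\<bar> = \<bar>real_of_int s\<bar> * real (Suc j) * h" using h by (simp add: abs_mult)
        also have "\<bar>real_of_int s\<bar> = 1" using s by linarith
        finally show ?thesis by simp
      qed
      moreover have "filterlim (\<lambda>j. h * real (Suc j)) at_top sequentially"
        using h by (intro filterlim_tendsto_pos_mult_at_top[OF tendsto_const] filterlim_compose[OF filterlim_real_sequentially] filterlim_Suc)
      ultimately show ?thesis by (simp only:)
    qed
    from ift_vanishes_at_infinity[OF F F2 this]
    have "(\<lambda>j. ift F (of_int (s * int (Suc j)) * h)) \<longlonglongrightarrow> 0" .
    then show "(\<lambda>j. C * cmod (ift F (of_int (s * int (Suc j)) * h))) \<longlonglongrightarrow> 0"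
      by (intro tendsto_mult_right_zero tendsto_norm_zero)
  qed
  show "(\<lambda>j. of_nat (Suc j) * (?b (int (Suc j)) + ?b (- int (Suc j)))) \<longlonglongrightarrow> 0"
    using tendsto_add[OF lim[of 1] lim[of "-1"]] by (simp add: distrib_left del: of_nat_Suc)
  let ?e = "\<lambda>n v. exp (\<i> * of_int n * complex_of_real (v * h)) * plus_kernel (w / h - of_int n)"
  have int: "integrable lborel (\<lambda>v. complex_of_real (F v) * ?e n v)" for n
  proof -
    have "integrable lborel (\<lambda>v. complex_of_real (F v) * exp (\<i> * of_real v * of_real (of_int n * h)) * plus_kernel (w / h - of_int n))"
      by (intro integrable_mult_left integrable_of_real_mult_exp F)
    then show ?thesis by (simp add: mult_ac)
  qed
  \<comment> \<open>Each sample is an integral over frequencies in which \<open>v * h\<close> plays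
    the part of the Fourier variable, so summation over \<open>n\<close> can act on the kernel alone
    under the integral.\<close>
  have b: "?b n = (LINT v|lborel. complex_of_real (F v) * ?e n v) / (2 * of_real pi)" for n
  proof -
    have "complex_of_real (F v) * exp (\<i> * of_real v * of_real (of_int n * h)) * plus_kernel (w / h - of_int n) = complex_of_real (F v) * ?e n v" for v
      by (simp add: mult_ac)
    then have "(LINT v|lborel. complex_of_real (F v) * exp (\<i> * of_real v * of_real (of_int n * h))) * plus_kernel (w / h - of_int n)
        = (LINT v|lborel. complex_of_real (F v) * ?e n v)"
      by (simp only: integral_mult_left_zero[symmetric])
    then show ?thesis unfolding ift_def by (simp only: times_divide_eq_left)
  qed
  have sigma: "(\<Sum>M<Suc N. \<Sum>n = - int M..int M. ?b n) / of_nat (Suc N)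
      = (LINT v|lborel. complex_of_real (F v) * cesaro_kernel (Suc N) (w / h) (v * h)) / (2 * of_real pi)" for N
  proof -
    have "(\<Sum>M<Suc N. \<Sum>n = - int M..int M. ?b n) / of_nat (Suc N)
        = (\<Sum>M<Suc N. \<Sum>n = - int M..int M. (LINT v|lborel. complex_of_real (F v) * ?e n v)) / of_nat (Suc N) / (2 * of_real pi)"
      unfolding b by (simp only: sum_divide_distrib[symmetric] divide_divide_eq_left mult.commute)
    also have "(\<Sum>M<Suc N. \<Sum>n = - int M..int M. (LINT v|lborel. complex_of_real (F v) * ?e n v)) / of_nat (Suc N)
        = (LINT v|lborel. (\<Sum>M<Suc N. \<Sum>n = - int M..int M. complex_of_real (F v) * ?e n v) / of_nat (Suc N))"
      by (simp only: integral_divide_zero Bochner_Integration.integral_sum int Bochner_Integration.integrable_sum)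
    also have "\<dots> = (LINT v|lborel. complex_of_real (F v) * cesaro_kernel (Suc N) (w / h) (v * h))"
      unfolding cesaro_kernel_def by (simp only: sum_distrib_left[symmetric] times_divide_eq_right)
    finally show ?thesis .
  qed
  have "(\<lambda>N. LINT v|lborel. complex_of_real (F v) * cesaro_kernel (Suc N) (w / h) (v * h))
      \<longlonglongrightarrow> (LINT v|lborel. complex_of_real (F v) * half_band (w / h) (wrap (v * h)))"
  proof (rule integral_dominated_convergence[where w = "\<lambda>v. \<bar>F v\<bar>"])
    show "AE v in lborel. (\<lambda>N. complex_of_real (F v) * cesaro_kernel (Suc N) (w / h) (v * h))
        \<longlonglongrightarrow> complex_of_real (F v) * half_band (w / h) (wrap (v * h))"
      using AE_wrap[OF h] by eventually_elim (intro tendsto_intros cesaro_kernel_tendsto, auto)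
    show "AE v in lborel. norm (complex_of_real (F v) * cesaro_kernel (Suc N) (w / h) (v * h)) \<le> \<bar>F v\<bar>" for N
      using norm_cesaro_kernel_le[of "Suc N"] by (auto simp: norm_mult intro!: mult_left_le)
    show "(\<lambda>v. complex_of_real (F v) * cesaro_kernel (Suc N) (w / h) (v * h)) \<in> borel_measurable lborel" for N
      unfolding cesaro_kernel_def by measurable
  qed (use F in auto)
  then show "(\<lambda>N. (\<Sum>M<Suc N. \<Sum>n = - int M..int M. ?b n) / of_nat (Suc N))
      \<longlonglongrightarrow> (LINT v|lborel. complex_of_real (F v) * half_band (w / h) (wrap (v * h))) / (2 * of_real pi)"
    unfolding sigma by (intro tendsto_intros) auto
qed

text \<open>At a frequency \<open>v\<close> folding is trivial as soon as
  \<open>\<bar>v * h\<bar> < pi\<close>, and \<open>(w / h) * (v * h) = w * v\<close>. The integrand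
  is then exactly that of the limit, hence eventually constant along every sequence of
  steps.\<close>

lemma sampling_limit:
  assumes F: "integrable lborel F"
  shows "((\<lambda>h. (LINT v|lborel. of_real (F v) * half_band (w / h) (wrap (v * h))) / (2 * of_real pi))
    \<longlongrightarrow> ift (\<lambda>v. indicator {0..} v * F v) w) (at_right 0)"
proof -
  have [measurable]: "F \<in> borel_measurable borel" using F by auto
  have "((\<lambda>h. LINT v|lborel. of_real (F v) * half_band (w / h) (wrap (v * h)))
      \<longlongrightarrow> (LINT v|lborel. complex_of_real (indicator {0..} v * F v) * exp (\<i> * of_real v * of_real w))) (at_right 0)"
    unfolding tendsto_at_iff_sequentially o_def
  proof (intro allI impI)
    fix X assume X: "\<forall>i. X i \<in> {0<..} - {0}" "X \<longlonglongrightarrow> (0::real)"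
    show "(\<lambda>n. LINT v|lborel. of_real (F v) * half_band (w / X n) (wrap (v * X n)))
      \<longlonglongrightarrow> (LINT v|lborel. complex_of_real (indicator {0..} v * F v) * exp (\<i> * of_real v * of_real w))"
    proof (rule integral_dominated_convergence[where w = "\<lambda>v. \<bar>F v\<bar>"])
      show "AE v in lborel. (\<lambda>n. complex_of_real (F v) * half_band (w / X n) (wrap (v * X n)))
          \<longlonglongrightarrow> complex_of_real (indicator {0..} v * F v) * exp (\<i> * of_real v * of_real w)"
      proof (rule AE_I2)
        fix v
        have "(\<lambda>n. \<bar>v * X n\<bar>) \<longlonglongrightarrow> \<bar>v * 0\<bar>" by (intro tendsto_intros X)
        then have "\<forall>\<^sub>F n in sequentially. \<bar>v * X n\<bar> < pi" by (intro order_tendstoD(2)) auto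
        then have "\<forall>\<^sub>F n in sequentially. complex_of_real (indicator {0..} v * F v) * exp (\<i> * of_real v * of_real w)
            = complex_of_real (F v) * half_band (w / X n) (wrap (v * X n))"
        proof eventually_elim
          case (elim n)
          have Xn: "X n > 0" using X(1) by auto
          then have "v * X n \<in> {0..pi} \<longleftrightarrow> v \<in> {0..}" using elim by (auto simp: zero_le_mult_iff)
          moreover have "\<i> * of_real (w / X n) * of_real (v * X n) = \<i> * complex_of_real v * complex_of_real w"
            using Xn by simp
          ultimately show ?case
            unfolding wrap_eq_self[OF elim] half_band_def by (simp add: indicator_def)
        qed
        then show "(\<lambda>n. complex_of_real (F v) * half_band (w / X n) (wrap (v * X n)))
          \<longlonglongrightarrow> complex_of_real (indicator {0..} v * F v) * exp (\<i> * of_real v * of_real w)"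
          by (rule Lim_transform_eventually[OF tendsto_const])
      qed
      show "AE v in lborel. norm (complex_of_real (F v) * half_band (w / X n) (wrap (v * X n))) \<le> \<bar>F v\<bar>" for n
        using norm_half_band_le_1 by (auto simp: norm_mult intro!: mult_left_le)
    qed (use F in auto)
  qed
  then show ?thesis unfolding ift_def by (intro tendsto_intros) auto
qed

proposition sampling_series_plus:
  assumes F: "integrable lborel F" and F2: "integrable lborel (\<lambda>w. (F w)\<^sup>2)"
  shows "h > 0 \<Longrightarrow> symmetric_summable (\<lambda>n. ift F (of_int n * h) * plus_kernel (w / h - of_int n))"
    and "((\<lambda>h. symmetric_sum (\<lambda>n. ift F (of_int n * h) * plus_kernel (w / h - of_int n)))
      \<longlongrightarrow> ift (\<lambda>v. indicator {0..} v * F v) w) (at_right 0)"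
proof -
  show "symmetric_summable (\<lambda>n. ift F (of_int n * h) * plus_kernel (w / h - of_int n))" if "h > 0"
    unfolding symmetric_summable_def using sampling_series[OF F F2 that] by (rule convergentI)
  have "\<forall>\<^sub>F h in at_right 0. (LINT v|lborel. of_real (F v) * half_band (w / h) (wrap (v * h))) / (2 * of_real pi)
      = symmetric_sum (\<lambda>n. ift F (of_int n * h) * plus_kernel (w / h - of_int n))"
    using eventually_at_right_less
    by eventually_elim (auto simp: symmetric_sum_def intro!: limI[symmetric] sampling_series F F2)
  with sampling_limit[OF F]
  show "((\<lambda>h. symmetric_sum (\<lambda>n. ift F (of_int n * h) * plus_kernel (w / h - of_int n)))
      \<longlongrightarrow> ift (\<lambda>v. indicator {0..} v * F v) w) (at_right 0)"
    by (rule Lim_transform_eventually)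
qed

text \<open>Reflecting \<open>n\<close> and the frequency axis turns the minus kernel into the plus kernel.\<close>

corollary sampling_series_minus:
  assumes F: "integrable lborel F" and F2: "integrable lborel (\<lambda>w. (F w)\<^sup>2)"
  shows "h > 0 \<Longrightarrow> symmetric_summable (\<lambda>n. ift F (of_int n * h) * minus_kernel (w / h - of_int n))"
    and "((\<lambda>h. symmetric_sum (\<lambda>n. ift F (of_int n * h) * minus_kernel (w / h - of_int n)))
      \<longlongrightarrow> ift (\<lambda>v. indicator {..0} v * F v) w) (at_right 0)"
proof -
  define G where "G v = F (- v)" for v
  have G: "integrable lborel G" using lborel_integrable_real_affine[OF F, of "-1" 0] by (simp add: G_def[abs_def])
  have G2: "integrable lborel (\<lambda>w. (G w)\<^sup>2)" using lborel_integrable_real_affine[OF F2, of "-1" 0] by (simp add: G_def)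
  have sums: "(\<Sum>n = - int N..int N. ift F (of_int n * h) * minus_kernel (w / h - of_int n))
      = (\<Sum>n = - int N..int N. ift G (of_int n * h) * plus_kernel (- w / h - of_int n))" for N h
    by (rule sum.reindex_bij_witness[where i = uminus and j = uminus])
       (auto simp: G_def[abs_def] ift_reflect minus_kernel_eq)
  show "symmetric_summable (\<lambda>n. ift F (of_int n * h) * minus_kernel (w / h - of_int n))" if "h > 0"
    using sampling_series_plus(1)[OF G G2 that] unfolding symmetric_summable_def sums .
  have "ift (\<lambda>v. indicator {0..} v * G v) (- w) = ift (\<lambda>v. indicator {0..} (- v) * F v) w"
    using ift_reflect[of "\<lambda>v. indicator {0..} v * G v" w] by (simp add: G_def)
  also have "(\<lambda>v. indicator {0..} (- v) * F v) = (\<lambda>v. indicator {..0} v * F v)"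
    by (auto simp: indicator_def)
  finally show "((\<lambda>h. symmetric_sum (\<lambda>n. ift F (of_int n * h) * minus_kernel (w / h - of_int n)))
      \<longlongrightarrow> ift (\<lambda>v. indicator {..0} v * F v) w) (at_right 0)"
    using sampling_series_plus(2)[OF G G2, of "- w"] unfolding symmetric_sum_def sums by simp
qed

subsection \<open>The decomposition\<close>

lemma integrable_indicator_mult:
  fixes F :: "real \<Rightarrow> real"
  assumes "integrable lborel F" "A \<in> sets borel"
  shows "integrable lborel (\<lambda>w. indicator A w * F w)"
  using integrable_mult_indicator[of A lborel F] assms by simp

lemma fourier_supported_in_ift:
  assumes F: "integrable lborel F" "\<And>w. 0 \<le> F w" "integrable lborel (\<lambda>w. (F w)\<^sup>2)"
    and "closed S" "\<And>w. w \<notin> S \<Longrightarrow> F w = 0"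
  shows "fourier_supported_in (ift F) S"
  unfolding fourier_supported_in_def
  using has_fourier_transform_ift[OF F] essential_support_subset[OF assms(4), of "\<lambda>w. of_real (F w)"] assms(5)
  by auto

theorem theorem9:
  fixes f :: "real \<Rightarrow> complex"
  assumes "square_integrable f"
    and "positive_definite f"
    and "continuous_on UNIV f"
  shows "\<exists>fminus fplus :: real \<Rightarrow> complex.
      solves_riemann_hilbert f fminus fplus \<and>
      fourier_supported_in fplus {0..} \<and>
      fourier_supported_in fminus {..0} \<and>
      positive_definite fplus \<and>
      positive_definite fminus \<and>
      (\<forall>w. (\<forall>h>0. symmetric_summable (\<lambda>n. f (of_int n * h) * plus_kernel (w / h - of_int n))) \<and>
           ((\<lambda>h. symmetric_sum (\<lambda>n. f (of_int n * h) * plus_kernel (w / h - of_int n)))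
              \<longlongrightarrow> fplus w) (at_right 0)) \<and>
      (\<forall>w. (\<forall>h>0. symmetric_summable (\<lambda>n. f (of_int n * h) * minus_kernel (w / h - of_int n))) \<and>
           ((\<lambda>h. symmetric_sum (\<lambda>n. f (of_int n * h) * minus_kernel (w / h - of_int n)))
              \<longlongrightarrow> fminus w) (at_right 0))"
proof -
  obtain F :: "real \<Rightarrow> real" where F_meas [measurable]: "F \<in> borel_measurable borel"
    and F0: "\<And>w. 0 \<le> F w" and F: "integrable lborel F" and F2: "integrable lborel (\<lambda>w. (F w)\<^sup>2)"
    and f: "f = ift F"
    using spectral_density[OF assms] by metis
  \<comment> \<open>Both half lines contain 0, so the value of \<open>F\<close> there is counted
    twice; the integrals do not see a single point.\<close>
  define P where "P = (\<lambda>w. indicator {0..} w * F w)"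
  define M where "M = (\<lambda>w. indicator {..0} w * F w)"
  have P: "integrable lborel P" "\<And>w. 0 \<le> P w" and M: "integrable lborel M" "\<And>w. 0 \<le> M w"
    unfolding P_def M_def using F0 by (auto intro!: integrable_indicator_mult F)
  have "(P w)\<^sup>2 = indicator {0..} w * (F w)\<^sup>2" "(M w)\<^sup>2 = indicator {..0} w * (F w)\<^sup>2" for w
    by (auto simp: P_def M_def indicator_def)
  then have P2: "integrable lborel (\<lambda>w. (P w)\<^sup>2)" and M2: "integrable lborel (\<lambda>w. (M w)\<^sup>2)"
    by (simp_all add: integrable_indicator_mult F2)
  have "AE w in lborel. w \<noteq> (0 :: real)" by (rule AE_lborel_singleton)
  then have "AE w in lborel. F w = M w + P w"
    by eventually_elim (auto simp: P_def M_def indicator_def)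
  then have "ift F = ift (\<lambda>w. M w + P w)"
    by (intro ift_cong_AE) (auto simp: P_def M_def)
  then have decomposition: "f x = ift M x + ift P x" for x
    by (simp add: f ift_add M P)
  have "holomorphic_boundary_value {z. 0 < Im z} (ift P)"
    by (rule holomorphic_boundary_value_ift[OF P(1)]) (simp add: P_def)
  moreover have "holomorphic_boundary_value {z. Im z < 0} (ift M)"
  proof -
    \<comment> \<open>Negating the frequency moves the support of \<open>M\<close> to the
      nonnegative half line; the reflection of the half plane undoes this.\<close>
    have "integrable lborel (\<lambda>w. M (- w))" using lborel_integrable_real_affine[OF M(1), of "-1" 0] by simp
    then have "holomorphic_boundary_value {z. 0 < Im z} (ift (\<lambda>w. M (- w)))"
      by (rule holomorphic_boundary_value_ift) (simp add: M_def)
    from holomorphic_boundary_value_reflect[OF this] show ?thesis by (simp add: ift_reflect)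
  qed
  ultimately have "solves_riemann_hilbert f (ift M) (ift P)"
    unfolding solves_riemann_hilbert_def using decomposition by blast
  moreover have "fourier_supported_in (ift P) {0..}" "fourier_supported_in (ift M) {..0}"
    by (intro fourier_supported_in_ift P P2 M M2; simp add: P_def M_def)+
  moreover have "positive_definite (ift P)" "positive_definite (ift M)"
    by (rule positive_definite_ift[OF P], rule positive_definite_ift[OF M])
  \<comment> \<open>The series sample the whole of \<open>f\<close>: the two kernels perform the
    splitting, and the limits are literally the inverse transforms of \<open>P\<close> and
    \<open>M\<close>.\<close>
  ultimately show ?thesis
    using sampling_series_plus[OF F F2] sampling_series_minus[OF F F2] unfolding P_def M_def f by blast
qed

end
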